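(* Let $\mathfrak{g}$ be a simple (finite-dimensional) Lie algebra over $k$, let $X=\operatorname{Spec}k[t^{\pm1}]$, and let $\Gamma=\{1,\sigma\}$ be a group of order two. Suppose $\sigma$ acts on $X$ by $\sigma\cdot x=x^{-1}$, $x\in X$, and on $\mathfrak{g}$ by an automorphism of order two. Let $\mathfrak{M}=M(X,\mathfrak{g})^\Gamma$. Then the map $\mathcal{E}\to\mathcal{S}$, $\Psi\mapsto\mathrm{ev}_\Psi$, is a bijection. In particular, all irreducible finite-dimensional representations of $\mathfrak{M}$ are evaluation representations. In particular, this is true for the generalized Onsager algebra $\mathcal{O}(\mathfrak{g})$.
   Context: $k$ is an algebraically closed field of characteristic zero; all tensor products are over $k$. Here $A=k[t^{\pm1}]$ with $\sigma\cdot t=t^{-1}$, and $\mathfrak{M}=M(X,\mathfrak{g})^\Gamma$ is the Lie algebra of $\Gamma$-equivariant regular maps $X\to\mathfrak{g}$ with pointwise operations; equivalently $\mathfrak{M}=(\mathfrak{g}\otimes A)^\Gamma$ for the diagonal action, with bracket $[u\otimes f,v\otimes h]=[u,v]\otimes fh$. The generalized Onsager algebra $\mathcal{O}(\mathfrak{g})$ is the algebra $\mathfrak{M}$ obtained when $\sigma$ acts on $\mathfrak{g}$ by the standard Chevalley involution $\sigma(e_i)=-f_i$, $\sigma(f_i)=-e_i$, $\sigma(h_i)=-h_i$, where $\{e_i,f_i,h_i\}$ is a set of Chevalley generators of $\mathfrak{g}$. $X_{\rm rat}=k^\times$ is the set of $k$-rational points of $X$. For $x\in X_{\rm rat}$ and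 $\alpha=\sum_i u_i\otimes f_i$, put $\alpha(x)=\sum_i f_i(x)u_i$. Let $\Gamma_x=\{g\in\Gamma:g\cdot x=x\}$ and $\mathfrak{g}^x=\{u\in\mathfrak{g}:g\cdot u=u\ \forall g\in\Gamma_x\}$; one has $\alpha(x)\in\mathfrak{g}^x$ for $\alpha\in\mathfrak{M}$. For a finite subset $\mathbf{x}\subseteq X_{\rm rat}$ let $\mathrm{ev}_{\mathbf x}:\mathfrak{M}\to\bigoplus_{x\in\mathbf{x}}\mathfrak{g}^x$, $\alpha\mapsto(\alpha(x))_{x\in\mathbf{x}}$. Given representations $\rho_x:\mathfrak{g}^x\to\operatorname{End}_kV_x$ ($x\in\mathbf{x}$), the evaluation representation $\mathrm{ev}_{\mathbf x}(\rho_x)_{x\in\mathbf{x}}$ of $\mathfrak{M}$ on $\bigotimes_{x\in\mathbf x}V_x$ is the composition of $\mathrm{ev}_{\mathbf x}$ with the tensor product representation of $\bigoplus_{x\in\mathbf{x}}\mathfrak{g}^x$. $\mathcal{R}_x$ is the set of isomorphism classes of irreducible finite-dimensional representations of $\mathfrak{g}^x$, and $\mathcal{R}_X=\bigsqcup_{x\in X_{\rm rat}}\mathcal{R}_x$, with $\Gamma$ acting by $g\cdot[\rho]=[\rho\circ g^{-1}]\in\mathcal{R}_{g\cdot x}$ for $[\rho]\in\mathcal{R}_x$. $\mathcal{E}$ is the set of finitely supported $\Gamma$-equivariant functions $\Psi:X_{\rm rat}\to\mathcal{R}_X$ with $\Psi(x)\in\mathcal{R}_x$, where $\operatorname{supp}\Psi=\{x:\Psi(x)\neq0\}$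 and $0$ denotes the class of the one-dimensional trivial representation. For $\Psi\in\mathcal{E}$, $\mathrm{ev}_\Psi$ is the isomorphism class of $\mathrm{ev}_{\mathbf x}(\Psi(x))_{x\in\mathbf{x}}$, where $\mathbf{x}$ contains exactly one element of each $\Gamma$-orbit in $\operatorname{supp}\Psi$ (independent of the choice); if $\operatorname{supp}\Psi=\emptyset$, it is the class of the trivial representation. $\mathcal{S}$ is the set of isomorphism classes of irreducible finite-dimensional representations of $\mathfrak{M}$. *)

theory Defs
  imports
    "HOL-Computational_Algebra.Polynomial"
    "HOL-Library.Function_Algebras"
    "HOL-Library.FuncSet"
    "HOL-Library.Z2"
begin

section \<open>Lie algebras\<close>

locale lie_algebra = vector_space scale
  for scale :: "'k::field \<Rightarrow> 'g::ab_group_add \<Rightarrow> 'g" (infixr \<open>*s\<close> 75) +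
  fixes bracket :: "'g \<Rightarrow> 'g \<Rightarrow> 'g"
  assumes bracket_add_left: "bracket (x + y) z = bracket x z + bracket y z"
    and bracket_add_right: "bracket x (y + z) = bracket x y + bracket x z"
    and bracket_scale_left: "bracket (c *s x) y = c *s bracket x y"
    and bracket_scale_right: "bracket x (c *s y) = c *s bracket x y"
    and bracket_self: "bracket x x = 0"
    and jacobi: "bracket x (bracket y z) + bracket y (bracket z x) + bracket z (bracket x y) = 0"
begin

definition lie_subalgebra :: "'g set \<Rightarrow> bool" where
  "lie_subalgebra L \<longleftrightarrow> subspace L \<and> (\<forall>x\<in>L. \<forall>y\<in>L. bracket x y \<in> L)"

definition lie_ideal :: "'g set \<Rightarrow> bool" where
  "lie_ideal I \<longleftrightarrow> subspace I \<and> (\<forall>x. \<forall>y\<in>I. bracket x y \<in> I)"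

definition lie_automorphism :: "('g \<Rightarrow> 'g) \<Rightarrow> bool" where
  "lie_automorphism \<sigma> \<longleftrightarrow> Vector_Spaces.linear scale scale \<sigma> \<and> bij \<sigma> \<and>
     (\<forall>x y. \<sigma> (bracket x y) = bracket (\<sigma> x) (\<sigma> y))"

text \<open>Cartan subalgebras are nilpotent self-normalizing subalgebras.\<close>

primrec lower_central :: "'g set \<Rightarrow> nat \<Rightarrow> 'g set" where
  "lower_central H 0 = H"
| "lower_central H (Suc n) = span {bracket x y | x y. x \<in> H \<and> y \<in> lower_central H n}"

definition cartan_subalgebra :: "'g set \<Rightarrow> bool" where
  "cartan_subalgebra H \<longleftrightarrow> lie_subalgebra H \<and> (\<exists>n. lower_central H n = {0}) \<and>
     {u. \<forall>x\<in>H. bracket u x \<in> H} = H"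

text \<open>Linear forms on a subspace \<open>H\<close> are functions on the ambient type that vanish off \<open>H\<close>,
  so that equal forms are equal as functions.\<close>

definition dual :: "'g set \<Rightarrow> ('g \<Rightarrow> 'k) set" where
  "dual H = {\<phi>. (\<forall>x\<in>H. \<forall>y\<in>H. \<phi> (x + y) = \<phi> x + \<phi> y) \<and> (\<forall>c. \<forall>x\<in>H. \<phi> (c *s x) = c * \<phi> x) \<and>
     (\<forall>x. x \<notin> H \<longrightarrow> \<phi> x = 0)}"

definition root_space :: "'g set \<Rightarrow> ('g \<Rightarrow> 'k) \<Rightarrow> 'g set" where
  "root_space H \<alpha> = {u. \<forall>x\<in>H. bracket x u = \<alpha> x *s u}"

definition roots :: "'g set \<Rightarrow> ('g \<Rightarrow> 'k) set" where
  "roots H = {\<alpha> \<in> dual H. \<alpha> \<noteq> (\<lambda>_. 0) \<and> root_space H \<alpha> \<noteq> {0}}"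

definition simple_roots :: "'g set \<Rightarrow> 'i set \<Rightarrow> ('i \<Rightarrow> 'g \<Rightarrow> 'k) \<Rightarrow> bool" where
  "simple_roots H I \<alpha> \<longleftrightarrow> finite I \<and> (\<forall>i\<in>I. \<alpha> i \<in> roots H) \<and>
     (\<forall>c. (\<forall>x\<in>H. (\<Sum>i\<in>I. c i * \<alpha> i x) = 0) \<longrightarrow> (\<forall>i\<in>I. c i = 0)) \<and>
     (\<forall>\<beta>\<in>roots H. \<exists>m :: 'i \<Rightarrow> int. ((\<forall>i\<in>I. 0 \<le> m i) \<or> (\<forall>i\<in>I. m i \<le> 0)) \<and>
        (\<forall>x\<in>H. \<beta> x = (\<Sum>i\<in>I. of_int (m i) * \<alpha> i x)))"

definition chevalley_generators ::
    "'i set \<Rightarrow> ('i \<Rightarrow> 'g) \<Rightarrow> ('i \<Rightarrow> 'g) \<Rightarrow> ('i \<Rightarrow> 'g) \<Rightarrow> bool" where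
  "chevalley_generators I e f h \<longleftrightarrow>
     (\<exists>H \<alpha>. cartan_subalgebra H \<and> simple_roots H I \<alpha> \<and>
        (\<forall>i\<in>I. e i \<in> root_space H (\<alpha> i) \<and> f i \<in> root_space H (\<lambda>x. - \<alpha> i x) \<and>
           h i \<in> H \<and> bracket (e i) (f i) = h i \<and> \<alpha> i (h i) = 2)) \<and>
     (\<forall>L. lie_subalgebra L \<and> e ` I \<union> f ` I \<union> h ` I \<subseteq> L \<longrightarrow> L = UNIV)"

definition chevalley_involution ::
    "'i set \<Rightarrow> ('i \<Rightarrow> 'g) \<Rightarrow> ('i \<Rightarrow> 'g) \<Rightarrow> ('i \<Rightarrow> 'g) \<Rightarrow> ('g \<Rightarrow> 'g) \<Rightarrow> bool" where
  "chevalley_involution I e f h \<sigma> \<longleftrightarrow> lie_automorphism \<sigma> \<and>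
     (\<forall>i\<in>I. \<sigma> (e i) = - f i \<and> \<sigma> (f i) = - e i \<and> \<sigma> (h i) = - h i)"

end

locale simple_lie_algebra = lie_algebra +
  assumes finite_dim: "\<exists>B. finite B \<and> span B = UNIV"
    and nonabelian: "\<exists>x y. bracket x y \<noteq> 0"
    and simple: "lie_ideal I \<Longrightarrow> I = {0} \<or> I = UNIV"


section \<open>Representations\<close>

text \<open>A Lie algebra is given here by a carrier \<open>L\<close> inside a type with scalar multiplication
  \<open>sL\<close> and bracket \<open>bL\<close>, a representation space by a carrier \<open>V\<close> inside a type with scalar
  multiplication \<open>sV\<close>.  The values \<open>\<rho> a v\<close> only matter for \<open>a \<in> L\<close> and \<open>v \<in> V\<close>.\<close>

definition lie_representation ::
    "('k::field \<Rightarrow> 'l::ab_group_add \<Rightarrow> 'l) \<Rightarrow> ('l \<Rightarrow> 'l \<Rightarrow> 'l) \<Rightarrow> 'l set \<Rightarrow>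
     ('k \<Rightarrow> 'v::ab_group_add \<Rightarrow> 'v) \<Rightarrow> 'v set \<Rightarrow> ('l \<Rightarrow> 'v \<Rightarrow> 'v) \<Rightarrow> bool" where
  "lie_representation sL bL L sV V \<rho> \<longleftrightarrow>
     vector_space sV \<and> module.subspace sV V \<and>
     (\<forall>a\<in>L. \<forall>v\<in>V. \<rho> a v \<in> V) \<and>
     (\<forall>a\<in>L. \<forall>v\<in>V. \<forall>w\<in>V. \<rho> a (v + w) = \<rho> a v + \<rho> a w) \<and>
     (\<forall>a\<in>L. \<forall>c. \<forall>v\<in>V. \<rho> a (sV c v) = sV c (\<rho> a v)) \<and>
     (\<forall>a\<in>L. \<forall>b\<in>L. \<forall>v\<in>V. \<rho> (a + b) v = \<rho> a v + \<rho> b v) \<and>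
     (\<forall>c. \<forall>a\<in>L. \<forall>v\<in>V. \<rho> (sL c a) v = sV c (\<rho> a v)) \<and>
     (\<forall>a\<in>L. \<forall>b\<in>L. \<forall>v\<in>V. \<rho> (bL a b) v = \<rho> a (\<rho> b v) - \<rho> b (\<rho> a v))"

definition finite_dimensional :: "('k::field \<Rightarrow> 'v::ab_group_add \<Rightarrow> 'v) \<Rightarrow> 'v set \<Rightarrow> bool" where
  "finite_dimensional sV V \<longleftrightarrow> (\<exists>B. finite B \<and> module.span sV B = V)"

definition irreducible_rep ::
    "'l set \<Rightarrow> ('k::field \<Rightarrow> 'v::ab_group_add \<Rightarrow> 'v) \<Rightarrow> 'v set \<Rightarrow> ('l \<Rightarrow> 'v \<Rightarrow> 'v) \<Rightarrow> bool" where
  "irreducible_rep L sV V \<rho> \<longleftrightarrow> V \<noteq> {0} \<and>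
     (\<forall>U. module.subspace sV U \<and> U \<subseteq> V \<and> (\<forall>a\<in>L. \<forall>u\<in>U. \<rho> a u \<in> U) \<longrightarrow> U = {0} \<or> U = V)"

definition rep_iso ::
    "'l set \<Rightarrow> ('k::field \<Rightarrow> 'v::ab_group_add \<Rightarrow> 'v) \<Rightarrow> 'v set \<Rightarrow> ('l \<Rightarrow> 'v \<Rightarrow> 'v) \<Rightarrow>
     ('k \<Rightarrow> 'w::ab_group_add \<Rightarrow> 'w) \<Rightarrow> 'w set \<Rightarrow> ('l \<Rightarrow> 'w \<Rightarrow> 'w) \<Rightarrow> bool" where
  "rep_iso L sV V \<rho> sW W \<tau> \<longleftrightarrow>
     (\<exists>T. bij_betw T V W \<and>
        (\<forall>v\<in>V. \<forall>w\<in>V. T (v + w) = T v + T w) \<and> (\<forall>c. \<forall>v\<in>V. T (sV c v) = sW c (T v)) \<and>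
        (\<forall>a\<in>L. \<forall>v\<in>V. T (\<rho> a v) = \<tau> a (T v)))"

definition fun_scale :: "('k \<Rightarrow> 'v \<Rightarrow> 'v) \<Rightarrow> 'k \<Rightarrow> ('i \<Rightarrow> 'v) \<Rightarrow> 'i \<Rightarrow> 'v" where
  "fun_scale s c v = (\<lambda>i. s c (v i))"

abbreviation coord_scale :: "'k::field \<Rightarrow> ('i \<Rightarrow> 'k) \<Rightarrow> 'i \<Rightarrow> 'k" where
  "coord_scale \<equiv> fun_scale (*)"

text \<open>Isomorphism classes need a universe of representation spaces.  Since every
  finite-dimensional space is isomorphic to a subspace of the space \<open>nat \<Rightarrow> 'k\<close> of all sequences,
  the class of an arbitrary representation is taken to be the set of all representations on
  subspaces of \<open>nat \<Rightarrow> 'k\<close> that are isomorphic to it.\<close>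

type_synonym ('k, 'l) rep = "(nat \<Rightarrow> 'k) set \<times> ('l \<Rightarrow> (nat \<Rightarrow> 'k) \<Rightarrow> (nat \<Rightarrow> 'k))"

definition rep_class ::
    "('k::field \<Rightarrow> 'l::ab_group_add \<Rightarrow> 'l) \<Rightarrow> ('l \<Rightarrow> 'l \<Rightarrow> 'l) \<Rightarrow> 'l set \<Rightarrow>
     ('k \<Rightarrow> 'v::ab_group_add \<Rightarrow> 'v) \<Rightarrow> 'v set \<Rightarrow> ('l \<Rightarrow> 'v \<Rightarrow> 'v) \<Rightarrow> ('k, 'l) rep set" where
  "rep_class sL bL L sV V \<rho> =
     {(W, \<tau>). lie_representation sL bL L coord_scale W \<tau> \<and> rep_iso L sV V \<rho> coord_scale W \<tau>}"

definition irreps ::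
    "('k::field \<Rightarrow> 'l::ab_group_add \<Rightarrow> 'l) \<Rightarrow> ('l \<Rightarrow> 'l \<Rightarrow> 'l) \<Rightarrow> 'l set \<Rightarrow> ('k, 'l) rep set set" where
  "irreps sL bL L =
     {rep_class sL bL L coord_scale V \<rho> | (V :: (nat \<Rightarrow> 'k) set) \<rho>.
        lie_representation sL bL L coord_scale V \<rho> \<and> finite_dimensional coord_scale V \<and>
        irreducible_rep L coord_scale V \<rho>}"

definition trivial_class ::
    "('k::field \<Rightarrow> 'l::ab_group_add \<Rightarrow> 'l) \<Rightarrow> ('l \<Rightarrow> 'l \<Rightarrow> 'l) \<Rightarrow> 'l set \<Rightarrow> ('k, 'l) rep set" where
  "trivial_class sL bL L = rep_class sL bL L (*) (UNIV :: 'k set) (\<lambda>_ _. 0)"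


subsection \<open>Tensor products over a finite set\<close>

text \<open>For subspaces \<open>V x\<close> of \<open>nat \<Rightarrow> 'k\<close>, \<open>x \<in> X\<close>, the tensor product is realised inside the
  functions of a multi-index \<open>i \<in> extensional X\<close>, a pure tensor having the coordinate
  \<open>\<Prod>x\<in>X. v x (i x)\<close> at \<open>i\<close>.  For \<open>X = {}\<close> this is a one-dimensional space.\<close>

definition pure_tensor :: "'p set \<Rightarrow> ('p \<Rightarrow> nat \<Rightarrow> 'k::field) \<Rightarrow> ('p \<Rightarrow> nat) \<Rightarrow> 'k" where
  "pure_tensor X v = (\<lambda>i. if i \<in> extensional X then \<Prod>x\<in>X. v x (i x) else 0)"

definition tensor_space :: "'p set \<Rightarrow> ('p \<Rightarrow> (nat \<Rightarrow> 'k::field) set) \<Rightarrow> (('p \<Rightarrow> nat) \<Rightarrow> 'k) set" where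
  "tensor_space X V = module.span coord_scale {pure_tensor X v | v. \<forall>x\<in>X. v x \<in> V x}"

text \<open>\<open>a = (a x)\<close> acts by the sum over \<open>x\<close> of \<open>id \<otimes> \<dots> \<otimes> \<rho> x (a x) \<otimes> \<dots> \<otimes> id\<close>: the operator
  \<open>\<rho> x (a x)\<close> is applied to the function of the single index \<open>j\<close> obtained by freezing all other
  indices.  See \<open>tensor_rep_pure_tensor\<close> below.\<close>

definition tensor_rep ::
    "'p set \<Rightarrow> ('p \<Rightarrow> 'l \<Rightarrow> (nat \<Rightarrow> 'k) \<Rightarrow> (nat \<Rightarrow> 'k)) \<Rightarrow> ('p \<Rightarrow> 'l) \<Rightarrow>
     (('p \<Rightarrow> nat) \<Rightarrow> 'k::field) \<Rightarrow> ('p \<Rightarrow> nat) \<Rightarrow> 'k" where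
  "tensor_rep X \<rho> a w =
     (\<lambda>i. if i \<in> extensional X then \<Sum>x\<in>X. \<rho> x (a x) (\<lambda>j. w (i(x := j))) (i x) else 0)"

lemma tensor_rep_pure_tensor:
  assumes "finite X" and "\<forall>x\<in>X. v x \<in> V x"
    and "\<forall>x\<in>X. lie_representation sL bL (L x) coord_scale (V x) (\<rho> x)" and "\<forall>x\<in>X. a x \<in> L x"
  shows "tensor_rep X \<rho> a (pure_tensor X v) =
    (\<lambda>i. \<Sum>x\<in>X. pure_tensor X (v(x := \<rho> x (a x) (v x))) i)"
proof
  fix i :: "'a \<Rightarrow> nat"
  show "tensor_rep X \<rho> a (pure_tensor X v) i =
    (\<Sum>x\<in>X. pure_tensor X (v(x := \<rho> x (a x) (v x))) i)"
  proof (cases "i \<in> extensional X")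
    case False
    then show ?thesis by (simp add: tensor_rep_def pure_tensor_def)
  next
    case True
    have "\<rho> x (a x) (\<lambda>j. pure_tensor X v (i(x := j))) (i x) =
        pure_tensor X (v(x := \<rho> x (a x) (v x))) i" if x: "x \<in> X" for x
    proof -
      let ?c = "\<Prod>y\<in>X - {x}. v y (i y)"
      have "pure_tensor X v (i(x := j)) = v x j * ?c" for j
      proof -
        have "i(x := j) \<in> extensional X" using True x by (auto simp: extensional_def)
        moreover have "(\<Prod>y\<in>X - {x}. v y ((i(x := j)) y)) = ?c" by (rule prod.cong) auto
        ultimately show ?thesis
          using x assms(1) by (simp add: pure_tensor_def prod.remove)
      qed
      then have "(\<lambda>j. pure_tensor X v (i(x := j))) = coord_scale ?c (v x)"
        by (auto simp: fun_scale_def)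
      moreover have "\<rho> x (a x) (coord_scale ?c (v x)) = coord_scale ?c (\<rho> x (a x) (v x))"
        using assms x unfolding lie_representation_def by blast
      moreover have "pure_tensor X (v(x := \<rho> x (a x) (v x))) i = \<rho> x (a x) (v x) (i x) * ?c"
      proof -
        have "(\<Prod>y\<in>X - {x}. (v(x := \<rho> x (a x) (v x))) y (i y)) = ?c" by (rule prod.cong) auto
        then show ?thesis using True x assms(1) by (simp add: pure_tensor_def prod.remove)
      qed
      ultimately show ?thesis by (simp add: fun_scale_def)
    qed
    then show ?thesis using True by (simp add: tensor_rep_def)
  qed
qed


section \<open>The action of a group of order two\<close>

text \<open>\<open>\<Gamma>\<close> is the additive group of the type \<open>bit\<close>: \<open>0\<close> is its neutral element and \<open>1\<close> is
  \<open>\<sigma>\<close>.\<close>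

definition X_rat :: "'k::field set" where
  "X_rat = {x. x \<noteq> 0}"

definition act_X :: "bit \<Rightarrow> 'k::field \<Rightarrow> 'k" where
  "act_X \<gamma> x = (if \<gamma> = 0 then x else inverse x)"

definition act_g :: "('g \<Rightarrow> 'g) \<Rightarrow> bit \<Rightarrow> 'g \<Rightarrow> 'g" where
  "act_g \<sigma> \<gamma> u = (if \<gamma> = 0 then u else \<sigma> u)"

definition stabilizer :: "'k::field \<Rightarrow> bit set" where
  "stabilizer x = {\<gamma>. act_X \<gamma> x = x}"

definition fixed_algebra :: "('g \<Rightarrow> 'g) \<Rightarrow> 'k::field \<Rightarrow> 'g set" where
  "fixed_algebra \<sigma> x = {u. \<forall>\<gamma>\<in>stabilizer x. act_g \<sigma> \<gamma> u = u}"


section \<open>The equivariant map algebra\<close>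

text \<open>A regular map \<open>k\<^sup>\<times> \<rightarrow> \<gg>\<close> is a Laurent polynomial \<open>x \<mapsto> \<Sum>n. x\<^sup>n c\<^sub>n\<close> with
  coefficients in \<open>\<gg>\<close> (that is, an element of \<open>\<gg> \<otimes> k[t, t\<inverse>]\<close>; the field is infinite).
  Being functions on all of \<open>'k\<close>, regular maps get the value \<open>0\<close> at the point \<open>0\<close>, which is not
  in \<open>X_rat\<close>.\<close>

definition regular_maps :: "('k::field \<Rightarrow> 'g::ab_group_add \<Rightarrow> 'g) \<Rightarrow> ('k \<Rightarrow> 'g) set" where
  "regular_maps s = {\<alpha>. \<alpha> 0 = 0 \<and>
     (\<exists>N c. finite N \<and> (\<forall>x\<in>X_rat. \<alpha> x = (\<Sum>n\<in>N. s (x powi n) (c n))))}"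

definition map_algebra ::
    "('k::field \<Rightarrow> 'g::ab_group_add \<Rightarrow> 'g) \<Rightarrow> ('g \<Rightarrow> 'g) \<Rightarrow> ('k \<Rightarrow> 'g) set" where
  "map_algebra s \<sigma> =
     {\<alpha> \<in> regular_maps s. \<forall>\<gamma>. \<forall>x\<in>X_rat. \<alpha> (act_X \<gamma> x) = act_g \<sigma> \<gamma> (\<alpha> x)}"

definition fun_bracket :: "('g \<Rightarrow> 'g \<Rightarrow> 'g) \<Rightarrow> ('k \<Rightarrow> 'g) \<Rightarrow> ('k \<Rightarrow> 'g) \<Rightarrow> 'k \<Rightarrow> 'g" where
  "fun_bracket br \<alpha> \<beta> = (\<lambda>x. br (\<alpha> x) (\<beta> x))"

lemma map_algebra_value_fixed:
  assumes "\<alpha> \<in> map_algebra s \<sigma>" and "x \<in> X_rat"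
  shows "\<alpha> x \<in> fixed_algebra \<sigma> x"
proof -
  have "act_g \<sigma> \<gamma> (\<alpha> x) = \<alpha> (act_X \<gamma> x)" for \<gamma>
    using assms by (simp add: map_algebra_def)
  then show ?thesis by (simp add: fixed_algebra_def stabilizer_def)
qed

lemma lie_algebra_fun:
  assumes "lie_algebra s br"
  shows "lie_algebra (fun_scale s) (fun_bracket br)"
proof -
  interpret lie_algebra s br by fact
  show ?thesis
    by unfold_locales
      (auto simp: fun_scale_def fun_bracket_def fun_eq_iff scale_right_distrib scale_left_distrib
        bracket_add_left bracket_add_right bracket_scale_left bracket_scale_right bracket_self jacobi)
qed

lemma map_algebra_subalgebra:
  assumes "lie_algebra s br" and "lie_algebra.lie_automorphism s br \<sigma>"
  shows "lie_algebra.lie_subalgebra (fun_scale s) (fun_bracket br) (map_algebra s \<sigma>)"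
proof -
  interpret lie_algebra s br by fact
  interpret F: lie_algebra "fun_scale s" "fun_bracket br" by (rule lie_algebra_fun) fact
  have lin: "Vector_Spaces.linear s s \<sigma>" and br: "\<sigma> (br x y) = br (\<sigma> x) (\<sigma> y)" for x y
    using assms(2) by (auto simp: lie_automorphism_def)
  interpret \<sigma>: Vector_Spaces.linear s s \<sigma> by (fact lin)
  have bsl: "br (sum f A) y = (\<Sum>a\<in>A. br (f a) y)" for f :: "int \<Rightarrow> 'b" and A y
    using additive.sum[of "\<lambda>x. br x y" f A] by (simp add: additive_def bracket_add_left)
  have bsr: "br y (sum f A) = (\<Sum>a\<in>A. br y (f a))" for f :: "int \<Rightarrow> 'b" and A y
    using additive.sum[of "br y" f A] by (simp add: additive_def bracket_add_right)
  have reg_add: "\<alpha> + \<beta> \<in> regular_maps s" if "\<alpha> \<in> regular_maps s" "\<beta> \<in> regular_maps s" for \<alpha> \<beta>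
  proof -
    from that obtain N c M d where *: "finite N" "finite M" "\<alpha> 0 = 0" "\<beta> 0 = 0"
      "\<forall>x\<in>X_rat. \<alpha> x = (\<Sum>n\<in>N. s (x powi n) (c n))"
      "\<forall>x\<in>X_rat. \<beta> x = (\<Sum>n\<in>M. s (x powi n) (d n))"
      unfolding regular_maps_def by blast
    let ?e = "\<lambda>n. (if n \<in> N then c n else 0) + (if n \<in> M then d n else 0)"
    have "(\<Sum>n\<in>N. s (x powi n) (c n)) = (\<Sum>n\<in>N \<union> M. s (x powi n) (if n \<in> N then c n else 0))"
      and "(\<Sum>n\<in>M. s (x powi n) (d n)) = (\<Sum>n\<in>N \<union> M. s (x powi n) (if n \<in> M then d n else 0))" for x
      using *(1,2) by (auto intro!: sum.mono_neutral_cong_left)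
    then have "(\<alpha> + \<beta>) x = (\<Sum>n\<in>N \<union> M. s (x powi n) (?e n))" if "x \<in> X_rat" for x
      using * that by (simp add: scale_right_distrib sum.distrib)
    then show ?thesis
      using * unfolding regular_maps_def by (auto intro!: exI[of _ "N \<union> M"] exI[of _ ?e])
  qed
  have reg_scale: "fun_scale s c \<alpha> \<in> regular_maps s" if "\<alpha> \<in> regular_maps s" for c \<alpha>
  proof -
    from that obtain N d where *: "finite N" "\<alpha> 0 = 0"
      "\<forall>x\<in>X_rat. \<alpha> x = (\<Sum>n\<in>N. s (x powi n) (d n))"
      unfolding regular_maps_def by blast
    then have "fun_scale s c \<alpha> x = (\<Sum>n\<in>N. s (x powi n) (s c (d n)))" if "x \<in> X_rat" for x
      using that by (simp add: fun_scale_def scale_sum_right mult.commute)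
    then show ?thesis
      using * unfolding regular_maps_def
      by (auto simp: fun_scale_def intro!: exI[of _ N] exI[of _ "\<lambda>n. s c (d n)"])
  qed
  have reg_br: "fun_bracket br \<alpha> \<beta> \<in> regular_maps s"
    if "\<alpha> \<in> regular_maps s" "\<beta> \<in> regular_maps s" for \<alpha> \<beta>
  proof -
    from that obtain N c M d where *: "finite N" "finite M" "\<alpha> 0 = 0" "\<beta> 0 = 0"
      "\<forall>x\<in>X_rat. \<alpha> x = (\<Sum>n\<in>N. s (x powi n) (c n))"
      "\<forall>x\<in>X_rat. \<beta> x = (\<Sum>n\<in>M. s (x powi n) (d n))"
      unfolding regular_maps_def by blast
    let ?S = "\<lambda>p. {q \<in> N \<times> M. fst q + snd q = p}"
    let ?e = "\<lambda>p. \<Sum>q\<in>?S p. br (c (fst q)) (d (snd q))"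
    let ?P = "(\<lambda>q. fst q + snd q) ` (N \<times> M)"
    have "fun_bracket br \<alpha> \<beta> x = (\<Sum>p\<in>?P. s (x powi p) (?e p))" if x: "x \<in> X_rat" for x
    proof -
      have x0: "x \<noteq> 0" using x by (simp add: X_rat_def)
      have "fun_bracket br \<alpha> \<beta> x =
          (\<Sum>m\<in>M. \<Sum>n\<in>N. s (x powi (n + m)) (br (c n) (d m)))"
        using * x x0
        by (simp add: fun_bracket_def bsl bsr bracket_scale_left bracket_scale_right power_int_add
            scale_sum_right mult.commute)
      also have "\<dots> = (\<Sum>n\<in>N. \<Sum>m\<in>M. s (x powi (n + m)) (br (c n) (d m)))"
        by (rule sum.swap)
      also have "\<dots> = (\<Sum>q\<in>N \<times> M. s (x powi (fst q + snd q)) (br (c (fst q)) (d (snd q))))"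
        by (simp add: sum.cartesian_product case_prod_unfold)
      also have "\<dots> = (\<Sum>p\<in>?P. \<Sum>q\<in>?S p. s (x powi (fst q + snd q)) (br (c (fst q)) (d (snd q))))"
        using * by (intro sum.image_gen) simp
      also have "\<dots> = (\<Sum>p\<in>?P. s (x powi p) (?e p))"
        by (auto simp: scale_sum_right intro!: sum.cong)
      finally show ?thesis .
    qed
    then have "\<exists>P e. finite P \<and> (\<forall>x\<in>X_rat. fun_bracket br \<alpha> \<beta> x = (\<Sum>p\<in>P. s (x powi p) (e p)))"
      using *(1,2) by (intro exI[of _ ?P] exI[of _ ?e]) auto
    moreover have "fun_bracket br \<alpha> \<beta> 0 = 0"
      using * bracket_scale_left[of 0 0 0] by (simp add: fun_bracket_def)
    ultimately show ?thesis by (simp add: regular_maps_def)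
  qed
  have "0 \<in> regular_maps s"
    by (auto simp: regular_maps_def intro!: exI[of _ "{}"])
  then show ?thesis
    unfolding F.lie_subalgebra_def F.subspace_def map_algebra_def
    using reg_add reg_scale reg_br
    by (auto simp: act_g_def fun_scale_def \<sigma>.add \<sigma>.scale \<sigma>.zero fun_bracket_def br)
qed

definition map_rep_class ::
    "('k::field \<Rightarrow> 'g::ab_group_add \<Rightarrow> 'g) \<Rightarrow> ('g \<Rightarrow> 'g \<Rightarrow> 'g) \<Rightarrow> ('g \<Rightarrow> 'g) \<Rightarrow>
     ('k \<Rightarrow> 'v::ab_group_add \<Rightarrow> 'v) \<Rightarrow> 'v set \<Rightarrow> (('k \<Rightarrow> 'g) \<Rightarrow> 'v \<Rightarrow> 'v) \<Rightarrow> ('k, 'k \<Rightarrow> 'g) rep set"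
  where "map_rep_class s br \<sigma> = rep_class (fun_scale s) (fun_bracket br) (map_algebra s \<sigma>)"

text \<open>The set \<open>\<S>\<close>.\<close>

definition map_irreps ::
    "('k::field \<Rightarrow> 'g::ab_group_add \<Rightarrow> 'g) \<Rightarrow> ('g \<Rightarrow> 'g \<Rightarrow> 'g) \<Rightarrow> ('g \<Rightarrow> 'g) \<Rightarrow>
     ('k, 'k \<Rightarrow> 'g) rep set set" where
  "map_irreps s br \<sigma> = irreps (fun_scale s) (fun_bracket br) (map_algebra s \<sigma>)"


section \<open>Evaluation representations\<close>

definition ev :: "'k set \<Rightarrow> ('k \<Rightarrow> 'g) \<Rightarrow> 'k \<Rightarrow> 'g" where
  "ev X \<alpha> = restrict \<alpha> X"

definition ev_rep ::
    "'k set \<Rightarrow> ('k \<Rightarrow> 'g \<Rightarrow> (nat \<Rightarrow> 'k) \<Rightarrow> (nat \<Rightarrow> 'k)) \<Rightarrow> ('k \<Rightarrow> 'g) \<Rightarrow>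
     (('k \<Rightarrow> nat) \<Rightarrow> 'k::field) \<Rightarrow> ('k \<Rightarrow> nat) \<Rightarrow> 'k" where
  "ev_rep X \<rho> = tensor_rep X \<rho> \<circ> ev X"

definition is_evaluation_rep ::
    "('k::field \<Rightarrow> 'g::ab_group_add \<Rightarrow> 'g) \<Rightarrow> ('g \<Rightarrow> 'g \<Rightarrow> 'g) \<Rightarrow> ('g \<Rightarrow> 'g) \<Rightarrow>
     ('k \<Rightarrow> 'v::ab_group_add \<Rightarrow> 'v) \<Rightarrow> 'v set \<Rightarrow> (('k \<Rightarrow> 'g) \<Rightarrow> 'v \<Rightarrow> 'v) \<Rightarrow> bool" where
  "is_evaluation_rep s br \<sigma> sV V \<rho> \<longleftrightarrow>
     (\<exists>X W \<tau>. finite X \<and> X \<subseteq> X_rat \<and>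
        (\<forall>x\<in>X. lie_representation s br (fixed_algebra \<sigma> x) coord_scale (W x) (\<tau> x)) \<and>
        rep_iso (map_algebra s \<sigma>) sV V \<rho> coord_scale (tensor_space X W) (ev_rep X \<tau>))"

text \<open>\<open>\<gamma> \<cdot> [\<rho>] = [\<rho> \<circ> \<gamma>\<inverse>]\<close>.  As classes contain every representation of the universe
  isomorphic to a given one, the image of a class is a class.\<close>

definition act_class :: "('g \<Rightarrow> 'g) \<Rightarrow> bit \<Rightarrow> ('k, 'g) rep set \<Rightarrow> ('k, 'g) rep set" where
  "act_class \<sigma> \<gamma> C = (\<lambda>(V, \<rho>). (V, \<rho> \<circ> act_g \<sigma> (- \<gamma>))) ` C"

definition class_supp ::
    "('k::field \<Rightarrow> 'g::ab_group_add \<Rightarrow> 'g) \<Rightarrow> ('g \<Rightarrow> 'g \<Rightarrow> 'g) \<Rightarrow> ('g \<Rightarrow> 'g) \<Rightarrow>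
     ('k \<Rightarrow> ('k, 'g) rep set) \<Rightarrow> 'k set" where
  "class_supp s br \<sigma> \<Psi> = {x \<in> X_rat. \<Psi> x \<noteq> trivial_class s br (fixed_algebra \<sigma> x)}"

text \<open>The set \<open>\<E>\<close>.  The requirement \<open>\<Psi> x \<in> \<R>\<^sub>x\<close> is part of the dependent function
  space, so the summands of \<open>\<R>\<^sub>X\<close> need no disjointness tags.\<close>

definition equivariant_class_funs ::
    "('k::field \<Rightarrow> 'g::ab_group_add \<Rightarrow> 'g) \<Rightarrow> ('g \<Rightarrow> 'g \<Rightarrow> 'g) \<Rightarrow> ('g \<Rightarrow> 'g) \<Rightarrow>
     ('k \<Rightarrow> ('k, 'g) rep set) set" where
  "equivariant_class_funs s br \<sigma> =
     {\<Psi> \<in> \<Pi>\<^sub>E x\<in>X_rat. irreps s br (fixed_algebra \<sigma> x).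
        finite (class_supp s br \<sigma> \<Psi>) \<and>
        (\<forall>\<gamma>. \<forall>x\<in>X_rat. \<Psi> (act_X \<gamma> x) = act_class \<sigma> \<gamma> (\<Psi> x))}"

definition orbit_transversal :: "'k::field set \<Rightarrow> 'k set \<Rightarrow> bool" where
  "orbit_transversal S X \<longleftrightarrow> X \<subseteq> S \<and> (\<forall>y\<in>S. \<exists>!z. z \<in> X \<and> (\<exists>\<gamma>. z = act_X \<gamma> y))"

text \<open>The class \<open>ev\<^sub>\<Psi>\<close>.  Instead of choosing a transversal \<open>X\<close> and representatives of
  the \<open>\<Psi> x\<close>, the classes obtained from all choices are united; this union belongs to
  \<open>map_irreps\<close> only if all choices give the same class.\<close>

definition ev_class ::
    "('k::field \<Rightarrow> 'g::ab_group_add \<Rightarrow> 'g) \<Rightarrow> ('g \<Rightarrow> 'g \<Rightarrow> 'g) \<Rightarrow> ('g \<Rightarrow> 'g) \<Rightarrow>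
     ('k \<Rightarrow> ('k, 'g) rep set) \<Rightarrow> ('k, 'k \<Rightarrow> 'g) rep set" where
  "ev_class s br \<sigma> \<Psi> =
     \<Union> {map_rep_class s br \<sigma> coord_scale (tensor_space X V) (ev_rep X \<rho>) | X V \<rho>.
          orbit_transversal (class_supp s br \<sigma> \<Psi>) X \<and> (\<forall>x\<in>X. (V x, \<rho> x) \<in> \<Psi> x)}"

end

theory Submission
  imports Defs
begin

text \<open>
  The proof rests on the simplicity of \<open>\<gg>\<close>, linear algebra over an algebraically closed field of
  characteristic zero, and Lagrange interpolation.

  Let \<open>\<gg> = \<gg>0 + \<gg>1\<close> be the decomposition into the eigenspaces of \<open>\<sigma>\<close> for \<open>1\<close> and \<open>-1\<close>, and put
  \<open>z = x + 1 / x\<close> and \<open>w = x - 1 / x\<close>, so that \<open>w\<^sup>2 = z\<^sup>2 - 4\<close>.  Then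
  \<open>\<MM> = \<gg>0 \<otimes> k[z] + \<gg>1 \<otimes> w k[z]\<close> (\<open>map_algebra_decomposition\<close>), and since \<open>\<gg>\<close> is simple,
  \<open>[\<gg>1, \<gg>1] = \<gg>0\<close> and \<open>[\<gg>0, \<gg>1] = \<gg>1\<close> (\<open>\<gg>0_generated\<close>, \<open>\<gg>1_generated\<close>).

  The main point is that an irreducible finite-dimensional representation \<open>V\<close> of \<open>\<MM>\<close> factors through
  the evaluation at a finite set of points (\<open>factors_through_evaluation\<close>).  Because \<open>V\<close> has finite
  dimension, some nonzero \<open>P\<close> in \<open>k[z]\<close> is such that \<open>\<MM> \<inter> (\<gg> \<otimes> P k[x, 1/x])\<close> acts as zero
  (\<open>conductor_exists\<close>).  Let \<open>R\<close> be the product of the factors \<open>z - \<zeta>\<close> over the roots \<open>\<zeta>\<close> of \<open>P\<close> and over \<open>\<plusminus>2\<close>,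
  the values of \<open>z\<close> at the fixed points of the inversion, and let \<open>I\<close> consist of the maps that vanish wherever
  \<open>R(z)\<close> does.  Some power of \<open>I\<close> acts as zero.  By a form of Lie's theorem (\<open>commuting_ideal_scalar\<close>) an
  ideal that acts by commuting operators acts by scalars, and a scalar that is a commutator is zero
  (\<open>commutator_eigenvalue_0\<close>).  Descending along a chain of ideals (\<open>J_descent\<close>), one finds that \<open>I\<close> acts by
  scalars.  It then acts as zero, because \<open>I = [\<MM>, I]\<close>; this is where \<open>\<plusminus>2\<close> and the two bracket identities enter.
  In particular there are no one-dimensional representations other than those coming from the points
  \<open>1\<close> and \<open>-1\<close>.

  So \<open>V\<close> is an irreducible representation of a finite direct sum of the algebras \<open>\<gg>\<^sup>x\<close>, hence a tensor product
  of irreducible representations of the summands (\<open>iso_tensor_product\<close>).  Conversely, evaluation is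
  surjective onto such a sum by interpolation (\<open>evaluation_surjective\<close>), and the Jacobson density theorem
  (\<open>density_separation\<close>) shows that tensor products of irreducible representations are irreducible
  (\<open>tensor_irreducible\<close>).

  That \<open>ev\<^sub>\<Psi>\<close> is well defined rests on the universal property of the tensor product (\<open>tensor_universal\<close>),
  which turns isomorphisms of the factors into one of the tensor products (\<open>tensor_product_iso\<close>); it is
  injective because freezing all indices but one recovers the factor at a given point
  (\<open>ev_class_injective\<close>).  Finally, a Chevalley involution is an automorphism of order two
  (\<open>chevalley_involution_order_two\<close>).
\<close>

section \<open>Operators on finite-dimensional spaces\<close>

definition linear_on ::
    "('k \<Rightarrow> 'v::ab_group_add \<Rightarrow> 'v) \<Rightarrow> ('k \<Rightarrow> 'w::ab_group_add \<Rightarrow> 'w) \<Rightarrow> 'v set \<Rightarrow> ('v \<Rightarrow> 'w) \<Rightarrow> bool"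
  where "linear_on sV sW V f \<longleftrightarrow>
    (\<forall>v\<in>V. \<forall>w\<in>V. f (v + w) = f v + f w) \<and> (\<forall>c. \<forall>v\<in>V. f (sV c v) = sW c (f v))"

lemma linear_on_add: "linear_on sV sW V f \<Longrightarrow> v \<in> V \<Longrightarrow> w \<in> V \<Longrightarrow> f (v + w) = f v + f w"
  and linear_on_scale: "linear_on sV sW V f \<Longrightarrow> v \<in> V \<Longrightarrow> f (sV c v) = sW c (f v)"
  by (auto simp: linear_on_def)

lemma linear_on_0:
  assumes "vector_space sV" "module.subspace sV V" "linear_on sV sW V f"
  shows "f 0 = 0"
proof -
  interpret vector_space sV by fact
  have "f (0 + 0) = f 0 + f 0"
    using assms(2,3) subspace_0 by (auto simp only: linear_on_def)
  then show ?thesis by simp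
qed

lemma linear_on_sum:
  assumes V: "vector_space sV" "module.subspace sV V" and f: "linear_on sV sW V f"
    and g: "\<And>i. i \<in> A \<Longrightarrow> g i \<in> V"
  shows "f (\<Sum>i\<in>A. g i) = (\<Sum>i\<in>A. f (g i))"
proof -
  interpret vector_space sV by fact
  show ?thesis
    using g
  proof (induction A rule: infinite_finite_induct)
    case (insert x A)
    then have "sum g A \<in> V"
      by (intro subspace_sum[OF V(2)]) auto
    with insert show ?case
      by (simp add: linear_on_add[OF f])
  qed (use linear_on_0[OF V f] in simp_all)
qed

lemma linear_on_diff:
  assumes V: "vector_space sV" "module.subspace sV V" "vector_space sW" and f: "linear_on sV sW V f"
    and v: "v \<in> V" "w \<in> V"
  shows "f (v - w) = f v - f w"
proof -
  interpret vector_space sV by fact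
  interpret W: vector_space sW by fact
  have "f (v - w) = f (v + sV (- 1) w)" by simp
  also have "\<dots> = f v + sW (- 1) (f w)"
    using v subspace_scale[OF V(2)] by (simp only: linear_on_add[OF f] linear_on_scale[OF f])
  finally show ?thesis by simp
qed

lemma linear_on_subset: "linear_on sV sW V f \<Longrightarrow> U \<subseteq> V \<Longrightarrow> linear_on sV sW U f"
  unfolding linear_on_def by blast

lemma linear_on_span_eq:
  assumes V: "vector_space sV" "module.subspace sV V" "vector_space sW"
    and f: "linear_on sV sW V f" and g: "linear_on sV sW V g"
    and B: "B \<subseteq> V" "\<And>b. b \<in> B \<Longrightarrow> f b = g b" and v: "v \<in> module.span sV B"
  shows "f v = g v"
proof -
  interpret vector_space sV by fact
  interpret W: vector_space sW by fact
  have "v \<in> V \<and> f v = g v"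
    using v
  proof (induction rule: span_induct_alt)
    case base
    then show ?case using linear_on_0[OF V(1,2) f] linear_on_0[OF V(1,2) g] subspace_0[OF V(2)] by simp
  next
    case (step c b v)
    then have "b \<in> V" "sV c b \<in> V" using B(1) subspace_scale[OF V(2)] by auto
    with step show ?case
      using B(2) subspace_add[OF V(2)]
      by (simp add: linear_on_add[OF f] linear_on_add[OF g] linear_on_scale[OF f] linear_on_scale[OF g])
  qed
  then show ?thesis by simp
qed

locale ac_vector_space = vector_space scale
  for scale :: "'k::{alg_closed_field, field_char_0} \<Rightarrow> 'v::ab_group_add \<Rightarrow> 'v" (infixr \<open>*s\<close> 75)
begin

definition operator_on :: "'v set \<Rightarrow> ('v \<Rightarrow> 'v) \<Rightarrow> bool" where
  "operator_on V f \<longleftrightarrow> (\<forall>v\<in>V. f v \<in> V) \<and> linear_on scale scale V f"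

definition invariant :: "('v \<Rightarrow> 'v) set \<Rightarrow> 'v set \<Rightarrow> bool" where
  "invariant Ops U \<longleftrightarrow> subspace U \<and> (\<forall>f\<in>Ops. \<forall>u\<in>U. f u \<in> U)"

definition irreducible :: "('v \<Rightarrow> 'v) set \<Rightarrow> 'v set \<Rightarrow> bool" where
  "irreducible Ops V \<longleftrightarrow> V \<noteq> {0} \<and> (\<forall>U. invariant Ops U \<and> U \<subseteq> V \<longrightarrow> U = {0} \<or> U = V)"

lemma operator_on_closed: "operator_on V f \<Longrightarrow> v \<in> V \<Longrightarrow> f v \<in> V"
  and operator_on_linear: "operator_on V f \<Longrightarrow> linear_on scale scale V f"
  by (auto simp: operator_on_def)

lemma operator_on_add: "operator_on V f \<Longrightarrow> v \<in> V \<Longrightarrow> w \<in> V \<Longrightarrow> f (v + w) = f v + f w"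
  and operator_on_scale: "operator_on V f \<Longrightarrow> v \<in> V \<Longrightarrow> f (c *s v) = c *s f v"
  by (auto simp: operator_on_def linear_on_def)

lemma operator_on_0: "subspace V \<Longrightarrow> operator_on V f \<Longrightarrow> f 0 = 0"
  using linear_on_0[OF vector_space_axioms] by (auto simp: operator_on_def)

lemma operator_on_diff:
  "subspace V \<Longrightarrow> operator_on V f \<Longrightarrow> v \<in> V \<Longrightarrow> w \<in> V \<Longrightarrow> f (v - w) = f v - f w"
  using linear_on_diff[OF vector_space_axioms _ vector_space_axioms] by (auto simp: operator_on_def)

lemma operator_on_sum:
  "subspace V \<Longrightarrow> operator_on V f \<Longrightarrow> (\<And>i. i \<in> A \<Longrightarrow> g i \<in> V) \<Longrightarrow> f (\<Sum>i\<in>A. g i) = (\<Sum>i\<in>A. f (g i))"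
  unfolding operator_on_def by (rule linear_on_sum[OF vector_space_axioms]) auto

lemma operator_on_funpow:
  assumes "operator_on V f"
  shows "operator_on V (f ^^ n)"
proof (induction n)
  case (Suc n)
  then show ?case using assms by (simp add: operator_on_def linear_on_def)
qed (simp add: operator_on_def linear_on_def)

lemma finite_dimensional_subspace:
  assumes "finite_dimensional scale V" "subspace U" "U \<subseteq> V"
  obtains B where "finite B" "independent B" "B \<subseteq> U" "span B = U"
proof -
  obtain B0 where B0: "finite B0" "span B0 = V"
    using assms(1) by (auto simp: finite_dimensional_def)
  obtain B where B: "B \<subseteq> U" "independent B" "U \<subseteq> span B"
    by (metis basis_exists)
  then have "finite B"
    using independent_span_bound[OF B0(1)] B0(2) assms(3) by blast
  moreover have "span B = U"
    using B assms(2) span_minimal by blast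
  ultimately show ?thesis using that B by blast
qed

lemma finite_dimensional_imp_subspace: "finite_dimensional scale V \<Longrightarrow> subspace V"
  by (auto simp: finite_dimensional_def)

lemma finite_dimensional_subset:
  "finite_dimensional scale V \<Longrightarrow> subspace U \<Longrightarrow> U \<subseteq> V \<Longrightarrow> finite_dimensional scale U"
  by (metis finite_dimensional_subspace finite_dimensional_def)

lemma independent_image_of_family:
  assumes dep: "\<And>c N. (\<Sum>i\<le>N::nat. c i *s g i) = 0 \<Longrightarrow> \<forall>i\<le>N. c i = 0"
  shows "inj g" and "independent (range g)"
proof -
  show inj: "inj g"
  proof (rule injI, rule ccontr)
    fix i j assume ij: "g i = g j" "i \<noteq> j"
    let ?c = "\<lambda>l. if l = i then 1 else if l = j then - 1 else (0::'k)"
    have "(\<Sum>l\<le>max i j. ?c l *s g l) = (\<Sum>l\<in>{i, j}. ?c l *s g l)"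
      by (rule sum.mono_neutral_right) auto
    also have "\<dots> = 0" using ij by simp
    finally have "\<forall>l\<le>max i j. ?c l = 0" by (rule dep)
    then have "?c i = 0" by (rule allE[of _ i]) simp
    then show False by simp
  qed
  show "independent (range g)"
    unfolding independent_explicit_finite_subsets
  proof (intro allI impI ballI)
    fix T u v assume T: "T \<subseteq> range g" "finite T" and s: "(\<Sum>v\<in>T. u v *s v) = 0" and v: "v \<in> T"
    obtain I where I: "T = g ` I" "finite I"
      using T by (meson finite_subset_image)
    obtain N where N: "I \<subseteq> {..N}" using I(2) finite_nat_iff_bounded_le by auto
    have "(\<Sum>v\<in>T. u v *s v) = (\<Sum>i\<in>I. u (g i) *s g i)"
      using inj unfolding I(1) by (subst sum.reindex) (auto intro: inj_on_subset)
    also have "\<dots> = (\<Sum>i\<le>N. (if i \<in> I then u (g i) else 0) *s g i)"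
      using N by (intro sum.mono_neutral_cong_left) auto
    finally have "\<forall>i\<le>N. (if i \<in> I then u (g i) else 0) = 0"
      unfolding s by (intro dep) simp
    then have "(if i \<in> I then u (g i) else 0) = 0" if "i \<in> I" for i using N that by blast
    then show "u v = 0" using v I(1) by auto
  qed
qed

lemma family_dependent:
  assumes "finite_dimensional scale V" "\<And>i::nat. g i \<in> V"
  obtains N c where "(\<Sum>i\<le>N. c i *s g i) = 0" "\<exists>i\<le>N. c i \<noteq> 0"
proof -
  obtain B where B: "finite B" "span B = V"
    using assms(1) by (auto simp: finite_dimensional_def)
  have "infinite (range g)" if "inj g" using that range_inj_infinite by blast
  moreover have "finite (range g)" if "independent (range g)"
    using independent_span_bound[OF B(1) that] assms(2) B(2) by auto
  ultimately show ?thesis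
    using independent_image_of_family[of g] that by blast
qed

text \<open>A linear dependence between the iterates \<open>v, f v, f\<^sup>2 v, \<dots>\<close> is a polynomial in \<open>f\<close> that
  annihilates \<open>v\<close>; splitting off its roots one at a time produces an eigenvector.\<close>

lemma eigenvector_exists:
  assumes fd: "finite_dimensional scale V" and f: "operator_on V f" and V: "V \<noteq> {0}"
  obtains c v where "v \<in> V" "v \<noteq> 0" "f v = c *s v"
proof -
  have sub: "subspace V" by (rule finite_dimensional_imp_subspace) fact
  define ap where "ap p v = (\<Sum>i\<le>degree p. coeff p i *s (f ^^ i) v)" for p v
  have ap_bound: "ap p v = (\<Sum>i\<le>n. coeff p i *s (f ^^ i) v)" if "degree p \<le> n" for p n v
    unfolding ap_def using that
    by (intro sum.mono_neutral_left) (auto simp: coeff_eq_0)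
  have ap_V: "ap p v \<in> V" if "v \<in> V" for p v
    unfolding ap_def
    by (intro subspace_sum[OF sub] subspace_scale[OF sub] operator_on_closed[OF operator_on_funpow[OF f]] that)
  have f_ap: "f (ap p v) = (\<Sum>i\<le>degree p. coeff p i *s (f ^^ Suc i) v)" if "v \<in> V" for p v
  proof -
    have *: "(f ^^ i) v \<in> V" for i
      using operator_on_closed[OF operator_on_funpow[OF f]] that by blast
    show ?thesis
      unfolding ap_def
      by (subst operator_on_sum[OF sub f]) (auto simp: * operator_on_scale[OF f] subspace_scale[OF sub])
  qed
  have root: "ap ([:- r, 1:] * p) v = f (ap p v) - r *s ap p v" if "v \<in> V" for r p v
  proof -
    let ?n = "degree p"
    have "ap ([:- r, 1:] * p) v = (\<Sum>i\<le>Suc ?n. coeff ([:- r, 1:] * p) i *s (f ^^ i) v)"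
      by (rule ap_bound) (use degree_mult_le[of "[:- r, 1:]" p] in simp)
    also have "\<dots> = (\<Sum>i\<le>Suc ?n. coeff (pCons 0 p) i *s (f ^^ i) v)
        - (\<Sum>i\<le>Suc ?n. coeff (smult r p) i *s (f ^^ i) v)"
      by (simp add: sum_subtractf[symmetric] scale_left_diff_distrib[symmetric] del: sum.atMost_Suc)
    also have "(\<Sum>i\<le>Suc ?n. coeff (pCons 0 p) i *s (f ^^ i) v) = f (ap p v)"
      unfolding f_ap[OF that] by (subst sum.atMost_Suc_shift) simp
    also have "(\<Sum>i\<le>Suc ?n. coeff (smult r p) i *s (f ^^ i) v) = r *s ap p v"
      unfolding ap_bound[of p "Suc ?n" v, OF le_SucI[OF order_refl]]
      by (subst scale_sum_right) (simp add: algebra_simps)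
    finally show ?thesis .
  qed
  obtain v0 where v0: "v0 \<in> V" "v0 \<noteq> 0" using V sub subspace_0 by blast
  obtain N c where c: "(\<Sum>i\<le>N. c i *s (f ^^ i) v0) = 0" "\<exists>i\<le>N. c i \<noteq> 0"
    using family_dependent[OF fd, of "\<lambda>i. (f ^^ i) v0"]
      operator_on_closed[OF operator_on_funpow[OF f]] v0(1) by metis
  define p where "p = (\<Sum>i\<le>N. monom (c i) i)"
  have coeff_p: "coeff p i = (if i \<le> N then c i else 0)" for i
    unfolding p_def by (simp add: coeff_sum)
  have "p \<noteq> 0" using c(2) coeff_p by (metis coeff_0)
  moreover have "ap p v0 = 0"
    using c(1) by (subst ap_bound[of p N]) (auto simp: coeff_p degree_le)
  ultimately have "\<exists>v\<in>V. v \<noteq> 0 \<and> (\<exists>c. f v = c *s v)"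
    using v0
  proof (induction "degree p" arbitrary: p v0 rule: less_induct)
    case less
    show ?case
    proof (cases "degree p = 0")
      case True
      then obtain a where "p = [:a:]" by (meson degree_eq_zeroE)
      then show ?thesis using less.prems by (simp add: ap_def)
    next
      case False
      then obtain r where "poly p r = 0"
        using alg_closed_imp_poly_has_root by blast
      then obtain q where q: "p = [:- r, 1:] * q"
        by (meson poly_eq_0_iff_dvd dvdE)
      have "q \<noteq> 0" using q less.prems by auto
      then have deg: "degree q < degree p" unfolding q by (subst degree_mult_eq) auto
      show ?thesis
      proof (cases "ap q v0 = 0")
        case True
        then show ?thesis using less.hyps[OF deg \<open>q \<noteq> 0\<close>] less.prems by blast
      next
        case False
        have "f (ap q v0) = r *s ap q v0"
          using root[of v0 r q] less.prems q by simp
        then show ?thesis using False ap_V less.prems by blast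
      qed
    qed
  qed
  then show ?thesis using that by blast
qed

text \<open>A nonzero invariant subspace of least dimension is irreducible.\<close>

lemma exists_irreducible_subspace:
  assumes fd: "finite_dimensional scale V" and inv: "invariant Ops V" and V: "V \<noteq> {0}"
  obtains U where "U \<subseteq> V" "invariant Ops U" "irreducible Ops U"
proof -
  let ?P = "\<lambda>U. invariant Ops U \<and> U \<subseteq> V \<and> U \<noteq> {0}"
  have "?P V" using assms by simp
  from ex_has_least_nat[of ?P V dim, OF this]
  obtain U where U: "?P U" and min: "\<And>W. ?P W \<Longrightarrow> dim U \<le> dim W" by blast
  have "irreducible Ops U"
    unfolding irreducible_def
  proof (intro conjI allI impI)
    fix W assume W: "invariant Ops W \<and> W \<subseteq> U"
    show "W = {0} \<or> W = U"
    proof (rule ccontr)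
      assume neg: "\<not> ?thesis"
      obtain BU where BU: "finite BU" "independent BU" "span BU = U"
        using finite_dimensional_subspace[OF fd, of U] U by (metis invariant_def)
      obtain BW where BW: "finite BW" "independent BW" "span BW = W"
        using finite_dimensional_subspace[OF fd, of W] U W by (metis invariant_def order_trans)
      obtain u where u: "u \<in> U" "u \<notin> W" using W neg by blast
      then have "independent (insert u BW)" "u \<notin> BW"
        using BW independent_insertI span_base by auto
      moreover have "insert u BW \<subseteq> span BU"
        using BU BW W u span_superset by blast
      ultimately have "Suc (card BW) \<le> card BU"
        using independent_span_bound[OF BU(1)] BW(1) by fastforce
      moreover have "dim U = card BU" "dim W = card BW"
        using BU BW dim_eq_card dim_span dim_eq_card_independent by metis+
      moreover have "dim U \<le> dim W"
        using min W U neg by blast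
      ultimately show False by simp
    qed
  qed (use U in simp)
  then show ?thesis using that U by blast
qed

lemma schur:
  assumes fd: "finite_dimensional scale V" and Ops: "\<And>a. a \<in> Ops \<Longrightarrow> operator_on V a"
    and irr: "irreducible Ops V" and f: "operator_on V f"
    and comm: "\<And>a v. a \<in> Ops \<Longrightarrow> v \<in> V \<Longrightarrow> f (a v) = a (f v)"
  shows "\<exists>c. \<forall>v\<in>V. f v = c *s v"
proof -
  have sub: "subspace V" by (rule finite_dimensional_imp_subspace) fact
  obtain c v where v: "v \<in> V" "v \<noteq> 0" "f v = c *s v"
    by (rule eigenvector_exists[OF fd f]) (use irr in \<open>auto simp: irreducible_def\<close>)
  let ?U = "{v \<in> V. f v = c *s v}"
  have "a u \<in> ?U" if "a \<in> Ops" "u \<in> ?U" for a u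
    using that Ops[OF that(1)] comm[OF that(1)] by (simp add: operator_on_scale operator_on_closed)
  moreover have "subspace ?U"
    using sub unfolding subspace_def
    by (auto simp: operator_on_add[OF f] operator_on_scale[OF f] operator_on_0[OF sub f]
        scale_right_distrib mult.commute)
  ultimately have "invariant Ops ?U"
    by (auto simp only: invariant_def)
  then have "?U = V" using irr v unfolding irreducible_def by blast
  then show ?thesis by blast
qed

text \<open>The finite-dimensional case of the Kleinecke-Shirokov theorem, in the form needed here.  With
  \<open>D = j - \<mu>\<close>, the commutation rule \<open>D\<^sup>m a = a D\<^sup>m + m b D\<^sup>m\<^sup>-\<^sup>1\<close> shows that \<open>D\<^sup>n a\<^sup>n v = n! c\<^sup>n v\<close>
  while \<open>D\<^sup>n\<^sup>+\<^sup>1 a\<^sup>n v = 0\<close>.  For \<open>c \<noteq> 0\<close> the vectors \<open>a\<^sup>n v\<close> would be linearly independent.\<close>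

lemma commutator_eigenvalue_0:
  assumes fd: "finite_dimensional scale V"
    and ops: "operator_on V j" "operator_on V a" "operator_on V b"
    and ja: "\<And>v. v \<in> V \<Longrightarrow> b v = j (a v) - a (j v)"
    and jb: "\<And>v. v \<in> V \<Longrightarrow> j (b v) = b (j v)"
    and v: "v \<in> V" "v \<noteq> 0" "j v = \<mu> *s v" "b v = c *s v"
  shows "c = 0"
proof (rule ccontr)
  assume c: "c \<noteq> 0"
  have sub: "subspace V" by (rule finite_dimensional_imp_subspace) fact
  note cl = operator_on_closed[OF ops(1)] operator_on_closed[OF ops(2)] operator_on_closed[OF ops(3)]
    subspace_add[OF sub] subspace_diff[OF sub] subspace_scale[OF sub]
  define D where "D u = j u - \<mu> *s u" for u
  have D: "operator_on V D"
    unfolding operator_on_def linear_on_def D_def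
    by (auto simp: cl operator_on_add[OF ops(1)] operator_on_scale[OF ops(1)] scale_right_distrib
        scale_right_diff_distrib mult.commute)
  note Dn = operator_on_funpow[OF D]
  note cl = cl operator_on_closed[OF D] operator_on_closed[OF Dn]
  have Da: "D (a u) = a (D u) + b u" if "u \<in> V" for u
    using that by (simp add: D_def cl ja operator_on_diff[OF sub ops(2)] operator_on_scale[OF ops(2)])
  have Db: "D (b u) = b (D u)" if "u \<in> V" for u
    using that by (simp add: D_def cl jb operator_on_diff[OF sub ops(3)] operator_on_scale[OF ops(3)])
  have Dnb: "(D ^^ m) (b u) = b ((D ^^ m) u)" if "u \<in> V" for m u
    by (induction m) (auto simp: Db cl that)
  have Dna: "(D ^^ Suc m) (a u) = a ((D ^^ Suc m) u) + of_nat (Suc m) *s b ((D ^^ m) u)"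
    if u: "u \<in> V" for m u
  proof (induction m)
    case 0
    show ?case using u by (simp add: Da)
  next
    case (Suc m)
    have "(D ^^ Suc (Suc m)) (a u) = D (a ((D ^^ Suc m) u) + of_nat (Suc m) *s b ((D ^^ m) u))"
      using Suc by simp
    also have "\<dots> = D (a ((D ^^ Suc m) u)) + of_nat (Suc m) *s D (b ((D ^^ m) u))"
      using u by (simp only: operator_on_add[OF D] operator_on_scale[OF D] cl)
    also have "\<dots> = a ((D ^^ Suc (Suc m)) u) + b ((D ^^ Suc m) u) + of_nat (Suc m) *s b ((D ^^ Suc m) u)"
    proof -
      have "D (a ((D ^^ Suc m) u)) = a (D ((D ^^ Suc m) u)) + b ((D ^^ Suc m) u)"
        by (rule Da[OF operator_on_closed[OF Dn u]])
      moreover have "D (b ((D ^^ m) u)) = b (D ((D ^^ m) u))"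
        by (rule Db[OF operator_on_closed[OF Dn u]])
      ultimately show ?thesis by simp
    qed
    also have "\<dots> = a ((D ^^ Suc (Suc m)) u) + of_nat (Suc (Suc m)) *s b ((D ^^ Suc m) u)"
      using scale_left_distrib[of 1 "of_nat (Suc m)" "b ((D ^^ Suc m) u)"] by (simp add: add.assoc)
    finally show ?case .
  qed
  define y where "y n = (a ^^ n) v" for n
  have yV: "y n \<in> V" for n
    unfolding y_def by (rule operator_on_closed[OF operator_on_funpow[OF ops(2)] v(1)])
  have ySuc: "y (Suc n) = a (y n)" for n by (simp add: y_def)
  have D0: "D 0 = 0" "a 0 = 0" "b 0 = 0" using operator_on_0[OF sub] D ops by blast+
  have main: "(D ^^ n) (y n) = (fact n * c ^ n) *s v \<and> (D ^^ Suc n) (y n) = 0" for n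
  proof (induction n)
    case 0
    show ?case using v by (simp add: y_def D_def)
  next
    case (Suc n)
    have "(D ^^ Suc n) (y (Suc n)) = of_nat (Suc n) *s b ((fact n * c ^ n) *s v)"
      using Dna[OF yV, of n n] unfolding conjunct2[OF Suc] conjunct1[OF Suc] by (simp only: ySuc D0 add_0)
    also have "\<dots> = (fact (Suc n) * c ^ Suc n) *s v"
      using v by (simp add: operator_on_scale[OF ops(3)] algebra_simps)
    finally have 1: "(D ^^ Suc n) (y (Suc n)) = (fact (Suc n) * c ^ Suc n) *s v" .
    have "(D ^^ Suc (Suc n)) (y n) = D ((D ^^ Suc n) (y n))" by simp
    then have "(D ^^ Suc (Suc n)) (y n) = 0" unfolding conjunct2[OF Suc] D0 .
    then have "(D ^^ Suc (Suc n)) (y (Suc n)) = 0"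
      using Dna[OF yV, of "Suc n" n] unfolding conjunct2[OF Suc] by (simp add: ySuc D0)
    with 1 show ?case by blast
  qed
  have Dhigh: "(D ^^ m) (y n) = 0" if "n < m" for m n
  proof -
    have "(D ^^ (k + Suc n)) (y n) = 0" for k
    proof (induction k)
      case 0
      show ?case using conjunct2[OF main] by simp
    next
      case (Suc k)
      then show ?case using D0 by simp
    qed
    from this[of "m - Suc n"] show ?thesis using that by simp
  qed
  obtain N d where d: "(\<Sum>i\<le>N. d i *s y i) = 0" "\<exists>i\<le>N. d i \<noteq> 0"
    by (rule family_dependent[OF fd yV])
  let ?T = "{i. i \<le> N \<and> d i \<noteq> 0}"
  have T: "finite ?T" "?T \<noteq> {}" using d(2) by auto
  define m where "m = Max ?T"
  have m: "m \<le> N" "d m \<noteq> 0" using Max_in[OF T] by (auto simp: m_def)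
  have top: "d i = 0" if "m < i" "i \<le> N" for i
  proof (rule ccontr)
    assume "d i \<noteq> 0"
    then have "i \<le> Max ?T" using that by (intro Max_ge[OF T(1)]) auto
    then show False using that(1) by (simp add: m_def)
  qed
  have "0 = (D ^^ m) (\<Sum>i\<le>N. d i *s y i)"
    using d(1) operator_on_0[OF sub Dn] by simp
  also have "\<dots> = (\<Sum>i\<le>N. d i *s (D ^^ m) (y i))"
    by (subst operator_on_sum[OF sub Dn]) (auto simp: cl yV operator_on_scale[OF Dn])
  also have "\<dots> = (\<Sum>i\<in>{m}. d i *s (D ^^ m) (y i))"
  proof (rule sum.mono_neutral_right)
    show "\<forall>i\<in>{..N} - {m}. d i *s (D ^^ m) (y i) = 0"
    proof
      fix i assume "i \<in> {..N} - {m}"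
      then have "i < m \<or> m < i \<and> i \<le> N" by auto
      then show "d i *s (D ^^ m) (y i) = 0" using top Dhigh by auto
    qed
  qed (use m(1) in auto)
  also have "\<dots> = (d m * (fact m * c ^ m)) *s v" using main by simp
  finally show False using m(2) c v(2) by simp
qed

text \<open>A form of Lie's theorem.  By Schur's lemma, \<open>J\<close> acts by scalars \<open>wt\<close> on a subspace that is
  irreducible under \<open>J\<close>.  The joint eigenspace for \<open>wt\<close> in \<open>V\<close> is stable under \<open>G\<close>, because \<open>wt\<close>
  vanishes on commutators by the preceding lemma; hence it is all of \<open>V\<close>.\<close>

lemma commuting_ideal_scalar:
  assumes fd: "finite_dimensional scale V" and G: "\<And>a. a \<in> G \<Longrightarrow> operator_on V a"
    and irr: "irreducible G V" and J: "\<And>j. j \<in> J \<Longrightarrow> operator_on V j"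
    and comm: "\<And>i j v. i \<in> J \<Longrightarrow> j \<in> J \<Longrightarrow> v \<in> V \<Longrightarrow> i (j v) = j (i v)"
    and ideal: "\<And>j a. j \<in> J \<Longrightarrow> a \<in> G \<Longrightarrow> \<exists>b\<in>J. \<forall>v\<in>V. b v = j (a v) - a (j v)"
    and j: "j \<in> J"
  shows "\<exists>c. \<forall>v\<in>V. j v = c *s v"
proof -
  have sub: "subspace V" by (rule finite_dimensional_imp_subspace) fact
  have V: "V \<noteq> {0}" using irr by (simp add: irreducible_def)
  have "invariant J V" using sub J by (auto simp: invariant_def operator_on_closed)
  then obtain W where W: "W \<subseteq> V" "invariant J W" "irreducible J W"
    using exists_irreducible_subspace[OF fd _ V] by blast
  have fdW: "finite_dimensional scale W"
    using finite_dimensional_subset[OF fd _ W(1)] W(2) by (simp add: invariant_def)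
  have JW: "operator_on W i" if "i \<in> J" for i
    using J[OF that] W that linear_on_subset by (auto simp: operator_on_def invariant_def)
  have "\<exists>c. \<forall>v\<in>W. i v = c *s v" if i: "i \<in> J" for i
  proof (rule schur[OF fdW JW W(3) JW[OF i]])
    show "i (a v) = a (i v)" if "a \<in> J" "v \<in> W" for a v
      using comm[OF i] that W(1) by blast
  qed
  then obtain wt where wt: "\<And>i v. i \<in> J \<Longrightarrow> v \<in> W \<Longrightarrow> i v = wt i *s v" by metis
  let ?U = "{v \<in> V. \<forall>i\<in>J. i v = wt i *s v}"
  obtain w where w: "w \<in> W" "w \<noteq> 0"
    using W(2,3) subspace_0[of W] unfolding irreducible_def invariant_def by blast
  then have wU: "w \<in> ?U" using wt W(1) by blast
  have "subspace ?U"
    unfolding subspace_def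
  proof (intro conjI ballI allI CollectI)
    fix i assume "i \<in> J"
    then have i: "operator_on V i" by (rule J)
    show "i 0 = wt i *s 0" by (simp add: operator_on_0[OF sub i])
    show "i (x + y) = wt i *s (x + y)" if "x \<in> ?U" "y \<in> ?U" for x y
      using that \<open>i \<in> J\<close> by (simp add: operator_on_add[OF i] scale_right_distrib)
    show "i (c *s x) = wt i *s c *s x" if "x \<in> ?U" for c x
    proof -
      have "x \<in> V" "i x = wt i *s x" using that \<open>i \<in> J\<close> by blast+
      then show ?thesis by (simp add: operator_on_scale[OF i] mult.commute)
    qed
  qed (use sub in \<open>auto simp: subspace_def\<close>)
  moreover have "a u \<in> ?U" if a: "a \<in> G" and u: "u \<in> ?U" for a u
  proof -
    have "i (a u) = wt i *s a u" if i: "i \<in> J" for i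
    proof (cases "u = 0")
      case True
      then show ?thesis
        by (simp add: operator_on_0[OF sub G[OF a]] operator_on_0[OF sub J[OF i]])
    next
      case False
      obtain b where b: "b \<in> J" "\<And>v. v \<in> V \<Longrightarrow> b v = i (a v) - a (i v)"
        using ideal[OF i a] by blast
      have uV: "u \<in> V" using u by simp
      have "wt b = 0"
        by (rule commutator_eigenvalue_0[OF fd J[OF i] G[OF a] J[OF b(1)] b(2) comm[OF i b(1)] uV False])
          (use u i b(1) in auto)
      moreover have "b u = wt b *s u" "i u = wt i *s u" using u i b(1) by blast+
      ultimately have "i (a u) = a (wt i *s u)" using b(2)[OF uV] by simp
      then show ?thesis by (simp add: operator_on_scale[OF G[OF a] uV])
    qed
    then show ?thesis using u G[OF a] by (simp add: operator_on_closed)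
  qed
  ultimately have "invariant G ?U" by (simp add: invariant_def)
  then have "?U = V" using irr w wU unfolding irreducible_def by blast
  then show ?thesis using j by blast
qed

inductive_set op_algebra :: "('v \<Rightarrow> 'v) set \<Rightarrow> ('v \<Rightarrow> 'v) set" for Ops where
  id: "(\<lambda>v. v) \<in> op_algebra Ops"
| gen: "f \<in> Ops \<Longrightarrow> f \<in> op_algebra Ops"
| add: "f \<in> op_algebra Ops \<Longrightarrow> g \<in> op_algebra Ops \<Longrightarrow> (\<lambda>v. f v + g v) \<in> op_algebra Ops"
| scale: "f \<in> op_algebra Ops \<Longrightarrow> (\<lambda>v. c *s f v) \<in> op_algebra Ops"
| comp: "f \<in> op_algebra Ops \<Longrightarrow> g \<in> op_algebra Ops \<Longrightarrow> (\<lambda>v. f (g v)) \<in> op_algebra Ops"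

lemma op_algebra_operator_on:
  assumes sub: "subspace V" and Ops: "\<And>a. a \<in> Ops \<Longrightarrow> operator_on V a" and f: "f \<in> op_algebra Ops"
  shows "operator_on V f"
  using f
proof induction
  case (gen f)
  then show ?case using Ops by blast
qed (auto simp: operator_on_def linear_on_def scale_right_distrib mult.commute algebra_simps
    subspace_add[OF sub] subspace_scale[OF sub])

lemma subspace_op_algebra_orbit: "subspace {f u | f. f \<in> op_algebra Ops}" (is "subspace ?U")
  unfolding subspace_def
proof (intro conjI ballI allI)
  have "(\<lambda>v. 0 *s v) \<in> op_algebra Ops" using op_algebra.scale[OF op_algebra.id] .
  then show "0 \<in> ?U" by force
next
  fix x y assume "x \<in> ?U" "y \<in> ?U"
  then obtain f g where fg: "x = f u" "y = g u" "f \<in> op_algebra Ops" "g \<in> op_algebra Ops" by blast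
  then have "(\<lambda>v. f v + g v) \<in> op_algebra Ops" by (intro op_algebra.add)
  then show "x + y \<in> ?U" unfolding fg by (intro CollectI exI[of _ "\<lambda>v. f v + g v"]) simp
next
  fix c x assume "x \<in> ?U"
  then obtain f where f: "x = f u" "f \<in> op_algebra Ops" by blast
  then have "(\<lambda>v. c *s f v) \<in> op_algebra Ops" by (intro op_algebra.scale)
  then show "c *s x \<in> ?U" unfolding f by (intro CollectI exI[of _ "\<lambda>v. c *s f v"]) simp
qed

text \<open>The Jacobson density theorem.  If every operator that kills \<open>B\<close> and \<open>b\<close> killed \<open>v\<close>, then
  \<open>f b \<mapsto> f v\<close>, for \<open>f\<close> killing \<open>B\<close>, would be an endomorphism, hence a scalar \<open>c\<close>; so \<open>v - c b\<close> would
  be killed by all operators that kill \<open>B\<close> and would lie in the span of \<open>B\<close> by induction.\<close>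

lemma density_separation:
  assumes fd: "finite_dimensional scale V" and Ops: "\<And>a. a \<in> Ops \<Longrightarrow> operator_on V a"
    and irr: "irreducible Ops V" and "finite B" "B \<subseteq> V" "v \<in> V" "v \<notin> span B"
  obtains f where "f \<in> op_algebra Ops" "\<And>b. b \<in> B \<Longrightarrow> f b = 0" "f v \<noteq> 0"
proof -
  have sub: "subspace V" by (rule finite_dimensional_imp_subspace) fact
  have alg: "operator_on V f" if "f \<in> op_algebra Ops" for f
    by (rule op_algebra_operator_on[OF sub Ops that])
  have "\<exists>f\<in>op_algebra Ops. (\<forall>b\<in>B. f b = 0) \<and> f v \<noteq> 0"
    using assms(4-7)
  proof (induction B arbitrary: v)
    case empty
    then show ?case using op_algebra.id by (intro bexI[of _ "\<lambda>v. v"]) auto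
  next
    case (insert b B)
    define A where "A = {f \<in> op_algebra Ops. \<forall>b\<in>B. f b = 0}"
    have A_alg: "f \<in> op_algebra Ops" if "f \<in> A" for f using that by (simp add: A_def)
    have bV: "b \<in> V" and BV: "B \<subseteq> V" using insert.prems by auto
    have A_add: "(\<lambda>v. f v + g v) \<in> A" if "f \<in> A" "g \<in> A" for f g
      using that op_algebra.add by (auto simp: A_def)
    have A_scale: "(\<lambda>v. c *s f v) \<in> A" if "f \<in> A" for f c
      using that op_algebra.scale by (auto simp: A_def)
    have A_comp: "(\<lambda>v. g (f v)) \<in> A" if "f \<in> A" "g \<in> Ops" for f g
      using that op_algebra.comp[OF op_algebra.gen[OF that(2)]] operator_on_0[OF sub Ops[OF that(2)]]
      by (auto simp: A_def)
    show ?case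
    proof (cases "b \<in> span B")
      case True
      then have "span (insert b B) = span B" using span_redundant by blast
      with insert.prems obtain f where f: "f \<in> A" "f v \<noteq> 0"
        using insert.IH[of v] by (auto simp: A_def)
      moreover have "f b = (\<lambda>_. 0) b"
        by (rule linear_on_span_eq[OF vector_space_axioms sub vector_space_axioms _ _ BV _ True])
          (use f alg[OF A_alg] in \<open>auto simp: operator_on_def linear_on_def A_def\<close>)
      ultimately show ?thesis by (intro bexI[of _ f]) (auto simp: A_def)
    next
      case False
      show ?thesis
      proof (rule ccontr)
        assume "\<not> ?thesis"
        then have neg: "f v = 0" if "f \<in> A" "f b = 0" for f using that by (auto simp: A_def)
        let ?U = "{f b | f. f \<in> A}"
        have "subspace ?U"
          unfolding subspace_def
        proof (intro conjI ballI allI)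
          have "(\<lambda>v. 0 *s v) \<in> A" using op_algebra.scale[OF op_algebra.id, of 0] by (simp add: A_def)
          then show "0 \<in> ?U" by (intro CollectI exI[of _ "\<lambda>v. 0 *s v"]) simp
        next
          fix x y assume "x \<in> ?U" "y \<in> ?U"
          then obtain f g where fg: "x = f b" "y = g b" "f \<in> A" "g \<in> A" by blast
          show "x + y \<in> ?U"
            using A_add[OF fg(3,4)] unfolding fg by (intro CollectI exI[of _ "\<lambda>v. f v + g v"]) simp
        next
          fix c x assume "x \<in> ?U"
          then obtain f where f: "x = f b" "f \<in> A" by blast
          show "c *s x \<in> ?U"
            using A_scale[OF f(2)] unfolding f by (intro CollectI exI[of _ "\<lambda>v. c *s f v"]) simp
        qed
        moreover have "g (f b) \<in> ?U" if "g \<in> Ops" "f \<in> A" for f g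
          using A_comp[OF that(2,1)] by (intro CollectI exI[of _ "\<lambda>v. g (f v)"]) simp
        ultimately have "invariant Ops ?U" by (auto simp only: invariant_def mem_Collect_eq)
        moreover have "?U \<subseteq> V" using operator_on_closed[OF alg[OF A_alg] bV] by auto
        moreover obtain f0 where "f0 \<in> A" "f0 b \<noteq> 0"
          using insert.IH[OF BV bV False] by (auto simp: A_def)
        then have "?U \<noteq> {0}" by auto
        ultimately have UV: "?U = V" using irr unfolding irreducible_def by blast
        define h where "h w = (SOME f. f \<in> A \<and> f b = w)" for w
        have h: "h w \<in> A" "h w b = w" if "w \<in> V" for w
        proof -
          have "w \<in> ?U" using UV that by simp
          then have "\<exists>f. f \<in> A \<and> f b = w" by auto
          from someI_ex[OF this] show "h w \<in> A" "h w b = w" by (auto simp: h_def)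
        qed
        have h_eq: "h w v = f v" if "f \<in> A" "f b = w" "w \<in> V" for f w
        proof -
          let ?g = "\<lambda>u. h w u + (- 1) *s f u"
          have "?g \<in> A" by (rule A_add[OF h(1)[OF that(3)] A_scale[OF that(1)]])
          moreover have "?g b = 0" using h that by simp
          ultimately have "?g v = 0" using neg by blast
          then show ?thesis by simp
        qed
        define T where "T w = h w v" for w
        have T: "operator_on V T"
          unfolding operator_on_def linear_on_def
        proof (intro conjI ballI allI)
          show "T w \<in> V" if "w \<in> V" for w
            unfolding T_def by (rule operator_on_closed[OF alg[OF A_alg[OF h(1)[OF that]]] insert.prems(2)])
          show "T (w + w') = T w + T w'" if "w \<in> V" "w' \<in> V" for w w'
            unfolding T_def using that h subspace_add[OF sub]
            by (intro h_eq[of "\<lambda>v. h w v + h w' v", OF A_add]) auto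
          show "T (c *s w) = c *s T w" if "w \<in> V" for c w
            unfolding T_def using that h subspace_scale[OF sub]
            by (intro h_eq[of "\<lambda>v. c *s h w v", OF A_scale]) auto
        qed
        have Tc: "T (g w) = g (T w)" if "g \<in> Ops" "w \<in> V" for g w
          unfolding T_def using h(2)[OF that(2)] operator_on_closed[OF Ops[OF that(1)] that(2)]
          by (intro h_eq[OF A_comp[OF h(1)[OF that(2)] that(1)]]) simp_all
        obtain c where c: "\<And>w. w \<in> V \<Longrightarrow> T w = c *s w"
          using schur[OF fd Ops irr T Tc] by auto
        have vcb: "v - c *s b \<in> V"
          using insert.prems bV subspace_diff[OF sub] subspace_scale[OF sub] by auto
        have "f (v - c *s b) = 0" if f: "f \<in> A" for f
        proof -
          have op: "operator_on V f" by (rule alg[OF A_alg[OF f]])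
          then have "f b \<in> V" using bV operator_on_closed by blast
          then have "f v = c *s f b" using h_eq[OF f refl] c[of "f b"] by (simp add: T_def)
          then show ?thesis
            using insert.prems bV subspace_scale[OF sub]
            by (simp add: operator_on_diff[OF sub op] operator_on_scale[OF op])
        qed
        then have "v - c *s b \<in> span B" using insert.IH[OF BV vcb] by (auto simp: A_def)
        then have "v \<in> span (insert b B)" using span_breakdown_eq by blast
        then show False using insert.prems by blast
      qed
    qed
  qed
  then show ?thesis using that by blast
qed

text \<open>The separating operators for the elements of a basis, scaled by the values of \<open>g\<close>, add up to any
  prescribed operator of rank one.\<close>

lemma density_rank_one:
  assumes fd: "finite_dimensional scale V" and Ops: "\<And>a. a \<in> Ops \<Longrightarrow> operator_on V a"
    and irr: "irreducible Ops V" and g: "linear_on scale (*) V g" and u0: "u0 \<in> V"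
  shows "\<exists>f\<in>op_algebra Ops. \<forall>v\<in>V. f v = g v *s u0"
proof -
  have sub: "subspace V" by (rule finite_dimensional_imp_subspace) fact
  have alg: "operator_on V f" if "f \<in> op_algebra Ops" for f
    by (rule op_algebra_operator_on[OF sub Ops that])
  obtain B where B: "finite B" "independent B" "B \<subseteq> V" "span B = V"
    using finite_dimensional_subspace[OF fd sub order_refl] by blast
  have "\<exists>f\<in>op_algebra Ops. \<forall>b'\<in>B. f b' = (if b' = b then u0 else 0)" if b: "b \<in> B" for b
  proof -
    have "b \<notin> span (B - {b})" using B(2) b dependent_def by blast
    then obtain h where h: "h \<in> op_algebra Ops" "\<And>b'. b' \<in> B - {b} \<Longrightarrow> h b' = 0" "h b \<noteq> 0"
      using density_separation[OF fd Ops irr, of "B - {b}" b] B b by blast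
    let ?U = "{f (h b) | f. f \<in> op_algebra Ops}"
    have hb: "h b \<in> V" using alg[OF h(1)] B b operator_on_closed by blast
    have "subspace ?U" by (rule subspace_op_algebra_orbit)
    moreover have "g (f (h b)) \<in> ?U" if "g \<in> Ops" "f \<in> op_algebra Ops" for f g
      using op_algebra.comp[OF op_algebra.gen[OF that(1)] that(2)] by (intro CollectI exI[of _ "\<lambda>v. g (f v)"]) simp
    ultimately have "invariant Ops ?U" by (auto simp only: invariant_def mem_Collect_eq)
    moreover have "?U \<subseteq> V" using alg hb by (auto simp: operator_on_closed)
    moreover have "h b \<in> ?U" using op_algebra.id by force
    ultimately have "?U = V" using irr h(3) unfolding irreducible_def by blast
    then have "u0 \<in> ?U" using u0 by simp
    then obtain f where f: "f \<in> op_algebra Ops" "f (h b) = u0" by auto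
    have "(\<lambda>v. f (h v)) \<in> op_algebra Ops" using f h op_algebra.comp by blast
    moreover have "f 0 = 0" using operator_on_0[OF sub alg] f by blast
    ultimately show ?thesis using f h by (intro bexI[of _ "\<lambda>v. f (h v)"]) auto
  qed
  then obtain F where F: "\<And>b. b \<in> B \<Longrightarrow> F b \<in> op_algebra Ops"
    "\<And>b b'. b \<in> B \<Longrightarrow> b' \<in> B \<Longrightarrow> F b b' = (if b' = b then u0 else 0)" by metis
  have sum_alg: "(\<lambda>v. \<Sum>b\<in>C. g b *s F b v) \<in> op_algebra Ops" if "finite C" "C \<subseteq> B" for C
    using that
  proof (induction C)
    case empty
    have "(\<lambda>v. 0 *s v) \<in> op_algebra Ops" using op_algebra.scale[OF op_algebra.id] .
    then show ?case by simp
  next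
    case (insert b C)
    then show ?case using F by (auto intro!: op_algebra.add op_algebra.scale)
  qed
  let ?f = "\<lambda>v. \<Sum>b\<in>B. g b *s F b v"
  have f: "?f \<in> op_algebra Ops" using sum_alg B by blast
  moreover have "?f v = g v *s u0" if "v \<in> V" for v
  proof (rule linear_on_span_eq[where f = ?f and g = "\<lambda>v. g v *s u0",
        OF vector_space_axioms sub vector_space_axioms _ _ B(3)])
    show "linear_on scale scale V ?f" using alg[OF f] operator_on_linear by blast
    show "linear_on scale scale V (\<lambda>v. g v *s u0)"
      using g by (auto simp: linear_on_def scale_left_distrib)
    show "v \<in> span B" using that B by simp
    fix b assume b: "b \<in> B"
    have "?f b = (\<Sum>b'\<in>B. if b' = b then g b' *s u0 else 0)"
      using F b by (intro sum.cong) auto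
    then show "?f b = g b *s u0" using B b by simp
  qed
  ultimately show ?thesis by (intro bexI[of _ ?f] ballI)
qed

end

section \<open>Homomorphisms of representations\<close>

lemma vector_space_coord_scale: "vector_space (coord_scale :: 'k::field \<Rightarrow> ('i \<Rightarrow> 'k) \<Rightarrow> 'i \<Rightarrow> 'k)"
  by unfold_locales (auto simp: fun_scale_def fun_eq_iff algebra_simps)

interpretation coord: ac_vector_space
  "coord_scale :: 'k::{alg_closed_field, field_char_0} \<Rightarrow> ('i \<Rightarrow> 'k) \<Rightarrow> 'i \<Rightarrow> 'k"
  by (intro ac_vector_space.intro vector_space_coord_scale)

lemma sum_fun_apply: "(\<Sum>a\<in>A. f a) i = (\<Sum>a\<in>A. f a i :: 'b::comm_monoid_add)"
  by (induction A rule: infinite_finite_induct) simp_all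

lemma lie_representationD:
  assumes "lie_representation sL bL L sV V \<rho>"
  shows "vector_space sV" "module.subspace sV V"
    and "\<And>a v. a \<in> L \<Longrightarrow> v \<in> V \<Longrightarrow> \<rho> a v \<in> V"
    and "\<And>a. a \<in> L \<Longrightarrow> linear_on sV sV V (\<rho> a)"
    and "\<And>a b v. a \<in> L \<Longrightarrow> b \<in> L \<Longrightarrow> v \<in> V \<Longrightarrow> \<rho> (a + b) v = \<rho> a v + \<rho> b v"
    and "\<And>c a v. a \<in> L \<Longrightarrow> v \<in> V \<Longrightarrow> \<rho> (sL c a) v = sV c (\<rho> a v)"
    and "\<And>a b v. a \<in> L \<Longrightarrow> b \<in> L \<Longrightarrow> v \<in> V \<Longrightarrow> \<rho> (bL a b) v = \<rho> a (\<rho> b v) - \<rho> b (\<rho> a v)"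
  using assms unfolding lie_representation_def linear_on_def by simp_all

lemma lie_representationI:
  assumes "vector_space sV" "module.subspace sV V"
    and "\<And>a v. a \<in> L \<Longrightarrow> v \<in> V \<Longrightarrow> \<rho> a v \<in> V"
    and "\<And>a. a \<in> L \<Longrightarrow> linear_on sV sV V (\<rho> a)"
    and "\<And>a b v. a \<in> L \<Longrightarrow> b \<in> L \<Longrightarrow> v \<in> V \<Longrightarrow> \<rho> (a + b) v = \<rho> a v + \<rho> b v"
    and "\<And>c a v. a \<in> L \<Longrightarrow> v \<in> V \<Longrightarrow> \<rho> (sL c a) v = sV c (\<rho> a v)"
    and "\<And>a b v. a \<in> L \<Longrightarrow> b \<in> L \<Longrightarrow> v \<in> V \<Longrightarrow> \<rho> (bL a b) v = \<rho> a (\<rho> b v) - \<rho> b (\<rho> a v)"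
  shows "lie_representation sL bL L sV V \<rho>"
  using assms unfolding lie_representation_def linear_on_def by simp

definition rep_hom ::
    "'l set \<Rightarrow> ('k \<Rightarrow> 'v::ab_group_add \<Rightarrow> 'v) \<Rightarrow> 'v set \<Rightarrow> ('l \<Rightarrow> 'v \<Rightarrow> 'v) \<Rightarrow>
     ('k \<Rightarrow> 'w::ab_group_add \<Rightarrow> 'w) \<Rightarrow> 'w set \<Rightarrow> ('l \<Rightarrow> 'w \<Rightarrow> 'w) \<Rightarrow> ('v \<Rightarrow> 'w) \<Rightarrow> bool" where
  "rep_hom L sV V \<rho> sW W \<tau> T \<longleftrightarrow>
     (\<forall>v\<in>V. T v \<in> W) \<and> linear_on sV sW V T \<and> (\<forall>a\<in>L. \<forall>v\<in>V. T (\<rho> a v) = \<tau> a (T v))"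

lemma rep_iso_iff_hom:
  "rep_iso L sV V \<rho> sW W \<tau> \<longleftrightarrow> (\<exists>T. rep_hom L sV V \<rho> sW W \<tau> T \<and> bij_betw T V W)"
proof
  assume "rep_iso L sV V \<rho> sW W \<tau>"
  then obtain T where "bij_betw T V W"
    "(\<forall>v\<in>V. \<forall>w\<in>V. T (v + w) = T v + T w) \<and> (\<forall>c. \<forall>v\<in>V. T (sV c v) = sW c (T v)) \<and>
        (\<forall>a\<in>L. \<forall>v\<in>V. T (\<rho> a v) = \<tau> a (T v))"
    unfolding rep_iso_def by auto
  then show "\<exists>T. rep_hom L sV V \<rho> sW W \<tau> T \<and> bij_betw T V W"
    unfolding rep_hom_def linear_on_def by (intro exI[of _ T]) (auto dest: bij_betwE)
next
  assume "\<exists>T. rep_hom L sV V \<rho> sW W \<tau> T \<and> bij_betw T V W"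
  then obtain T where "rep_hom L sV V \<rho> sW W \<tau> T" "bij_betw T V W" by auto
  then show "rep_iso L sV V \<rho> sW W \<tau>"
    unfolding rep_iso_def rep_hom_def linear_on_def by (intro exI[of _ T]) simp
qed

lemma rep_iso_refl: "rep_iso L sV V \<rho> sV V \<rho>"
  unfolding rep_iso_def by (intro exI[of _ "\<lambda>v. v"]) (simp add: bij_betw_def)

lemma rep_iso_sym:
  assumes V: "lie_representation sL bL L sV V \<rho>" and iso: "rep_iso L sV V \<rho> sW W \<tau>"
  shows "rep_iso L sW W \<tau> sV V \<rho>"
proof -
  interpret V: vector_space sV by (rule lie_representationD(1)[OF V])
  note sub = lie_representationD(2)[OF V]
  obtain T where T: "bij_betw T V W" "\<And>v w. v \<in> V \<Longrightarrow> w \<in> V \<Longrightarrow> T (v + w) = T v + T w"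
    "\<And>c v. v \<in> V \<Longrightarrow> T (sV c v) = sW c (T v)" "\<And>a v. a \<in> L \<Longrightarrow> v \<in> V \<Longrightarrow> T (\<rho> a v) = \<tau> a (T v)"
    using iso unfolding rep_iso_def by auto
  define S where "S = inv_into V T"
  have S: "bij_betw S W V" unfolding S_def by (rule bij_betw_inv_into[OF T(1)])
  have ST: "S (T v) = v" if "v \<in> V" for v
    unfolding S_def by (rule bij_betw_inv_into_left[OF T(1) that])
  have TS: "T (S w) = w" "S w \<in> V" if "w \<in> W" for w
    using bij_betw_inv_into_right[OF T(1) that] bij_betwE[OF S] that by (auto simp: S_def)
  have "S (v + w) = S v + S w" if "v \<in> W" "w \<in> W" for v w
    using ST[of "S v + S w"] T(2)[of "S v" "S w"] TS that V.subspace_add[OF sub] by simp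
  moreover have "S (sW c v) = sV c (S v)" if "v \<in> W" for v c
    using ST[of "sV c (S v)"] T(3)[of "S v" c] TS that V.subspace_scale[OF sub] by simp
  moreover have "S (\<tau> a v) = \<rho> a (S v)" if "v \<in> W" "a \<in> L" for v a
    using ST[of "\<rho> a (S v)"] T(4)[of a "S v"] TS that lie_representationD(3)[OF V] by simp
  ultimately show ?thesis unfolding rep_iso_def using S by (intro exI[of _ S]) auto
qed

lemma rep_iso_trans:
  assumes "rep_iso L sV V \<rho> sW W \<tau>" "rep_iso L sW W \<tau> sU U \<pi>"
  shows "rep_iso L sV V \<rho> sU U \<pi>"
proof -
  obtain T where T: "rep_hom L sV V \<rho> sW W \<tau> T" "bij_betw T V W"
    using assms(1) unfolding rep_iso_iff_hom by blast
  obtain S where S: "rep_hom L sW W \<tau> sU U \<pi> S" "bij_betw S W U"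
    using assms(2) unfolding rep_iso_iff_hom by blast
  have "rep_hom L sV V \<rho> sU U \<pi> (S \<circ> T)"
    using T(1) S(1) unfolding rep_hom_def linear_on_def by simp
  moreover have "bij_betw (S \<circ> T) V U" using T(2) S(2) by (rule bij_betw_trans)
  ultimately show ?thesis unfolding rep_iso_iff_hom by blast
qed

lemma irreducible_rep_nonzero:
  assumes V: "lie_representation sL bL L sV V \<rho>" and irr: "irreducible_rep L sV V \<rho>"
  shows "\<exists>v\<in>V. v \<noteq> 0"
proof -
  interpret vector_space sV by (rule lie_representationD(1)[OF V])
  show ?thesis
    using irr subspace_0[OF lie_representationD(2)[OF V]] unfolding irreducible_rep_def by auto
qed

lemma lie_representation_subset:
  assumes V: "lie_representation sL bL L sV V \<rho>" and "M \<subseteq> L"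
  shows "lie_representation sL bL M sV V \<rho>"
  using assms unfolding lie_representation_def by (simp add: subset_iff)

text \<open>Schur's lemma: the kernel and the image of a homomorphism are subrepresentations.\<close>

lemma irreducible_rep_hom_iso:
  assumes V: "lie_representation sL bL L sV V \<rho>" and W: "lie_representation sL bL L sW W \<tau>"
    and irrV: "irreducible_rep L sV V \<rho>" and irrW: "irreducible_rep L sW W \<tau>"
    and T: "rep_hom L sV V \<rho> sW W \<tau> T" and v: "v \<in> V" "T v \<noteq> 0"
  shows "rep_iso L sV V \<rho> sW W \<tau>"
proof -
  interpret V: vector_space sV by (rule lie_representationD(1)[OF V])
  interpret W: vector_space sW by (rule lie_representationD(1)[OF W])
  note sub = lie_representationD(2)[OF V] and subW = lie_representationD(2)[OF W]
  have lin: "linear_on sV sW V T" and TW: "\<And>v. v \<in> V \<Longrightarrow> T v \<in> W"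
    and Ta: "\<And>a v. a \<in> L \<Longrightarrow> v \<in> V \<Longrightarrow> T (\<rho> a v) = \<tau> a (T v)"
    using T by (auto simp: rep_hom_def)
  have T0: "T 0 = 0" by (rule linear_on_0[OF V.vector_space_axioms sub lin])
  have \<tau>0: "\<tau> a 0 = 0" if "a \<in> L" for a
    by (rule linear_on_0[OF W.vector_space_axioms subW lie_representationD(4)[OF W that]])
  let ?K = "{v \<in> V. T v = 0}"
  have "V.subspace ?K"
    using sub unfolding V.subspace_def by (auto simp: T0 linear_on_add[OF lin] linear_on_scale[OF lin])
  moreover have "\<forall>a\<in>L. \<forall>u\<in>?K. \<rho> a u \<in> ?K" using Ta \<tau>0 lie_representationD(3)[OF V] by auto
  ultimately have "?K = {0} \<or> ?K = V"
    using irrV unfolding irreducible_rep_def by auto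
  then have K: "?K = {0}" using v by auto
  have "inj_on T V"
  proof (rule inj_onI)
    fix x y assume xy: "x \<in> V" "y \<in> V" "T x = T y"
    then have "x - y \<in> ?K"
      using V.subspace_diff[OF sub] linear_on_diff[OF V.vector_space_axioms sub W.vector_space_axioms lin]
      by auto
    then show "x = y" using K by simp
  qed
  moreover have "T ` V = W"
  proof -
    have "W.subspace (T ` V)"
      unfolding W.subspace_def
    proof (intro conjI ballI allI)
      show "0 \<in> T ` V" using T0 V.subspace_0[OF sub] by force
      show "x + y \<in> T ` V" if "x \<in> T ` V" "y \<in> T ` V" for x y
        using that V.subspace_add[OF sub] by (auto simp: linear_on_add[OF lin, symmetric])
      show "sW c x \<in> T ` V" if "x \<in> T ` V" for c x
        using that V.subspace_scale[OF sub] by (auto simp: linear_on_scale[OF lin, symmetric])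
    qed
    moreover have "T ` V \<subseteq> W" using TW by auto
    moreover have "\<forall>a\<in>L. \<forall>u\<in>T ` V. \<tau> a u \<in> T ` V"
      using lie_representationD(3)[OF V] by (auto simp: Ta[symmetric])
    ultimately have "T ` V = {0} \<or> T ` V = W"
      using irrW unfolding irreducible_rep_def by blast
    then show ?thesis using v by auto
  qed
  ultimately show ?thesis unfolding rep_iso_iff_hom bij_betw_def using T by blast
qed

lemma rep_iso_irreducible:
  assumes V: "lie_representation sL bL L sV V \<rho>" and W: "lie_representation sL bL L sW W \<tau>"
    and irrV: "irreducible_rep L sV V \<rho>" and iso: "rep_iso L sV V \<rho> sW W \<tau>"
  shows "irreducible_rep L sW W \<tau>"
proof -
  interpret V: vector_space sV by (rule lie_representationD(1)[OF V])
  interpret W: vector_space sW by (rule lie_representationD(1)[OF W])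
  note sub = lie_representationD(2)[OF V] and subW = lie_representationD(2)[OF W]
  obtain T where T: "rep_hom L sV V \<rho> sW W \<tau> T" "bij_betw T V W"
    using iso unfolding rep_iso_iff_hom by blast
  have lin: "linear_on sV sW V T" and Ta: "\<And>a v. a \<in> L \<Longrightarrow> v \<in> V \<Longrightarrow> T (\<rho> a v) = \<tau> a (T v)"
    using T by (auto simp: rep_hom_def)
  have T0: "T 0 = 0" by (rule linear_on_0[OF V.vector_space_axioms sub lin])
  have TV: "T ` V = W" and inj: "inj_on T V" using T(2) by (auto simp: bij_betw_def)
  have 0: "0 \<in> V" by (rule V.subspace_0[OF sub])
  have "W \<noteq> {0}"
  proof
    assume "W = {0}"
    then have "T v = T 0" if "v \<in> V" for v using TV T0 that by auto
    then have "V \<subseteq> {0}" using inj 0 by (auto dest: inj_onD)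
    then show False using irrV 0 unfolding irreducible_rep_def by blast
  qed
  moreover have "U = {0} \<or> U = W"
    if U: "W.subspace U" "U \<subseteq> W" "\<And>a u. a \<in> L \<Longrightarrow> u \<in> U \<Longrightarrow> \<tau> a u \<in> U" for U
  proof -
    let ?U = "{v \<in> V. T v \<in> U}"
    have "V.subspace ?U"
      using sub U(1) unfolding V.subspace_def W.subspace_def
      by (auto simp: T0 linear_on_add[OF lin] linear_on_scale[OF lin])
    moreover have "\<forall>a\<in>L. \<forall>u\<in>?U. \<rho> a u \<in> ?U"
      using U(3) Ta lie_representationD(3)[OF V] by auto
    ultimately have "?U = {0} \<or> ?U = V"
      using irrV unfolding irreducible_rep_def by auto
    moreover have "U = T ` ?U" using U(2) TV by auto
    ultimately show ?thesis using TV T0 by auto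
  qed
  ultimately show ?thesis unfolding irreducible_rep_def by blast
qed

lemma linear_image_span:
  assumes V: "vector_space sV" "module.subspace sV V" "vector_space sW" and lin: "linear_on sV sW V T"
    and B: "B \<subseteq> V"
  shows "T ` module.span sV B = module.span sW (T ` B)"
proof -
  interpret V: vector_space sV by fact
  interpret W: vector_space sW by fact
  note sub = V(2)
  have spV: "V.span B \<subseteq> V" using B by (rule V.span_minimal[OF _ sub])
  show ?thesis
  proof
    show "T ` V.span B \<subseteq> W.span (T ` B)"
    proof
      fix w assume "w \<in> T ` V.span B"
      then obtain v where v: "v \<in> V.span B" "w = T v" by auto
      from v(1) have "v \<in> V \<and> T v \<in> W.span (T ` B)"
      proof (induction rule: V.span_induct_alt)
        case base
        show ?case using linear_on_0[OF V.vector_space_axioms sub lin] V.subspace_0[OF sub] W.span_zero by simp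
      next
        case (step c x y)
        then have "x \<in> V" "sV c x \<in> V" using B V.subspace_scale[OF sub] by auto
        then show ?case
          using step V.subspace_add[OF sub] W.span_add[OF W.span_scale[OF W.span_base[of "T x"]]]
          by (simp add: linear_on_add[OF lin] linear_on_scale[OF lin])
      qed
      then show "w \<in> W.span (T ` B)" using v by simp
    qed
    have "W.subspace (T ` V.span B)"
      unfolding W.subspace_def
    proof (intro conjI ballI allI)
      show "0 \<in> T ` V.span B"
        using linear_on_0[OF V.vector_space_axioms sub lin] V.span_zero by force
      show "x + y \<in> T ` V.span B" if "x \<in> T ` V.span B" "y \<in> T ` V.span B" for x y
        using that spV V.span_add by (auto simp: linear_on_add[OF lin, symmetric] subset_iff)
      show "sW c x \<in> T ` V.span B" if "x \<in> T ` V.span B" for c x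
        using that spV V.span_scale by (auto simp: linear_on_scale[OF lin, symmetric] subset_iff)
    qed
    moreover have "T ` B \<subseteq> T ` V.span B" using V.span_superset by auto
    ultimately show "W.span (T ` B) \<subseteq> T ` V.span B" by (intro W.span_minimal)
  qed
qed

lemma rep_iso_finite_dimensional:
  assumes V: "lie_representation sL bL L sV V \<rho>" and W: "lie_representation sL bL L sW W \<tau>"
    and fd: "finite_dimensional sV V" and iso: "rep_iso L sV V \<rho> sW W \<tau>"
  shows "finite_dimensional sW W"
proof -
  interpret V: vector_space sV by (rule lie_representationD(1)[OF V])
  obtain T where T: "rep_hom L sV V \<rho> sW W \<tau> T" "bij_betw T V W"
    using iso unfolding rep_iso_iff_hom by blast
  obtain B where B: "finite B" "V.span B = V" using fd unfolding finite_dimensional_def by blast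
  have "module.span sW (T ` B) = T ` V"
    using linear_image_span[OF lie_representationD(1,2)[OF V] lie_representationD(1)[OF W], of T B]
      T(1) B(2) V.span_superset[of B] by (auto simp: rep_hom_def)
  then show ?thesis using T(2) B(1) unfolding finite_dimensional_def bij_betw_def by auto
qed

lemma rep_transport:
  assumes V: "lie_representation sL bL L sV V \<rho>" and sW: "vector_space sW"
    and lin: "linear_on sV sW V T" and inj: "inj_on T V"
  defines "\<tau> \<equiv> \<lambda>a w. T (\<rho> a (inv_into V T w))"
  shows "lie_representation sL bL L sW (T ` V) \<tau>" and "rep_iso L sV V \<rho> sW (T ` V) \<tau>"
proof -
  interpret V: vector_space sV by (rule lie_representationD(1)[OF V])
  interpret W: vector_space sW by (rule sW)
  note sub = lie_representationD(2)[OF V]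
  note cl = lie_representationD(3)[OF V] V.subspace_add[OF sub] V.subspace_scale[OF sub]
  have \<tau>: "\<tau> a (T v) = T (\<rho> a v)" if "v \<in> V" for a v
    using inj that by (simp add: \<tau>_def)
  have add: "T v + T w = T (v + w)" and sc: "sW c (T v) = T (sV c v)" if "v \<in> V" "w \<in> V" for v w c
    using linear_on_add[OF lin] linear_on_scale[OF lin] that by auto
  show "lie_representation sL bL L sW (T ` V) \<tau>"
  proof (rule lie_representationI[OF sW])
    have "T ` V.span V = W.span (T ` V)"
      by (rule linear_image_span[OF V.vector_space_axioms sub sW lin order_refl])
    then have "T ` V = W.span (T ` V)" using V.span_eq_iff sub by metis
    then show "W.subspace (T ` V)" by (metis W.subspace_span)
    show "\<tau> a v \<in> T ` V" if "a \<in> L" "v \<in> T ` V" for a v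
      using that cl by (auto simp: \<tau>)
    show "linear_on sW sW (T ` V) (\<tau> a)" if a: "a \<in> L" for a
      unfolding linear_on_def ball_simps
    proof (intro conjI ballI allI)
      fix v w c assume vw: "v \<in> V" "w \<in> V"
      show "\<tau> a (T v + T w) = \<tau> a (T v) + \<tau> a (T w)"
        using vw a cl by (simp add: \<tau> add linear_on_add[OF lie_representationD(4)[OF V a]])
    next
      fix v c assume v: "v \<in> V"
      show "\<tau> a (sW c (T v)) = sW c (\<tau> a (T v))"
        using v a cl sc[OF v v] sc[of "\<rho> a v" "\<rho> a v"]
        by (simp add: \<tau> linear_on_scale[OF lie_representationD(4)[OF V a]])
    qed
    show "\<tau> (a + b) v = \<tau> a v + \<tau> b v" if ab: "a \<in> L" "b \<in> L" and "v \<in> T ` V" for a b v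
    proof -
      obtain v' where v': "v' \<in> V" "v = T v'" using \<open>v \<in> T ` V\<close> by auto
      show ?thesis using v' ab cl by (simp add: \<tau> lie_representationD(5)[OF V] add)
    qed
    show "\<tau> (sL c a) v = sW c (\<tau> a v)" if a: "a \<in> L" and "v \<in> T ` V" for a c v
    proof -
      obtain v' where v': "v' \<in> V" "v = T v'" using \<open>v \<in> T ` V\<close> by auto
      show ?thesis using v' a cl sc[of "\<rho> a v'" "\<rho> a v'"] by (simp add: \<tau> lie_representationD(6)[OF V])
    qed
    show "\<tau> (bL a b) v = \<tau> a (\<tau> b v) - \<tau> b (\<tau> a v)" if ab: "a \<in> L" "b \<in> L" and "v \<in> T ` V" for a b v
    proof -
      obtain v' where v': "v' \<in> V" "v = T v'" using \<open>v \<in> T ` V\<close> by auto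
      show ?thesis using v' ab cl
        by (simp add: \<tau> lie_representationD(7)[OF V] linear_on_diff[OF V.vector_space_axioms sub sW lin])
    qed
  qed
  show "rep_iso L sV V \<rho> sW (T ` V) \<tau>"
    unfolding rep_iso_iff_hom rep_hom_def using lin inj \<tau> by (intro exI[of _ T]) (auto simp: bij_betw_def)
qed

text \<open>The coordinates with respect to a basis identify a finite-dimensional space with a space of
  sequences.\<close>

lemma rep_model_exists:
  fixes sV :: "'k::field \<Rightarrow> 'v::ab_group_add \<Rightarrow> 'v"
  assumes V: "lie_representation sL bL L sV V \<rho>" and fd: "finite_dimensional sV V"
  obtains W :: "(nat \<Rightarrow> 'k) set" and \<tau> where "lie_representation sL bL L coord_scale W \<tau>"
    "finite_dimensional coord_scale W" "rep_iso L sV V \<rho> coord_scale W \<tau>"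
proof -
  interpret V: vector_space sV by (rule lie_representationD(1)[OF V])
  note sub = lie_representationD(2)[OF V]
  obtain B0 where B0: "finite B0" "V.span B0 = V" using fd unfolding finite_dimensional_def by blast
  obtain B where B: "B \<subseteq> V" "V.independent B" "V \<subseteq> V.span B"
    by (metis V.basis_exists)
  have finB: "finite B" using V.independent_span_bound[OF B0(1) B(2)] B(1) B0(2) by simp
  have spB: "V.span B = V" using V.span_minimal[OF B(1) sub] B(3) by blast
  obtain e where e: "bij_betw e {..<card B} B"
    using finB ex_bij_betw_nat_finite by (metis atLeast0LessThan)
  define T where "T v = (\<lambda>i. if i < card B then V.representation B v (e i) else 0)" for v
  have lin: "linear_on sV coord_scale V T"
    unfolding linear_on_def T_def fun_scale_def
    using B(2) spB by (auto simp: fun_eq_iff V.representation_add V.representation_scale)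
  have inj: "inj_on T V"
  proof (rule inj_onI)
    fix v w assume vw: "v \<in> V" "w \<in> V" "T v = T w"
    have "V.representation B v b = V.representation B w b" if "b \<in> B" for b
    proof -
      have "b \<in> e ` {..<card B}" using that bij_betw_imp_surj_on[OF e] by simp
      then obtain i where "i < card B" "e i = b" by auto
      then show ?thesis using fun_cong[OF vw(3), of i] by (simp add: T_def)
    qed
    moreover have "v = (\<Sum>b\<in>B. sV (V.representation B v b) b)" if "v \<in> V" for v
      using V.sum_representation_eq[OF B(2) _ finB order_refl] that spB by simp
    ultimately show "v = w" using vw by (metis (no_types, lifting) sum.cong)
  qed
  note tr = rep_transport[OF V vector_space_coord_scale lin inj]
  show ?thesis
    by (rule that[OF tr(1) rep_iso_finite_dimensional[OF V tr(1) fd tr(2)] tr(2)])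
qed

lemma (in ac_vector_space) irreducible_rep_iff:
  "irreducible_rep L scale V \<rho> \<longleftrightarrow> irreducible (\<rho> ` L) V"
  unfolding irreducible_rep_def irreducible_def invariant_def by auto

lemma (in ac_vector_space) lie_representation_operator:
  "lie_representation sL bL L scale V \<rho> \<Longrightarrow> f \<in> \<rho> ` L \<Longrightarrow> operator_on V f"
  unfolding operator_on_def using lie_representationD(3,4) by fast

section \<open>Tensor products\<close>

text \<open>Finitely many coordinates \<open>v j\<close> determine the elements \<open>v\<close> of a finite-dimensional space of
  sequences: each new spanning vector contributes at most one further coordinate.\<close>

lemma coordinate_expansion:
  fixes V :: "(nat \<Rightarrow> 'k::{alg_closed_field, field_char_0}) set"
  assumes "finite_dimensional coord_scale V"
  shows "\<exists>J b. finite J \<and> (\<forall>j\<in>J. b j \<in> V) \<and> (\<forall>v\<in>V. v = (\<Sum>j\<in>J. coord_scale (v j) (b j)))"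
proof -
  obtain B where B: "finite B" "coord.span B = V"
    using assms by (auto simp: finite_dimensional_def)
  have "\<exists>J b. finite J \<and> (\<forall>j\<in>J. b j \<in> coord.span B) \<and>
      (\<forall>v\<in>coord.span B. v = (\<Sum>j\<in>J. coord_scale (v j) (b j)))"
    using B(1)
  proof (induction B)
    case empty
    show ?case by (intro exI[of _ "{}"]) simp
  next
    case (insert w B)
    then obtain J b where J: "finite J" and b: "\<And>j. j \<in> J \<Longrightarrow> b j \<in> coord.span B"
      and ex: "\<And>v. v \<in> coord.span B \<Longrightarrow> v = (\<Sum>j\<in>J. coord_scale (v j) (b j))"
      by blast
    define E where "E v = v - (\<Sum>j\<in>J. coord_scale (v j) (b j))" for v
    have mono: "coord.span B \<subseteq> coord.span (insert w B)" by (rule coord.span_mono) auto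
    have E: "\<exists>c. E v = coord_scale c (E w)" if v: "v \<in> coord.span (insert w B)" for v
    proof -
      obtain c where c: "v - coord_scale c w \<in> coord.span B"
        using v coord.span_breakdown_eq by blast
      have "v - coord_scale c w = (\<Sum>j\<in>J. coord_scale (v j - c * w j) (b j))"
        using ex[OF c] by (simp add: fun_scale_def)
      then have "E v = coord_scale c (E w)"
        by (simp add: E_def fun_eq_iff fun_scale_def sum_fun_apply algebra_simps sum_subtractf
            sum_distrib_left)
      then show ?thesis ..
    qed
    show ?case
    proof (cases "E w = 0")
      case True
      have "v = (\<Sum>j\<in>J. coord_scale (v j) (b j))" if "v \<in> coord.span (insert w B)" for v
      proof -
        have "E v = 0" using E[OF that] True by (auto simp: fun_scale_def)
        then show ?thesis by (simp add: E_def)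
      qed
      then show ?thesis using J b mono by (intro exI[of _ J] exI[of _ b]) blast
    next
      case False
      then obtain j0 where j0: "E w j0 \<noteq> 0" by (auto simp: fun_eq_iff)
      (* The component of w outside the span of B is nonzero at j0; so the value at j0 serves as the
         additional coordinate, and each b j is corrected to vanish there. *)
      define w0 where "w0 = coord_scale (1 / E w j0) (E w)"
      have Ej0: "E v = coord_scale (E v j0) w0" if "v \<in> coord.span (insert w B)" for v
        using E[OF that] j0 by (auto simp: w0_def fun_scale_def fun_eq_iff)
      have "(\<Sum>j\<in>J. coord_scale (w j) (b j)) \<in> coord.span (insert w B)"
        using b mono by (intro coord.span_sum coord.span_scale) auto
      then have w0: "w0 \<in> coord.span (insert w B)"
        unfolding w0_def E_def by (intro coord.span_scale coord.span_diff) (auto intro: coord.span_base)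
      let ?b = "\<lambda>j. (if j \<in> J then b j - coord_scale (b j j0) w0 else 0) + (if j = j0 then w0 else 0)"
      have "?b j \<in> coord.span (insert w B)" for j
        using w0 b mono by (auto intro!: coord.span_add coord.span_diff coord.span_scale coord.span_zero)
      moreover have "v = (\<Sum>j\<in>insert j0 J. coord_scale (v j) (?b j))" if v: "v \<in> coord.span (insert w B)" for v
      proof
        fix i
        have "(\<Sum>j\<in>insert j0 J. coord_scale (v j) (?b j)) i =
            (\<Sum>j\<in>insert j0 J. (if j \<in> J then v j * (b j i - b j j0 * w0 i) else 0) +
               (if j = j0 then v j * w0 i else 0))"
          by (auto simp: sum_fun_apply fun_scale_def algebra_simps intro!: sum.cong)
        also have "\<dots> = (\<Sum>j\<in>J. v j * (b j i - b j j0 * w0 i)) + v j0 * w0 i"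
          using J by (simp add: sum.distrib sum.delta sum.If_cases Int_absorb1 subset_insertI
              insert_absorb Int_insert_left)
        also have "\<dots> = (\<Sum>j\<in>J. v j * b j i) + (v j0 - (\<Sum>j\<in>J. v j * b j j0)) * w0 i"
          by (simp add: algebra_simps sum_subtractf sum_distrib_left sum_distrib_right)
        also have "\<dots> = (\<Sum>j\<in>J. v j * b j i) + E v i"
          using fun_cong[OF Ej0[OF v], of i] by (simp add: E_def fun_scale_def sum_fun_apply)
        finally show "v i = (\<Sum>j\<in>insert j0 J. coord_scale (v j) (?b j)) i"
          by (simp add: E_def fun_scale_def sum_fun_apply)
      qed
      ultimately show ?thesis using J by (intro exI[of _ "insert j0 J"] exI[of _ ?b]) blast
    qed
  qed
  then show ?thesis using B(2) by simp
qed

lemma coordinate_expansion_family: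
  fixes V :: "'p \<Rightarrow> (nat \<Rightarrow> 'k::{alg_closed_field, field_char_0}) set"
  assumes "\<And>x. x \<in> X \<Longrightarrow> finite_dimensional coord_scale (V x)"
  shows "\<exists>J b. \<forall>x\<in>X. finite (J x) \<and> (\<forall>j\<in>J x. b x j \<in> V x) \<and>
    (\<forall>v\<in>V x. v = (\<Sum>j\<in>J x. coord_scale (v j) (b x j)))"
proof -
  have "\<forall>x\<in>X. \<exists>J b. finite J \<and> (\<forall>j\<in>J. b j \<in> V x) \<and> (\<forall>v\<in>V x. v = (\<Sum>j\<in>J. coord_scale (v j) (b j)))"
    using coordinate_expansion[OF assms] by blast
  from bchoice[OF this] obtain J where "\<forall>x\<in>X. \<exists>b. finite (J x) \<and> (\<forall>j\<in>J x. b j \<in> V x) \<and>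
      (\<forall>v\<in>V x. v = (\<Sum>j\<in>J x. coord_scale (v j) (b j)))" ..
  from bchoice[OF this] show ?thesis by blast
qed

definition multilinear_on ::
    "'p set \<Rightarrow> ('p \<Rightarrow> (nat \<Rightarrow> 'k::field) set) \<Rightarrow> ('k \<Rightarrow> 'w::ab_group_add \<Rightarrow> 'w) \<Rightarrow>
     (('p \<Rightarrow> nat \<Rightarrow> 'k) \<Rightarrow> 'w) \<Rightarrow> bool" where
  "multilinear_on X V sW m \<longleftrightarrow>
     (\<forall>v x. (\<forall>y\<in>X. v y \<in> V y) \<and> x \<in> X \<longrightarrow> linear_on coord_scale sW (V x) (\<lambda>u. m (v(x := u)))) \<and>
     (\<forall>v v'. (\<forall>x\<in>X. v x = v' x) \<longrightarrow> m v = m v')"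

lemma multilinear_on_linear:
  "multilinear_on X V sW m \<Longrightarrow> (\<And>y. y \<in> X \<Longrightarrow> v y \<in> V y) \<Longrightarrow> x \<in> X \<Longrightarrow>
    linear_on coord_scale sW (V x) (\<lambda>u. m (v(x := u)))"
  and multilinear_on_cong: "multilinear_on X V sW m \<Longrightarrow> (\<And>x. x \<in> X \<Longrightarrow> v x = v' x) \<Longrightarrow> m v = m v'"
  unfolding multilinear_on_def by blast+

lemma pure_tensor_fun_upd:
  assumes "finite X" "x \<in> X"
  shows "pure_tensor X (v(x := u)) i =
    (if i \<in> extensional X then u (i x) * (\<Prod>y\<in>X - {x}. v y (i y)) else 0)"
proof -
  have "(\<Prod>y\<in>X - {x}. (v(x := u)) y (i y)) = (\<Prod>y\<in>X - {x}. v y (i y))"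
    by (rule prod.cong) auto
  then show ?thesis using assms by (simp add: pure_tensor_def prod.remove)
qed

lemma multilinear_pure_tensor:
  assumes "finite X"
  shows "multilinear_on X V coord_scale (pure_tensor X)"
  unfolding multilinear_on_def linear_on_def
proof (intro conjI allI impI ballI)
  fix v v' :: "'a \<Rightarrow> nat \<Rightarrow> 'b" assume "\<forall>x\<in>X. v x = v' x"
  then show "pure_tensor X v = pure_tensor X v'" by (auto simp: pure_tensor_def fun_eq_iff)
qed (auto simp: fun_eq_iff pure_tensor_fun_upd[OF assms] fun_scale_def algebra_simps)

text \<open>A multilinear map is determined by its values on the \<open>b x j\<close>; the coefficients are the coordinates of
  the pure tensor of \<open>v\<close>.\<close>

lemma multilinear_expansion:
  fixes m :: "('p \<Rightarrow> nat \<Rightarrow> 'k::{alg_closed_field, field_char_0}) \<Rightarrow> 'w::ab_group_add"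
  assumes X: "finite X" and sW: "vector_space sW" and m: "multilinear_on X V sW m"
    and V: "\<And>x. x \<in> X \<Longrightarrow> coord.subspace (V x)"
    and J: "\<And>x. x \<in> X \<Longrightarrow> finite (J x)" and b: "\<And>x j. x \<in> X \<Longrightarrow> j \<in> J x \<Longrightarrow> b x j \<in> V x"
    and ex: "\<And>x u. x \<in> X \<Longrightarrow> u \<in> V x \<Longrightarrow> u = (\<Sum>j\<in>J x. coord_scale (u j) (b x j))"
    and v: "\<And>x. x \<in> X \<Longrightarrow> v x \<in> V x"
  shows "m v = (\<Sum>i\<in>PiE X J. sW (\<Prod>x\<in>X. v x (i x)) (m (\<lambda>x. b x (i x))))"
proof -
  interpret W: vector_space sW by (rule sW)
  (* Expand one argument after another: those in Y have been replaced by basis vectors. *)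
  let ?v = "\<lambda>Y i y. if y \<in> Y then b y (i y) else v y"
  have "m v = (\<Sum>i\<in>PiE Y J. sW (\<Prod>x\<in>Y. v x (i x)) (m (?v Y i)))" if "finite Y" "Y \<subseteq> X" for Y
    using that
  proof (induction Y)
    case empty
    show ?case by simp
  next
    case (insert x Y)
    then have xX: "x \<in> X" and YX: "Y \<subseteq> X" by auto
    have step: "m (?v Y i) = (\<Sum>j\<in>J x. sW (v x j) (m (?v (insert x Y) (i(x := j)))))"
      if i: "i \<in> PiE Y J" for i
    proof -
      have vY: "?v Y i y \<in> V y" if "y \<in> X" for y using that b v i YX by (auto simp: PiE_def Pi_def)
      note lin = multilinear_on_linear[OF m, of "?v Y i", OF vY xX]
      have "m (?v Y i) = m ((?v Y i)(x := v x))"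
        using insert.hyps by (intro arg_cong[where f = m]) auto
      also have "\<dots> = m ((?v Y i)(x := (\<Sum>j\<in>J x. coord_scale (v x j) (b x j))))"
        using ex[OF xX v[OF xX]] by simp
      also have "\<dots> = (\<Sum>j\<in>J x. m ((?v Y i)(x := coord_scale (v x j) (b x j))))"
        using V[OF xX] b[OF xX]
        by (intro linear_on_sum[OF vector_space_coord_scale _ lin]) (auto intro: coord.subspace_scale)
      also have "\<dots> = (\<Sum>j\<in>J x. sW (v x j) (m ((?v Y i)(x := b x j))))"
        using b[OF xX] by (intro sum.cong refl linear_on_scale[OF lin])
      also have "\<dots> = (\<Sum>j\<in>J x. sW (v x j) (m (?v (insert x Y) (i(x := j)))))"
        using insert.hyps by (intro sum.cong refl arg_cong2[where f = sW] arg_cong[where f = m]) auto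
      finally show ?thesis .
    qed
    have "m v = (\<Sum>i\<in>PiE Y J. sW (\<Prod>x\<in>Y. v x (i x)) (m (?v Y i)))"
      using insert YX by blast
    also have "\<dots> = (\<Sum>i\<in>PiE Y J. \<Sum>j\<in>J x.
        sW (\<Prod>y\<in>Y. v y (i y)) (sW (v x j) (m (?v (insert x Y) (i(x := j))))))"
      by (intro sum.cong refl) (simp add: step W.scale_sum_right)
    also have "\<dots> = (\<Sum>j\<in>J x. \<Sum>i\<in>PiE Y J.
        sW (\<Prod>y\<in>Y. v y (i y)) (sW (v x j) (m (?v (insert x Y) (i(x := j))))))"
      by (rule sum.swap)
    also have "\<dots> = (\<Sum>(j, i)\<in>J x \<times> PiE Y J.
        sW (\<Prod>y\<in>Y. v y (i y)) (sW (v x j) (m (?v (insert x Y) (i(x := j))))))"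
      by (rule sum.cartesian_product)
    also have "\<dots> = (\<Sum>(j, i)\<in>J x \<times> PiE Y J.
        sW (\<Prod>y\<in>insert x Y. v y ((i(x := j)) y)) (m (?v (insert x Y) (i(x := j)))))"
    proof (intro sum.cong refl, clarify)
      fix j i
      have "(\<Prod>y\<in>Y. v y ((i(x := j)) y)) = (\<Prod>y\<in>Y. v y (i y))"
        using insert.hyps by (intro prod.cong) auto
      then show "sW (\<Prod>y\<in>Y. v y (i y)) (sW (v x j) (m (?v (insert x Y) (i(x := j))))) =
          sW (\<Prod>y\<in>insert x Y. v y ((i(x := j)) y)) (m (?v (insert x Y) (i(x := j))))"
        using insert.hyps by (simp add: mult.commute)
    qed
    also have "\<dots> = (\<Sum>i\<in>(\<lambda>(j, i). i(x := j)) ` (J x \<times> PiE Y J).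
        sW (\<Prod>y\<in>insert x Y. v y (i y)) (m (?v (insert x Y) i)))"
      by (subst sum.reindex[OF inj_combinator]) (use insert.hyps in \<open>auto simp: case_prod_unfold\<close>)
    finally show ?case by (simp only: PiE_insert_eq)
  qed
  from this[OF X order_refl] have "m v = (\<Sum>i\<in>PiE X J. sW (\<Prod>x\<in>X. v x (i x)) (m (?v X i)))" .
  also have "\<dots> = (\<Sum>i\<in>PiE X J. sW (\<Prod>x\<in>X. v x (i x)) (m (\<lambda>x. b x (i x))))"
    by (intro sum.cong refl arg_cong2[where f = sW] multilinear_on_cong[OF m]) simp
  finally show ?thesis .
qed

text \<open>The universal property of the tensor product.  The preceding expansion defines \<open>T\<close> on all functions
  of a multi-index.\<close>

lemma tensor_universal:
  fixes m :: "('p \<Rightarrow> nat \<Rightarrow> 'k::{alg_closed_field, field_char_0}) \<Rightarrow> 'w::ab_group_add"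
  assumes X: "finite X" and fd: "\<And>x. x \<in> X \<Longrightarrow> finite_dimensional coord_scale (V x)"
    and sW: "vector_space sW" and m: "multilinear_on X V sW m"
  shows "\<exists>T. linear_on coord_scale sW UNIV T \<and>
    (\<forall>v. (\<forall>x\<in>X. v x \<in> V x) \<longrightarrow> T (pure_tensor X v) = m v)"
proof -
  interpret W: vector_space sW by (rule sW)
  have "\<exists>J b. \<forall>x\<in>X. finite (J x) \<and> (\<forall>j\<in>J x. b x j \<in> V x) \<and>
      (\<forall>v\<in>V x. v = (\<Sum>j\<in>J x. coord_scale (v j) (b x j)))"
    by (rule coordinate_expansion_family) (rule fd)
  then obtain J b where "\<forall>x\<in>X. finite (J x) \<and> (\<forall>j\<in>J x. b x j \<in> V x) \<and>
      (\<forall>v\<in>V x. v = (\<Sum>j\<in>J x. coord_scale (v j) (b x j)))"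
    by (elim exE) (rule that)
  then have J: "\<And>x. x \<in> X \<Longrightarrow> finite (J x)"
    and b: "\<And>x j. x \<in> X \<Longrightarrow> j \<in> J x \<Longrightarrow> b x j \<in> V x"
    and ex: "\<And>x u. x \<in> X \<Longrightarrow> u \<in> V x \<Longrightarrow> u = (\<Sum>j\<in>J x. coord_scale (u j) (b x j))"
    by blast+
  define T where "T w = (\<Sum>i\<in>PiE X J. sW (w i) (m (\<lambda>x. b x (i x))))" for w
  have "linear_on coord_scale sW UNIV T"
    unfolding linear_on_def T_def fun_scale_def
    by (simp add: W.scale_left_distrib sum.distrib W.scale_sum_right)
  moreover have "T (pure_tensor X v) = m v" if v: "\<And>x. x \<in> X \<Longrightarrow> v x \<in> V x" for v
  proof -
    have "m v = (\<Sum>i\<in>PiE X J. sW (\<Prod>x\<in>X. v x (i x)) (m (\<lambda>x. b x (i x))))"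
      by (rule multilinear_expansion[OF X sW m coord.finite_dimensional_imp_subspace[OF fd] J b ex v])
    then show ?thesis unfolding T_def pure_tensor_def by (simp add: PiE_def)
  qed
  ultimately show ?thesis by (intro exI[of _ T]) simp
qed

lemma tensor_space_finite_dimensional:
  fixes V :: "'p \<Rightarrow> (nat \<Rightarrow> 'k::{alg_closed_field, field_char_0}) set"
  assumes X: "finite X" and fd: "\<And>x. x \<in> X \<Longrightarrow> finite_dimensional coord_scale (V x)"
  shows "finite_dimensional coord_scale (tensor_space X V)"
proof -
  have "\<exists>J b. \<forall>x\<in>X. finite (J x) \<and> (\<forall>j\<in>J x. b x j \<in> V x) \<and>
      (\<forall>v\<in>V x. v = (\<Sum>j\<in>J x. coord_scale (v j) (b x j)))"
    by (rule coordinate_expansion_family) (rule fd)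
  then obtain J b where "\<forall>x\<in>X. finite (J x) \<and> (\<forall>j\<in>J x. b x j \<in> V x) \<and>
      (\<forall>v\<in>V x. v = (\<Sum>j\<in>J x. coord_scale (v j) (b x j)))"
    by (elim exE) (rule that)
  then have J: "\<And>x. x \<in> X \<Longrightarrow> finite (J x)"
    and b: "\<And>x j. x \<in> X \<Longrightarrow> j \<in> J x \<Longrightarrow> b x j \<in> V x"
    and ex: "\<And>x u. x \<in> X \<Longrightarrow> u \<in> V x \<Longrightarrow> u = (\<Sum>j\<in>J x. coord_scale (u j) (b x j))"
    by blast+
  let ?B = "(\<lambda>i. pure_tensor X (\<lambda>x. b x (i x))) ` PiE X J"
  have "pure_tensor X v \<in> coord.span ?B" if v: "\<forall>x\<in>X. v x \<in> V x" for v
  proof -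
    have "pure_tensor X v = (\<Sum>i\<in>PiE X J.
        coord_scale (\<Prod>x\<in>X. v x (i x)) (pure_tensor X (\<lambda>x. b x (i x))))"
      by (rule multilinear_expansion[OF X vector_space_coord_scale multilinear_pure_tensor[OF X]
            coord.finite_dimensional_imp_subspace[OF fd] J b ex]) (use v in auto)
    then show ?thesis
      by (simp only:) (intro coord.span_sum coord.span_scale coord.span_base imageI)
  qed
  then have "tensor_space X V \<subseteq> coord.span ?B"
    unfolding tensor_space_def by (intro coord.span_minimal) auto
  moreover have "coord.span ?B \<subseteq> tensor_space X V"
    unfolding tensor_space_def
  proof (rule coord.span_mono, rule image_subsetI)
    fix i assume "i \<in> PiE X J"
    then show "pure_tensor X (\<lambda>x. b x (i x)) \<in> {pure_tensor X v |v. \<forall>x\<in>X. v x \<in> V x}"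
      using b by (intro CollectI exI[of _ "\<lambda>x. b x (i x)"]) (auto simp: PiE_def Pi_def)
  qed
  moreover have "finite ?B" using X J by (intro finite_imageI finite_PiE)
  ultimately show ?thesis unfolding finite_dimensional_def by blast
qed

text \<open>\<open>slot X x f\<close> is the operator \<open>id \<otimes> \<dots> \<otimes> f \<otimes> \<dots> \<otimes> id\<close> with \<open>f\<close> at the place \<open>x\<close>.\<close>

definition slot ::
    "'p set \<Rightarrow> 'p \<Rightarrow> ((nat \<Rightarrow> 'k) \<Rightarrow> (nat \<Rightarrow> 'k)) \<Rightarrow> (('p \<Rightarrow> nat) \<Rightarrow> 'k::field) \<Rightarrow> ('p \<Rightarrow> nat) \<Rightarrow> 'k" where
  "slot X x f w = (\<lambda>i. if i \<in> extensional X then f (\<lambda>j. w (i(x := j))) (i x) else 0)"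

lemma extensional_upd: "i \<in> extensional X \<Longrightarrow> x \<in> X \<Longrightarrow> i(x := j) \<in> extensional X"
  by (auto simp: extensional_def)

lemma ev_rep_slot: "ev_rep X \<rho> \<alpha> w = (\<Sum>x\<in>X. slot X x (\<rho> x (\<alpha> x)) w)"
  by (auto simp: ev_rep_def ev_def tensor_rep_def slot_def sum_fun_apply fun_eq_iff)

lemma slot_add: "slot X x (\<lambda>u. f u + g u) w = slot X x f w + slot X x g w"
  by (auto simp: slot_def fun_eq_iff)

lemma slot_scale: "slot X x (\<lambda>u. coord_scale c (f u)) w = coord_scale c (slot X x f w)"
  by (auto simp: slot_def fun_eq_iff fun_scale_def)

lemma slot_comp: "x \<in> X \<Longrightarrow> slot X x (\<lambda>u. f (g u)) w = slot X x f (slot X x g w)"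
  by (auto simp: slot_def fun_eq_iff extensional_upd)

lemma pure_tensor_slice:
  assumes "finite X" "x \<in> X" "i \<in> extensional X"
  shows "(\<lambda>j. pure_tensor X v (i(x := j))) = coord_scale (\<Prod>y\<in>X - {x}. v y (i y)) (v x)"
proof
  fix j
  have "(\<Prod>y\<in>X - {x}. v y ((i(x := j)) y)) = (\<Prod>y\<in>X - {x}. v y (i y))"
    by (rule prod.cong) auto
  then show "pure_tensor X v (i(x := j)) = coord_scale (\<Prod>y\<in>X - {x}. v y (i y)) (v x) j"
    using assms by (simp add: pure_tensor_def extensional_upd prod.remove fun_scale_def)
qed

locale tensor =
  fixes X :: "'p set" and V :: "'p \<Rightarrow> (nat \<Rightarrow> 'k::{alg_closed_field, field_char_0}) set"
  assumes finite_X: "finite X" and subspace_V: "x \<in> X \<Longrightarrow> coord.subspace (V x)"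
begin

abbreviation "TS \<equiv> tensor_space X V"

lemma subspace_TS: "coord.subspace TS"
  by (simp add: tensor_space_def coord.subspace_span)

lemma pure_tensor_in_TS: "(\<And>x. x \<in> X \<Longrightarrow> v x \<in> V x) \<Longrightarrow> pure_tensor X v \<in> TS"
  unfolding tensor_space_def by (rule coord.span_base) auto

lemma TS_induct [consumes 1, case_names zero step]:
  assumes "w \<in> TS" and "P 0"
    and "\<And>c v w. (\<And>x. x \<in> X \<Longrightarrow> v x \<in> V x) \<Longrightarrow> w \<in> TS \<Longrightarrow> P w \<Longrightarrow> P (coord_scale c (pure_tensor X v) + w)"
  shows "P w"
proof -
  have "w \<in> TS \<and> P w"
    using assms(1) unfolding tensor_space_def
  proof (induction rule: coord.span_induct_alt)
    case base
    show ?case by (intro conjI coord.span_zero assms(2))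
  next
    case (step c p w)
    then obtain v where v: "p = pure_tensor X v" "\<And>x. x \<in> X \<Longrightarrow> v x \<in> V x" by auto
    have "coord_scale c p + w \<in> coord.span {pure_tensor X v |v. \<forall>x\<in>X. v x \<in> V x}"
      using step by (intro coord.span_add coord.span_scale) (auto intro: coord.span_base)
    moreover have "P (coord_scale c p + w)"
      unfolding v(1) by (rule assms(3)) (use step v in \<open>auto simp: tensor_space_def\<close>)
    ultimately show ?case ..
  qed
  then show ?thesis ..
qed

lemma TS_eqI:
  assumes "vector_space sW" "linear_on coord_scale sW TS f" "linear_on coord_scale sW TS g"
    and "\<And>v. (\<And>x. x \<in> X \<Longrightarrow> v x \<in> V x) \<Longrightarrow> f (pure_tensor X v) = g (pure_tensor X v)" and "w \<in> TS"
  shows "f w = g w"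
proof (rule linear_on_span_eq[OF vector_space_coord_scale subspace_TS assms(1-3)])
  show "w \<in> coord.span {pure_tensor X v | v. \<forall>x\<in>X. v x \<in> V x}"
    using assms(5) by (simp add: tensor_space_def)
qed (use assms(4) pure_tensor_in_TS in auto)

lemma slice_in:
  assumes "w \<in> TS" "x \<in> X" "i \<in> extensional X"
  shows "(\<lambda>j. w (i(x := j))) \<in> V x"
  using assms(1)
proof (induction rule: TS_induct)
  case zero
  show ?case using coord.subspace_0[OF subspace_V[OF assms(2)]] by (simp add: zero_fun_def)
next
  case (step c v w)
  have "(\<lambda>j. (coord_scale c (pure_tensor X v) + w) (i(x := j))) =
      coord_scale c (\<lambda>j. pure_tensor X v (i(x := j))) + (\<lambda>j. w (i(x := j)))"
    by (simp add: fun_eq_iff fun_scale_def)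
  also have "\<dots> \<in> V x"
    unfolding pure_tensor_slice[OF finite_X assms(2,3)]
    by (intro coord.subspace_add[OF subspace_V] coord.subspace_scale[OF subspace_V] step assms(2))
  finally show ?case .
qed

lemma TS_support: "w \<in> TS \<Longrightarrow> i \<notin> extensional X \<Longrightarrow> w i = 0"
  by (induction rule: TS_induct) (auto simp: pure_tensor_def fun_scale_def)

lemma slot_cong:
  "w \<in> TS \<Longrightarrow> x \<in> X \<Longrightarrow> (\<And>u. u \<in> V x \<Longrightarrow> f u = g u) \<Longrightarrow> slot X x f w = slot X x g w"
  using slice_in by (auto simp: slot_def fun_eq_iff)

lemma slot_pure_tensor:
  assumes x: "x \<in> X" and f: "linear_on coord_scale coord_scale (V x) f" and v: "v x \<in> V x"
  shows "slot X x f (pure_tensor X v) = pure_tensor X (v(x := f (v x)))"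
proof
  fix i
  show "slot X x f (pure_tensor X v) i = pure_tensor X (v(x := f (v x))) i"
  proof (cases "i \<in> extensional X")
    case True
    then show ?thesis
      unfolding slot_def pure_tensor_fun_upd[OF finite_X x] pure_tensor_slice[OF finite_X x True]
        linear_on_scale[OF f v]
      by (simp add: fun_scale_def mult.commute)
  qed (simp add: slot_def pure_tensor_def)
qed

lemma slot_linear:
  assumes x: "x \<in> X" and f: "linear_on coord_scale coord_scale (V x) f"
  shows "linear_on coord_scale coord_scale TS (slot X x f)"
  unfolding linear_on_def
proof (intro conjI ballI allI ext)
  fix v w i assume vw: "v \<in> TS" "w \<in> TS"
  have "(\<lambda>j. (v + w) (i(x := j))) = (\<lambda>j. v (i(x := j))) + (\<lambda>j. w (i(x := j)))"
    by (simp add: fun_eq_iff)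
  then show "slot X x f (v + w) i = (slot X x f v + slot X x f w) i"
    using linear_on_add[OF f slice_in slice_in] vw x by (simp add: slot_def)
next
  fix c v i assume v: "v \<in> TS"
  have "(\<lambda>j. coord_scale c v (i(x := j))) = coord_scale c (\<lambda>j. v (i(x := j)))"
    by (simp add: fun_eq_iff fun_scale_def)
  then show "slot X x f (coord_scale c v) i = coord_scale c (slot X x f v) i"
    using linear_on_scale[OF f slice_in] v x by (simp add: slot_def) (simp add: fun_scale_def slot_def)
qed

lemma slot_operator:
  assumes x: "x \<in> X" and f: "coord.operator_on (V x) f"
  shows "coord.operator_on TS (slot X x f)"
  unfolding coord.operator_on_def
proof (intro conjI ballI)
  note lin = slot_linear[OF x coord.operator_on_linear[OF f]]
  show "linear_on coord_scale coord_scale TS (slot X x f)" by (rule lin)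
  fix w assume "w \<in> TS"
  then show "slot X x f w \<in> TS"
  proof (induction rule: TS_induct)
    case zero
    show ?case
      unfolding linear_on_0[OF vector_space_coord_scale subspace_TS lin]
      by (rule coord.subspace_0[OF subspace_TS])
  next
    case (step c v w)
    have p: "pure_tensor X v \<in> TS" "pure_tensor X (v(x := f (v x))) \<in> TS"
      using step(1) coord.operator_on_closed[OF f] x by (auto intro!: pure_tensor_in_TS)
    have "slot X x f (coord_scale c (pure_tensor X v) + w) =
        coord_scale c (pure_tensor X (v(x := f (v x)))) + slot X x f w"
      using step p coord.subspace_scale[OF subspace_TS] x
      by (simp add: linear_on_add[OF lin] linear_on_scale[OF lin]
          slot_pure_tensor[OF x coord.operator_on_linear[OF f]])
    then show ?case
      using coord.subspace_add[OF subspace_TS coord.subspace_scale[OF subspace_TS p(2)] step(3)]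
      by (simp only:)
  qed
qed

lemma slot_commute:
  assumes x: "x \<in> X" and y: "y \<in> X" and "x \<noteq> y"
    and f: "coord.operator_on (V x) f" and g: "coord.operator_on (V y) g" and w: "w \<in> TS"
  shows "slot X x f (slot X y g w) = slot X y g (slot X x f w)"
proof (rule TS_eqI[where f = "\<lambda>w. slot X x f (slot X y g w)" and g = "\<lambda>w. slot X y g (slot X x f w)",
      OF vector_space_coord_scale _ _ _ w])
  note F = slot_operator[OF x f] and G = slot_operator[OF y g]
  show "linear_on coord_scale coord_scale TS (\<lambda>w. slot X x f (slot X y g w))"
    unfolding linear_on_def using coord.operator_on_closed[OF G]
    by (simp add: coord.operator_on_add[OF F] coord.operator_on_add[OF G]
        coord.operator_on_scale[OF F] coord.operator_on_scale[OF G])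
  show "linear_on coord_scale coord_scale TS (\<lambda>w. slot X y g (slot X x f w))"
    unfolding linear_on_def using coord.operator_on_closed[OF F]
    by (simp add: coord.operator_on_add[OF F] coord.operator_on_add[OF G]
        coord.operator_on_scale[OF F] coord.operator_on_scale[OF G])
  fix v assume v: "\<And>x. x \<in> X \<Longrightarrow> v x \<in> V x"
  show "slot X x f (slot X y g (pure_tensor X v)) = slot X y g (slot X x f (pure_tensor X v))"
    using v x y \<open>x \<noteq> y\<close>
    by (simp add: slot_pure_tensor coord.operator_on_linear[OF f] coord.operator_on_linear[OF g]
        fun_upd_twist)
qed

text \<open>By density, the algebra generated by \<open>Ops x\<close> contains an operator that sends \<open>u \<in> V x\<close> to
  \<open>u (i0 x)\<close> times a prescribed vector \<open>v x\<close>.  Applied in every slot to an element \<open>w\<close> with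
  \<open>w i0 \<noteq> 0\<close>, these operators produce \<open>w i0\<close> times the pure tensor of the \<open>v x\<close>.\<close>

lemma tensor_irreducible:
  assumes fd: "\<And>x. x \<in> X \<Longrightarrow> finite_dimensional coord_scale (V x)"
    and Ops: "\<And>x f. x \<in> X \<Longrightarrow> f \<in> Ops x \<Longrightarrow> coord.operator_on (V x) f"
    and irr: "\<And>x. x \<in> X \<Longrightarrow> coord.irreducible (Ops x) (V x)"
    and U: "coord.subspace U" "U \<subseteq> TS" "U \<noteq> {0}"
    and inv: "\<And>x f w. x \<in> X \<Longrightarrow> f \<in> Ops x \<Longrightarrow> w \<in> U \<Longrightarrow> slot X x f w \<in> U"
  shows "U = TS"
proof
  have inv': "slot X x f w \<in> U" if x: "x \<in> X" and f: "f \<in> coord.op_algebra (Ops x)" and w: "w \<in> U" for x f w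
    using f w
  proof (induction arbitrary: w)
    case id
    have "slot X x (\<lambda>v. v) w = w"
      using TS_support[of w] id U(2) by (auto simp: slot_def fun_eq_iff)
    then show ?case using id by simp
  next
    case (gen f)
    then show ?case using inv x by blast
  next
    case (add f g)
    then show ?case unfolding slot_add by (intro coord.subspace_add[OF U(1)])
  next
    case (scale f c)
    then show ?case unfolding slot_scale by (intro coord.subspace_scale[OF U(1)])
  next
    case (comp f g)
    then show ?case unfolding slot_comp[OF x] by blast
  qed
  obtain w where w: "w \<in> U" "w \<noteq> 0" using U coord.subspace_0[OF U(1)] by blast
  then obtain i0 where i0: "w i0 \<noteq> 0" by (auto simp: fun_eq_iff)
  then have i0X: "i0 \<in> extensional X" using TS_support[of w i0] w U(2) by blast
  have pure: "pure_tensor X v \<in> U" if v: "\<And>x. x \<in> X \<Longrightarrow> v x \<in> V x" for v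
  proof -
    define wY where "wY Y = (\<lambda>i. if i \<in> extensional X
      then (\<Prod>x\<in>Y. v x (i x)) * w (\<lambda>y. if y \<in> Y then i0 y else i y) else 0)" for Y
    have "wY Y \<in> U" if "finite Y" "Y \<subseteq> X" for Y
      using that
    proof (induction Y)
      case empty
      have "wY {} = w" using TS_support[of w] w(1) U(2) by (auto simp: wY_def fun_eq_iff)
      then show ?case using w(1) by simp
    next
      case (insert x Y)
      then have x: "x \<in> X" and YX: "Y \<subseteq> X" by auto
      have "linear_on coord_scale (*) (V x) (\<lambda>u. u (i0 x))"
        by (simp add: linear_on_def fun_scale_def)
      from coord.density_rank_one[OF fd[OF x] Ops[OF x] irr[OF x] this v[OF x]]
      obtain f where f: "f \<in> coord.op_algebra (Ops x)"
        "\<And>u. u \<in> V x \<Longrightarrow> f u = coord_scale (u (i0 x)) (v x)" by auto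
      have wYU: "wY Y \<in> U" using insert YX by blast
      have "slot X x f (wY Y) = wY (insert x Y)"
      proof
        fix i
        show "slot X x f (wY Y) i = wY (insert x Y) i"
        proof (cases "i \<in> extensional X")
          case True
          have "slot X x f (wY Y) i = wY Y (i(x := i0 x)) * v x (i x)"
            using True f(2)[OF slice_in[OF _ x True]] wYU U(2)
            by (auto simp: slot_def fun_scale_def)
          also have "wY Y (i(x := i0 x)) = (\<Prod>y\<in>Y. v y (i y)) * w (\<lambda>y. if y \<in> insert x Y then i0 y else i y)"
          proof -
            have "(\<Prod>y\<in>Y. v y ((i(x := i0 x)) y)) = (\<Prod>y\<in>Y. v y (i y))"
              using insert.hyps by (intro prod.cong) auto
            moreover have "(\<lambda>y. if y \<in> Y then i0 y else (i(x := i0 x)) y) =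
                (\<lambda>y. if y \<in> insert x Y then i0 y else i y)"
              by auto
            ultimately show ?thesis using extensional_upd[OF True x] by (simp add: wY_def)
          qed
          finally show ?thesis using insert.hyps True by (simp add: wY_def mult.commute mult.left_commute)
        qed (simp add: slot_def wY_def)
      qed
      then show ?case using inv'[OF x f(1) wYU] by simp
    qed
    from this[OF finite_X order_refl] have "coord_scale (1 / w i0) (wY X) \<in> U"
      by (rule coord.subspace_scale[OF U(1)])
    also have "coord_scale (1 / w i0) (wY X) = pure_tensor X v"
    proof
      fix i
      have "(\<lambda>y. if y \<in> X then i0 y else i y) = i0" if "i \<in> extensional X"
        using that i0X by (auto simp: extensional_def fun_eq_iff)
      then show "coord_scale (1 / w i0) (wY X) i = pure_tensor X v i"
        using i0 by (simp add: fun_scale_def wY_def pure_tensor_def)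
    qed
    finally show ?thesis .
  qed
  show "TS \<subseteq> U" unfolding tensor_space_def by (rule coord.span_minimal[OF _ U(1)]) (use pure in auto)
qed (rule U(2))

lemma pure_tensor_nonzero:
  assumes "\<And>x. x \<in> X \<Longrightarrow> v x \<noteq> 0"
  shows "pure_tensor X v \<noteq> 0"
proof -
  have "\<forall>x\<in>X. \<exists>j. v x j \<noteq> 0" using assms by (auto simp: fun_eq_iff)
  then obtain i where i: "\<And>x. x \<in> X \<Longrightarrow> v x (i x) \<noteq> 0" by metis
  then have "pure_tensor X v (restrict i X) \<noteq> 0"
    using finite_X by (simp add: pure_tensor_def)
  then show ?thesis by auto
qed

end

section \<open>Evaluation representations\<close>

locale evaluation_rep = tensor X V for X :: "'k::{alg_closed_field, field_char_0} set"
    and V :: "'k \<Rightarrow> (nat \<Rightarrow> 'k) set" +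
  fixes s :: "'k \<Rightarrow> 'g::ab_group_add \<Rightarrow> 'g" and br :: "'g \<Rightarrow> 'g \<Rightarrow> 'g"
    and L :: "'k \<Rightarrow> 'g set" and \<rho> :: "'k \<Rightarrow> 'g \<Rightarrow> (nat \<Rightarrow> 'k) \<Rightarrow> (nat \<Rightarrow> 'k)" and M :: "('k \<Rightarrow> 'g) set"
  assumes rep: "x \<in> X \<Longrightarrow> lie_representation s br (L x) coord_scale (V x) (\<rho> x)"
    and M_in: "\<alpha> \<in> M \<Longrightarrow> x \<in> X \<Longrightarrow> \<alpha> x \<in> L x"
begin

lemma rep_operator: "x \<in> X \<Longrightarrow> a \<in> L x \<Longrightarrow> coord.operator_on (V x) (\<rho> x a)"
  using coord.lie_representation_operator[OF rep] by blast

lemma slot_rep_operator: "x \<in> X \<Longrightarrow> a \<in> L x \<Longrightarrow> coord.operator_on TS (slot X x (\<rho> x a))"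
  by (intro slot_operator rep_operator)

lemma ev_rep_linear:
  assumes "\<alpha> \<in> M"
  shows "linear_on coord_scale coord_scale TS (ev_rep X \<rho> \<alpha>)"
  unfolding linear_on_def ev_rep_slot
  by (auto simp: sum.distrib[symmetric] coord.scale_sum_right assms M_in
      coord.operator_on_add[OF slot_rep_operator] coord.operator_on_scale[OF slot_rep_operator]
      intro!: sum.cong)

lemma ev_rep_pure_tensor:
  assumes "\<alpha> \<in> M" "\<And>x. x \<in> X \<Longrightarrow> v x \<in> V x"
  shows "ev_rep X \<rho> \<alpha> (pure_tensor X v) = (\<Sum>x\<in>X. pure_tensor X (v(x := \<rho> x (\<alpha> x) (v x))))"
  unfolding ev_rep_slot
  using assms lie_representationD(4)[OF rep] M_in by (intro sum.cong refl slot_pure_tensor) auto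

text \<open>In the commutator of two sums of slot operators only the terms at equal places survive.\<close>

lemma ev_rep_lie_representation:
  "lie_representation (fun_scale s) (fun_bracket br) M coord_scale TS (ev_rep X \<rho>)"
proof (rule lie_representationI[OF vector_space_coord_scale subspace_TS])
  note cl = coord.operator_on_closed[OF slot_rep_operator[OF _ M_in]]
  show "ev_rep X \<rho> a v \<in> TS" if "a \<in> M" "v \<in> TS" for a v
    unfolding ev_rep_slot using that cl by (intro coord.subspace_sum[OF subspace_TS]) auto
  show "linear_on coord_scale coord_scale TS (ev_rep X \<rho> a)" if "a \<in> M" for a
    by (rule ev_rep_linear[OF that])
  fix a b v assume a: "a \<in> M" and v: "v \<in> TS"
  show "ev_rep X \<rho> (fun_scale s c a) v = coord_scale c (ev_rep X \<rho> a v)" for c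
  proof -
    have "slot X x (\<rho> x (fun_scale s c a x)) v = coord_scale c (slot X x (\<rho> x (a x)) v)" if "x \<in> X" for x
      unfolding slot_scale[symmetric] fun_scale_def[of s]
      using lie_representationD(6)[OF rep] that M_in[OF a] by (intro slot_cong[OF v]) auto
    then show ?thesis unfolding ev_rep_slot coord.scale_sum_right by (intro sum.cong refl)
  qed
  assume b: "b \<in> M"
  show "ev_rep X \<rho> (a + b) v = ev_rep X \<rho> a v + ev_rep X \<rho> b v"
  proof -
    have "slot X x (\<rho> x ((a + b) x)) v = slot X x (\<rho> x (a x)) v + slot X x (\<rho> x (b x)) v" if "x \<in> X" for x
      unfolding slot_add[symmetric] plus_fun_apply
      using lie_representationD(5)[OF rep] that M_in[OF a] M_in[OF b] by (intro slot_cong[OF v]) auto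
    then show ?thesis unfolding ev_rep_slot sum.distrib[symmetric] by (intro sum.cong refl)
  qed
  let ?A = "\<lambda>x. slot X x (\<rho> x (a x))" and ?B = "\<lambda>x. slot X x (\<rho> x (b x))"
  have "slot X x (\<rho> x (fun_bracket br a b x)) v = ?A x (?B x v) - ?B x (?A x v)" if x: "x \<in> X" for x
  proof -
    have "slot X x (\<rho> x (fun_bracket br a b x)) v =
        slot X x (\<lambda>u. \<rho> x (a x) (\<rho> x (b x) u) + coord_scale (- 1) (\<rho> x (b x) (\<rho> x (a x) u))) v"
      unfolding fun_bracket_def
      using lie_representationD(7)[OF rep] x M_in[OF a] M_in[OF b] by (intro slot_cong[OF v]) auto
    also have "\<dots> = ?A x (?B x v) + coord_scale (- 1) (?B x (?A x v))"
      by (simp only: slot_add slot_scale slot_comp[OF x])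
    finally show ?thesis
      by (simp only: coord.scale_minus_left coord.scale_one diff_conv_add_uminus)
  qed
  then have "ev_rep X \<rho> (fun_bracket br a b) v = (\<Sum>x\<in>X. ?A x (?B x v) - ?B x (?A x v))"
    unfolding ev_rep_slot by (intro sum.cong refl)
  also have "\<dots> = (\<Sum>x\<in>X. \<Sum>y\<in>X. ?A x (?B y v) - ?B y (?A x v))"
  proof (intro sum.cong refl)
    fix x assume x: "x \<in> X"
    have "(\<Sum>y\<in>X. ?A x (?B y v) - ?B y (?A x v)) = (\<Sum>y\<in>{x}. ?A x (?B y v) - ?B y (?A x v))"
    proof (rule sum.mono_neutral_right[OF finite_X])
      show "\<forall>y\<in>X - {x}. ?A x (?B y v) - ?B y (?A x v) = 0"
        using slot_commute[OF x _ _ rep_operator[OF x M_in[OF a x]] rep_operator[OF _ M_in[OF b]] v]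
        by auto
    qed (use x in auto)
    then show "?A x (?B x v) - ?B x (?A x v) = (\<Sum>y\<in>X. ?A x (?B y v) - ?B y (?A x v))" by simp
  qed
  also have "\<dots> = (\<Sum>x\<in>X. \<Sum>y\<in>X. ?A x (?B y v)) - (\<Sum>x\<in>X. \<Sum>y\<in>X. ?B y (?A x v))"
    by (simp only: sum_subtractf)
  also have "(\<Sum>x\<in>X. \<Sum>y\<in>X. ?B y (?A x v)) = (\<Sum>y\<in>X. \<Sum>x\<in>X. ?B y (?A x v))"
    by (rule sum.swap)
  also have "(\<Sum>x\<in>X. \<Sum>y\<in>X. ?A x (?B y v)) = (\<Sum>x\<in>X. ?A x (\<Sum>y\<in>X. ?B y v))"
    using cl[OF _ b] v
    by (intro sum.cong refl coord.operator_on_sum[OF subspace_TS slot_rep_operator[OF _ M_in[OF a]], symmetric]) auto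
  also have "(\<Sum>y\<in>X. \<Sum>x\<in>X. ?B y (?A x v)) = (\<Sum>y\<in>X. ?B y (\<Sum>x\<in>X. ?A x v))"
    using cl[OF _ a] v
    by (intro sum.cong refl coord.operator_on_sum[OF subspace_TS slot_rep_operator[OF _ M_in[OF b]], symmetric]) auto
  finally show "ev_rep X \<rho> (fun_bracket br a b) v = ev_rep X \<rho> a (ev_rep X \<rho> b v) - ev_rep X \<rho> b (ev_rep X \<rho> a v)"
    unfolding ev_rep_slot .
qed

text \<open>An equivariant multilinear map factors through the tensor product; equivariance is checked on
  pure tensors.\<close>

lemma multilinear_hom:
  fixes sW :: "'k \<Rightarrow> 'w::ab_group_add \<Rightarrow> 'w"
  assumes fd: "\<And>x. x \<in> X \<Longrightarrow> finite_dimensional coord_scale (V x)"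
    and W: "lie_representation sL bL M sW W \<tau>" and m: "multilinear_on X V sW m"
    and m_W: "\<And>v. (\<And>x. x \<in> X \<Longrightarrow> v x \<in> V x) \<Longrightarrow> m v \<in> W"
    and m_eq: "\<And>\<alpha> v. \<alpha> \<in> M \<Longrightarrow> (\<And>x. x \<in> X \<Longrightarrow> v x \<in> V x) \<Longrightarrow>
      (\<Sum>x\<in>X. m (v(x := \<rho> x (\<alpha> x) (v x)))) = \<tau> \<alpha> (m v)"
  shows "\<exists>T. rep_hom M coord_scale TS (ev_rep X \<rho>) sW W \<tau> T \<and>
    (\<forall>v. (\<forall>x\<in>X. v x \<in> V x) \<longrightarrow> T (pure_tensor X v) = m v)"
proof -
  interpret W: vector_space sW by (rule lie_representationD(1)[OF W])
  note sW = W.vector_space_axioms and subW = lie_representationD(2)[OF W]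
  obtain T where T_lin: "linear_on coord_scale sW UNIV T"
    and T_pure: "\<And>v. (\<And>x. x \<in> X \<Longrightarrow> v x \<in> V x) \<Longrightarrow> T (pure_tensor X v) = m v"
    using tensor_universal[OF finite_X fd sW m] by auto
  have T_in: "T w \<in> W" if "w \<in> TS" for w
    using that
  proof (induction rule: TS_induct)
    case zero
    show ?case
      using linear_on_0[OF vector_space_coord_scale coord.subspace_UNIV T_lin] W.subspace_0[OF subW]
      by (simp only:)
  next
    case (step c v w)
    have "T (coord_scale c (pure_tensor X v) + w) = sW c (m v) + T w"
      by (simp only: linear_on_add[OF T_lin] linear_on_scale[OF T_lin] T_pure[OF step(1)] UNIV_I)
    then show ?case
      using W.subspace_add[OF subW W.subspace_scale[OF subW m_W[OF step(1)]] step(3)] by (simp only:)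
  qed
  have T_eq: "T (ev_rep X \<rho> \<alpha> w) = \<tau> \<alpha> (T w)" if \<alpha>: "\<alpha> \<in> M" and w: "w \<in> TS" for \<alpha> w
  proof (rule TS_eqI[where f = "\<lambda>w. T (ev_rep X \<rho> \<alpha> w)" and g = "\<lambda>w. \<tau> \<alpha> (T w)", OF sW _ _ _ w])
    note ev_lin = ev_rep_linear[OF \<alpha>] and \<tau>_lin = lie_representationD(4)[OF W \<alpha>]
    show "linear_on coord_scale sW TS (\<lambda>w. T (ev_rep X \<rho> \<alpha> w))"
      unfolding linear_on_def
      by (intro conjI ballI allI) (simp_all only: linear_on_add[OF ev_lin] linear_on_scale[OF ev_lin]
          linear_on_add[OF T_lin] linear_on_scale[OF T_lin] UNIV_I)
    show "linear_on coord_scale sW TS (\<lambda>w. \<tau> \<alpha> (T w))"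
      unfolding linear_on_def
      by (intro conjI ballI allI) (simp_all only: linear_on_add[OF T_lin] linear_on_scale[OF T_lin] UNIV_I
          T_in linear_on_add[OF \<tau>_lin] linear_on_scale[OF \<tau>_lin])
    fix v assume v: "\<And>x. x \<in> X \<Longrightarrow> v x \<in> V x"
    have upd: "(v(x := \<rho> x (\<alpha> x) (v x))) z \<in> V z" if "x \<in> X" "z \<in> X" for x z
      using v that lie_representationD(3)[OF rep[OF that(1)] M_in[OF \<alpha> that(1)]] by auto
    have ev: "ev_rep X \<rho> \<alpha> (pure_tensor X v) = (\<Sum>x\<in>X. pure_tensor X (v(x := \<rho> x (\<alpha> x) (v x))))"
      by (rule ev_rep_pure_tensor[OF \<alpha> v])
    have "T (ev_rep X \<rho> \<alpha> (pure_tensor X v)) = (\<Sum>x\<in>X. T (pure_tensor X (v(x := \<rho> x (\<alpha> x) (v x)))))"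
      unfolding ev by (rule linear_on_sum[OF vector_space_coord_scale coord.subspace_UNIV T_lin UNIV_I])
    also have "\<dots> = (\<Sum>x\<in>X. m (v(x := \<rho> x (\<alpha> x) (v x))))"
      using upd by (intro sum.cong refl T_pure) auto
    also have "\<dots> = \<tau> \<alpha> (m v)" by (rule m_eq[OF \<alpha> v])
    also have "m v = T (pure_tensor X v)" by (rule T_pure[OF v, symmetric])
    finally show "T (ev_rep X \<rho> \<alpha> (pure_tensor X v)) = \<tau> \<alpha> (T (pure_tensor X v))" .
  qed
  have "rep_hom M coord_scale TS (ev_rep X \<rho>) sW W \<tau> T"
    unfolding rep_hom_def using T_in T_eq linear_on_subset[OF T_lin subset_UNIV] by blast
  then show ?thesis using T_pure by (intro exI[of _ T]) simp
qed

lemma rep_0: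
  assumes "x \<in> X" "a \<in> L x" "v \<in> V x" "s 0 a = 0"
  shows "\<rho> x 0 v = 0"
  using lie_representationD(6)[OF rep[OF assms(1)] assms(2,3), of 0] assms(4) by simp

lemma ev_rep_supported:
  assumes \<alpha>: "\<alpha> \<in> M" and x: "x \<in> X" and 0: "\<And>y. y \<in> X \<Longrightarrow> y \<noteq> x \<Longrightarrow> \<alpha> y = 0"
    and s: "\<And>u. s 0 u = 0" and w: "w \<in> TS"
  shows "ev_rep X \<rho> \<alpha> w = slot X x (\<rho> x (\<alpha> x)) w"
proof -
  have "slot X y (\<rho> y (\<alpha> y)) w = 0" if y: "y \<in> X" "y \<noteq> x" for y
  proof -
    have "slot X y (\<rho> y (\<alpha> y)) w = slot X y (\<lambda>u. coord_scale 0 u) w"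
      using rep_0[OF y(1) M_in[OF \<alpha> y(1)] _ s] 0[OF y] y(1) by (intro slot_cong[OF w]) auto
    also have "\<dots> = 0" by (simp add: slot_def fun_eq_iff fun_scale_def)
    finally show ?thesis .
  qed
  then have "(\<Sum>y\<in>X. slot X y (\<rho> y (\<alpha> y)) w) = (\<Sum>y\<in>{x}. slot X y (\<rho> y (\<alpha> y)) w)"
    using x finite_X by (intro sum.mono_neutral_right) auto
  then show ?thesis by (simp add: ev_rep_slot)
qed

text \<open>Functions supported at one point of \<open>X\<close> act in one tensor factor, so that the criterion for
  irreducibility applies.\<close>

lemma ev_rep_irreducible:
  assumes fd: "\<And>x. x \<in> X \<Longrightarrow> finite_dimensional coord_scale (V x)"
    and irr: "\<And>x. x \<in> X \<Longrightarrow> irreducible_rep (L x) coord_scale (V x) (\<rho> x)"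
    and s: "\<And>u. s 0 u = 0"
    and surj: "\<And>x u. x \<in> X \<Longrightarrow> u \<in> L x \<Longrightarrow> \<exists>\<alpha>\<in>M. \<alpha> x = u \<and> (\<forall>y\<in>X - {x}. \<alpha> y = 0)"
  shows "irreducible_rep M coord_scale TS (ev_rep X \<rho>)"
  unfolding irreducible_rep_def
proof (intro conjI allI impI)
  have "\<exists>v. v \<in> V x \<and> v \<noteq> 0" if "x \<in> X" for x
    using irreducible_rep_nonzero[OF rep irr] that by blast
  then obtain v where v: "\<And>x. x \<in> X \<Longrightarrow> v x \<in> V x" "\<And>x. x \<in> X \<Longrightarrow> v x \<noteq> 0" by metis
  show "TS \<noteq> {0}" using pure_tensor_in_TS[OF v(1)] pure_tensor_nonzero[OF v(2)] by auto
  fix U assume U: "coord.subspace U \<and> U \<subseteq> TS \<and> (\<forall>a\<in>M. \<forall>u\<in>U. ev_rep X \<rho> a u \<in> U)"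
  show "U = {0} \<or> U = TS"
  proof (rule disjCI)
    assume "U \<noteq> TS"
    show "U = {0}"
    proof (rule ccontr)
      assume "U \<noteq> {0}"
      have "U = TS"
      proof (rule tensor_irreducible[of "\<lambda>x. \<rho> x ` L x"])
        show "coord.irreducible (\<rho> x ` L x) (V x)" if "x \<in> X" for x
          using irr[OF that] unfolding coord.irreducible_rep_iff .
        fix x f w assume x: "x \<in> X" and f: "f \<in> \<rho> x ` L x" and w: "w \<in> U"
        then obtain u where u: "u \<in> L x" "f = \<rho> x u" by auto
        obtain \<alpha> where \<alpha>: "\<alpha> \<in> M" "\<alpha> x = u" "\<And>y. y \<in> X \<Longrightarrow> y \<noteq> x \<Longrightarrow> \<alpha> y = 0"
          using surj[OF x u(1)] by auto
        have "w \<in> TS" using w U by auto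
        have "ev_rep X \<rho> \<alpha> w = slot X x (\<rho> x (\<alpha> x)) w"
          by (rule ev_rep_supported[OF \<alpha>(1) x \<alpha>(3) s \<open>w \<in> TS\<close>])
        then have "slot X x f w = ev_rep X \<rho> \<alpha> w" by (simp only: \<alpha>(2) u(2))
        then show "slot X x f w \<in> U" using U \<alpha>(1) w by (simp only:)
      qed (use U \<open>U \<noteq> {0}\<close> fd rep_operator in auto)
      then show False using \<open>U \<noteq> TS\<close> by simp
    qed
  qed
qed

end

section \<open>The eigenspaces of the involution\<close>

locale involution_lie_algebra = simple_lie_algebra scale bracket
  for scale :: "'k::{alg_closed_field, field_char_0} \<Rightarrow> 'g::ab_group_add \<Rightarrow> 'g" (infixr \<open>*s\<close> 75)
    and bracket :: "'g \<Rightarrow> 'g \<Rightarrow> 'g" +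
  fixes \<sigma> :: "'g \<Rightarrow> 'g"
  assumes automorphism: "lie_automorphism \<sigma>" and involution: "\<sigma> \<circ> \<sigma> = id" and nontrivial: "\<sigma> \<noteq> id"
begin

lemma \<sigma>_linear: "Vector_Spaces.linear scale scale \<sigma>"
  and \<sigma>_bracket: "\<sigma> (bracket u v) = bracket (\<sigma> u) (\<sigma> v)"
  using automorphism by (auto simp: lie_automorphism_def)

lemma \<sigma>_\<sigma> [simp]: "\<sigma> (\<sigma> u) = u"
  using involution by (metis comp_apply id_apply)

sublocale \<sigma>: Vector_Spaces.linear scale scale \<sigma>
  by (rule \<sigma>_linear)

lemma bracket_0 [simp]: "bracket 0 u = 0" "bracket u 0 = 0"
  using bracket_scale_left[of 0 0 u] bracket_scale_right[of u 0 0] by simp_all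

lemma bracket_minus [simp]: "bracket (- u) v = - bracket u v" "bracket u (- v) = - bracket u v"
  using bracket_scale_left[of "- 1" u v] bracket_scale_right[of u "- 1" v] by simp_all

lemma bracket_skew: "bracket u v = - bracket v u"
proof -
  have "bracket (u + v) (u + v) = 0" by (rule bracket_self)
  then have "bracket u v + bracket v u = 0"
    unfolding bracket_add_left bracket_add_right by (simp add: bracket_self add.commute)
  then show ?thesis by (rule eq_neg_iff_add_eq_0[THEN iffD2])
qed

definition "\<gg>0 = {u. \<sigma> u = u}"
definition "\<gg>1 = {u. \<sigma> u = - u}"
definition "p0 u = (1 / 2) *s (u + \<sigma> u)"
definition "p1 u = (1 / 2) *s (u - \<sigma> u)"

lemma half_double: "(1 / 2) *s (u + u) = u"
proof -
  have "(1 / 2) *s (u + u) = (1 / 2 + 1 / 2) *s u" by (simp only: scale_right_distrib scale_left_distrib)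
  then show ?thesis by simp
qed

lemma p0_in: "p0 u \<in> \<gg>0" and p1_in: "p1 u \<in> \<gg>1"
  by (auto simp: \<gg>0_def \<gg>1_def p0_def p1_def \<sigma>.scale \<sigma>.add \<sigma>.diff add.commute
      scale_minus_right[symmetric] simp del: scale_minus_right)

lemma p0_add_p1: "p0 u + p1 u = u"
proof -
  have "p0 u + p1 u = (1 / 2) *s ((u + \<sigma> u) + (u - \<sigma> u))"
    by (simp only: p0_def p1_def scale_right_distrib)
  also have "(u + \<sigma> u) + (u - \<sigma> u) = u + u" by simp
  finally show ?thesis by (simp only: half_double)
qed

lemma p0_fixed: "u \<in> \<gg>0 \<Longrightarrow> p0 u = u" and p1_of_\<gg>0: "u \<in> \<gg>0 \<Longrightarrow> p1 u = 0"
  and p0_of_\<gg>1: "u \<in> \<gg>1 \<Longrightarrow> p0 u = 0" and p1_fixed: "u \<in> \<gg>1 \<Longrightarrow> p1 u = u"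
  by (auto simp: \<gg>0_def \<gg>1_def p0_def p1_def half_double)

lemma p0_add: "p0 (u + v) = p0 u + p0 v" and p1_add: "p1 (u + v) = p1 u + p1 v"
  and p0_scale: "p0 (c *s u) = c *s p0 u" and p1_scale: "p1 (c *s u) = c *s p1 u"
  by (simp_all add: p0_def p1_def \<sigma>.add \<sigma>.scale scale_right_distrib scale_right_diff_distrib
      mult.commute algebra_simps)

lemma p0_0 [simp]: "p0 0 = 0" and p1_0 [simp]: "p1 0 = 0"
  by (simp_all add: p0_def p1_def \<sigma>.zero)

lemma p0_sum: "p0 (\<Sum>i\<in>I. f i) = (\<Sum>i\<in>I. p0 (f i))" and p1_sum: "p1 (\<Sum>i\<in>I. f i) = (\<Sum>i\<in>I. p1 (f i))"
  by (induction I rule: infinite_finite_induct) (simp_all add: p0_add p1_add)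

lemma subspace_\<gg>0: "subspace \<gg>0" and subspace_\<gg>1: "subspace \<gg>1"
  unfolding subspace_def \<gg>0_def \<gg>1_def by (auto simp: \<sigma>.add \<sigma>.scale \<sigma>.zero)

lemma bracket_00: "u \<in> \<gg>0 \<Longrightarrow> v \<in> \<gg>0 \<Longrightarrow> bracket u v \<in> \<gg>0"
  and bracket_01: "u \<in> \<gg>0 \<Longrightarrow> v \<in> \<gg>1 \<Longrightarrow> bracket u v \<in> \<gg>1"
  and bracket_10: "u \<in> \<gg>1 \<Longrightarrow> v \<in> \<gg>0 \<Longrightarrow> bracket u v \<in> \<gg>1"
  and bracket_11: "u \<in> \<gg>1 \<Longrightarrow> v \<in> \<gg>1 \<Longrightarrow> bracket u v \<in> \<gg>0"
  by (auto simp: \<gg>0_def \<gg>1_def \<sigma>_bracket)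

lemma p0_bracket: "p0 (bracket x y) = bracket (p0 x) (p0 y) + bracket (p1 x) (p1 y)"
  and p1_bracket: "p1 (bracket x y) = bracket (p0 x) (p1 y) + bracket (p1 x) (p0 y)"
proof -
  have "bracket x y = bracket (p0 x + p1 x) (p0 y + p1 y)" by (simp only: p0_add_p1)
  then have *: "bracket x y = bracket (p0 x) (p0 y) + bracket (p0 x) (p1 y)
      + (bracket (p1 x) (p0 y) + bracket (p1 x) (p1 y))"
    by (simp only: bracket_add_left bracket_add_right ac_simps)
  show "p0 (bracket x y) = bracket (p0 x) (p0 y) + bracket (p1 x) (p1 y)"
    unfolding * by (simp add: p0_add p0_fixed p0_of_\<gg>1 bracket_00 bracket_01 bracket_10 bracket_11 p0_in p1_in)
  show "p1 (bracket x y) = bracket (p0 x) (p1 y) + bracket (p1 x) (p0 y)"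
    unfolding * by (simp add: p1_add p1_fixed p1_of_\<gg>0 bracket_00 bracket_01 bracket_10 bracket_11 p0_in p1_in)
qed

lemma ideal_UNIV:
  assumes "subspace I" "\<And>x y. y \<in> I \<Longrightarrow> bracket x y \<in> I" "u \<in> I" "u \<noteq> 0"
  shows "v \<in> I"
proof -
  have "lie_ideal I" using assms by (simp add: lie_ideal_def)
  then have "I = UNIV" using simple assms by blast
  then show ?thesis by simp
qed

lemma bracket_nonzero:
  assumes "u \<noteq> 0"
  obtains v where "bracket u v \<noteq> 0"
proof (rule ccontr)
  assume "\<not> thesis"
  then have u: "bracket u v = 0" for v using that by blast
  let ?C = "{u. \<forall>v. bracket u v = 0}"
  obtain x y where xy: "bracket x y \<noteq> 0" using nonabelian by blast
  have "x \<in> ?C"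
  proof (rule ideal_UNIV)
    show "subspace ?C"
      unfolding subspace_def by (auto simp: bracket_add_left bracket_scale_left)
    show "bracket z w \<in> ?C" if "w \<in> ?C" for z w
      using that bracket_skew[of z w] by auto
  qed (use u assms in auto)
  then show False using xy by blast
qed

text \<open>\<open>[\<gg>1, \<gg>1] + \<gg>1\<close> and \<open>\<gg>0 + [\<gg>0, \<gg>1]\<close> are nonzero ideals of \<open>\<gg>\<close>.  As \<open>\<gg>\<close> is simple,
  \<open>[\<gg>1, \<gg>1] = \<gg>0\<close> and \<open>[\<gg>0, \<gg>1] = \<gg>1\<close>.\<close>

lemma \<gg>0_generated:
  assumes S: "subspace S" "\<And>a b. a \<in> \<gg>1 \<Longrightarrow> b \<in> \<gg>1 \<Longrightarrow> bracket a b \<in> S" and u: "u \<in> \<gg>0"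
  shows "u \<in> S"
proof -
  define D where "D = span {bracket a b | a b. a \<in> \<gg>1 \<and> b \<in> \<gg>1}"
  have D: "bracket a b \<in> D" if "a \<in> \<gg>1" "b \<in> \<gg>1" for a b
    unfolding D_def by (rule span_base) (use that in blast)
  have sub: "subspace D" by (simp add: D_def subspace_span)
  have stable: "bracket x y \<in> D" if x: "x \<in> \<gg>0" and "y \<in> D" for x y
    using that(2) unfolding D_def
  proof (induction rule: span_induct_alt)
    case base
    show ?case by (simp add: span_zero)
  next
    case (step c z y)
    then obtain a b where ab: "z = bracket a b" "a \<in> \<gg>1" "b \<in> \<gg>1" by blast
    have "bracket x z = bracket (bracket x a) b + bracket a (bracket x b)"
      using jacobi[of x a b] bracket_skew[of b "bracket x a"] bracket_skew[of b x]
      by (simp add: ab algebra_simps eq_neg_iff_add_eq_0)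
    also have "\<dots> \<in> D" by (intro subspace_add[OF sub] D bracket_01 x ab)
    finally have "bracket x z \<in> D" .
    then show ?case
      using step.IH unfolding bracket_add_right bracket_scale_right D_def
      by (intro span_add span_scale)
  qed
  obtain v where v: "\<sigma> v \<noteq> v" using nontrivial by (auto simp: fun_eq_iff)
  have "u \<in> {u. p0 u \<in> D}"
  proof (rule ideal_UNIV)
    show "subspace {u. p0 u \<in> D}"
      using sub unfolding subspace_def by (auto simp: p0_add p0_scale)
    show "bracket x y \<in> {u. p0 u \<in> D}" if "y \<in> {u. p0 u \<in> D}" for x y
      using that by (simp add: p0_bracket subspace_add[OF sub] stable D p0_in p1_in)
    show "p1 v \<in> {u. p0 u \<in> D}" using subspace_0[OF sub] by (simp add: p0_of_\<gg>1 p1_in)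
    show "p1 v \<noteq> 0" using v by (simp add: p1_def)
  qed
  then have "u \<in> D" using u by (simp add: p0_fixed)
  moreover have "D \<subseteq> S" unfolding D_def by (rule span_minimal[OF _ S(1)]) (use S(2) in auto)
  ultimately show ?thesis by auto
qed

lemma \<gg>1_generated:
  assumes S: "subspace S" "\<And>a b. a \<in> \<gg>0 \<Longrightarrow> b \<in> \<gg>1 \<Longrightarrow> bracket a b \<in> S" and u: "u \<in> \<gg>1"
  shows "u \<in> S"
proof -
  have p1_in_S: "p1 (bracket x y) \<in> S" for x y
    using S(2)[of "p0 x" "p1 y"] S(2)[of "p0 y" "p1 x"] subspace_neg[OF S(1)]
    by (simp add: p1_bracket bracket_skew[of "p1 x" "p0 y"] p0_in p1_in subspace_diff[OF S(1)])
  obtain x y where xy: "bracket x y \<noteq> 0" using nonabelian by blast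
  have "u \<in> {u. p1 u \<in> S}"
  proof (rule ideal_UNIV)
    show "subspace {u. p1 u \<in> S}"
      using S(1) unfolding subspace_def by (auto simp: p1_add p1_scale)
    show "bracket x y \<in> {u. p1 u \<in> S}" using p1_in_S by simp
  qed (use p1_in_S xy in auto)
  then show ?thesis using u by (simp add: p1_fixed)
qed

end

section \<open>Equivariant maps and polynomials in \<open>x + 1 / x\<close>\<close>

text \<open>Laurent polynomials, written as fractions with a power of \<open>x\<close> as denominator; in this form closure
  under sums and products needs no reindexing of exponents.\<close>

definition laurent :: "('k::field \<Rightarrow> 'k) \<Rightarrow> bool" where
  "laurent f \<longleftrightarrow> (\<exists>P n. \<forall>x. x \<noteq> 0 \<longrightarrow> f x = poly P x / x ^ n)"

lemma laurent_const: "laurent (\<lambda>_. c)"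
  unfolding laurent_def by (intro exI[of _ "[:c:]"] exI[of _ 0]) simp

lemma laurent_id: "laurent (\<lambda>x. x)"
  unfolding laurent_def by (intro exI[of _ "[:0, 1:]"] exI[of _ 0]) simp

lemma laurent_inverse: "laurent inverse"
  unfolding laurent_def by (intro exI[of _ "1"] exI[of _ 1]) (simp add: field_simps)

lemma laurent_add:
  assumes "laurent f" "laurent g"
  shows "laurent (\<lambda>x. f x + g x)"
proof -
  obtain P n Q m where "\<And>x. x \<noteq> 0 \<Longrightarrow> f x = poly P x / x ^ n" "\<And>x. x \<noteq> 0 \<Longrightarrow> g x = poly Q x / x ^ m"
    using assms unfolding laurent_def by blast
  then show ?thesis
    unfolding laurent_def
    by (intro exI[of _ "P * monom 1 m + Q * monom 1 n"] exI[of _ "n + m"])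
      (simp add: poly_monom power_add field_simps)
qed

lemma laurent_mult:
  assumes "laurent f" "laurent g"
  shows "laurent (\<lambda>x. f x * g x)"
proof -
  obtain P n Q m where "\<And>x. x \<noteq> 0 \<Longrightarrow> f x = poly P x / x ^ n" "\<And>x. x \<noteq> 0 \<Longrightarrow> g x = poly Q x / x ^ m"
    using assms unfolding laurent_def by blast
  then show ?thesis
    unfolding laurent_def
    by (intro exI[of _ "P * Q"] exI[of _ "n + m"]) (simp add: power_add)
qed

lemma laurent_poly: "laurent f \<Longrightarrow> laurent (\<lambda>x. poly F (f x))"
  by (induction F) (auto intro!: laurent_add laurent_mult laurent_const)

lemma laurent_regular:
  assumes "vector_space s" and f: "laurent f"
  shows "(\<lambda>x. if x = 0 then 0 else s (f x) u) \<in> regular_maps s"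
proof -
  interpret vector_space s by fact
  obtain P n where P: "\<And>x. x \<noteq> 0 \<Longrightarrow> f x = poly P x / x ^ n" using f unfolding laurent_def by blast
  let ?N = "(\<lambda>i. int i - int n) ` {..degree P}"
  let ?c = "\<lambda>j. s (coeff P (nat (j + int n))) u"
  have "s (f x) u = (\<Sum>j\<in>?N. s (x powi j) (?c j))" if x: "x \<noteq> 0" for x
  proof -
    have "(\<Sum>j\<in>?N. s (x powi j) (?c j)) = (\<Sum>i\<le>degree P. s (x powi (int i - int n)) (s (coeff P i) u))"
      by (subst sum.reindex) (auto simp: inj_on_def)
    also have "\<dots> = (\<Sum>i\<le>degree P. s (coeff P i * x ^ i / x ^ n) u)"
      using x by (intro sum.cong) (auto simp: power_int_diff field_simps)
    also have "\<dots> = s (poly P x / x ^ n) u"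
      by (simp add: poly_altdef scale_sum_left sum_divide_distrib)
    finally show ?thesis using P[OF x] by simp
  qed
  then show ?thesis
    unfolding regular_maps_def X_rat_def by (auto intro!: exI[of _ ?N] exI[of _ ?c])
qed

lemma add_inverse_eq_iff:
  fixes x y :: "'k::field"
  assumes "x \<noteq> 0" "y \<noteq> 0"
  shows "x + inverse x = y + inverse y \<longleftrightarrow> x = y \<or> x = inverse y"
proof -
  have "(x - y) * (x * y - 1) = x * y * ((x + inverse x) - (y + inverse y))"
    using assms by (simp add: field_simps)
  then have "x + inverse x = y + inverse y \<longleftrightarrow> (x - y) * (x * y - 1) = 0"
    using assms by simp
  also have "\<dots> \<longleftrightarrow> x = y \<or> x * y = 1" by simp
  also have "x * y = 1 \<longleftrightarrow> x = inverse y" using assms by (simp add: field_simps)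
  finally show ?thesis .
qed

text \<open>With \<open>z = x + 1 / x\<close>, the sums \<open>x\<^sup>n + x\<^sup>-\<^sup>n\<close> and the differences \<open>x\<^sup>n - x\<^sup>-\<^sup>n\<close> both satisfy the
  recursion \<open>s (n + 2) = z s (n + 1) - s n\<close>.\<close>

lemma power_sum_poly:
  "\<exists>T. \<forall>x::'k::field. x \<noteq> 0 \<longrightarrow> x ^ n + inverse x ^ n = poly T (x + inverse x)"
proof (induction n rule: induct_nat_012)
  case 0
  show ?case by (intro exI[of _ "[:2:]"]) simp
next
  case 1
  show ?case by (intro exI[of _ "[:0, 1:]"]) simp
next
  case (ge2 n)
  then obtain T T' where T: "\<And>x::'k. x \<noteq> 0 \<Longrightarrow> x ^ n + inverse x ^ n = poly T (x + inverse x)"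
    "\<And>x::'k. x \<noteq> 0 \<Longrightarrow> x ^ Suc n + inverse x ^ Suc n = poly T' (x + inverse x)" by blast
  have "x ^ Suc (Suc n) + inverse x ^ Suc (Suc n) = poly ([:0, 1:] * T' - T) (x + inverse x)"
    if x: "x \<noteq> 0" for x :: 'k
  proof -
    have "x ^ Suc (Suc n) + inverse x ^ Suc (Suc n) =
        (x + inverse x) * (x ^ Suc n + inverse x ^ Suc n) - (x ^ n + inverse x ^ n)"
      using x by (simp add: field_simps)
    then show ?thesis using T x by simp
  qed
  then show ?case by blast
qed

lemma power_diff_poly:
  "\<exists>U. \<forall>x::'k::field. x \<noteq> 0 \<longrightarrow> x ^ n - inverse x ^ n = (x - inverse x) * poly U (x + inverse x)"
proof (induction n rule: induct_nat_012)
  case 0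
  show ?case by (intro exI[of _ 0]) simp
next
  case 1
  show ?case by (intro exI[of _ 1]) simp
next
  case (ge2 n)
  then obtain T T' where T: "\<And>x::'k. x \<noteq> 0 \<Longrightarrow> x ^ n - inverse x ^ n = (x - inverse x) * poly T (x + inverse x)"
    "\<And>x::'k. x \<noteq> 0 \<Longrightarrow> x ^ Suc n - inverse x ^ Suc n = (x - inverse x) * poly T' (x + inverse x)" by blast
  have "x ^ Suc (Suc n) - inverse x ^ Suc (Suc n) = (x - inverse x) * poly ([:0, 1:] * T' - T) (x + inverse x)"
    if x: "x \<noteq> 0" for x :: 'k
  proof -
    have "x ^ Suc (Suc n) - inverse x ^ Suc (Suc n) =
        (x + inverse x) * (x ^ Suc n - inverse x ^ Suc n) - (x ^ n - inverse x ^ n)"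
      using x by (simp add: field_simps)
    also have "\<dots> = (x + inverse x) * ((x - inverse x) * poly T' (x + inverse x))
        - (x - inverse x) * poly T (x + inverse x)"
      using T x by simp
    finally show ?thesis by (simp add: algebra_simps)
  qed
  then show ?case by blast
qed

lemma powi_sum_poly:
  "\<exists>T. \<forall>x::'k::field. x \<noteq> 0 \<longrightarrow> x powi n + inverse x powi n = poly T (x + inverse x)"
proof (cases "n \<ge> 0")
  case True
  then show ?thesis using power_sum_poly[of "nat n"] by (simp add: power_int_def)
next
  case False
  obtain T where T: "\<And>x::'k. x \<noteq> 0 \<Longrightarrow> x ^ nat (- n) + inverse x ^ nat (- n) = poly T (x + inverse x)"
    using power_sum_poly by blast
  show ?thesis using False T by (intro exI[of _ T]) (auto simp: power_int_def add.commute)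
qed

lemma powi_diff_poly:
  "\<exists>U. \<forall>x::'k::field. x \<noteq> 0 \<longrightarrow> x powi n - inverse x powi n = (x - inverse x) * poly U (x + inverse x)"
proof (cases "n \<ge> 0")
  case True
  then show ?thesis using power_diff_poly[of "nat n"] by (simp add: power_int_def)
next
  case False
  obtain T where T: "\<And>x::'k. x \<noteq> 0 \<Longrightarrow>
      x ^ nat (- n) - inverse x ^ nat (- n) = (x - inverse x) * poly T (x + inverse x)"
    using power_diff_poly by blast
  have "x powi n - inverse x powi n = (x - inverse x) * poly (- T) (x + inverse x)" if "x \<noteq> 0" for x :: 'k
  proof -
    have "x powi n - inverse x powi n = - (x ^ nat (- n) - inverse x ^ nat (- n))"
      using False by (simp add: power_int_def)
    then show ?thesis using T[OF that] by simp
  qed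
  then show ?thesis by blast
qed

definition lagrange :: "'k::field set \<Rightarrow> 'k \<Rightarrow> 'k poly" where
  "lagrange Z \<zeta> = (\<Prod>\<eta>\<in>Z - {\<zeta>}. smult (1 / (\<zeta> - \<eta>)) [:- \<eta>, 1:])"

lemma poly_lagrange:
  assumes "finite Z" "\<eta> \<in> Z"
  shows "poly (lagrange Z \<zeta>) \<eta> = (if \<eta> = \<zeta> then 1 else 0)"
proof (cases "\<eta> = \<zeta>")
  case True
  then show ?thesis
    by (auto simp: lagrange_def poly_prod diff_divide_distrib[symmetric] intro!: prod.neutral
        split: if_splits)
next
  case False
  then show ?thesis
    using assms by (auto simp: lagrange_def poly_prod intro!: prod_zero bexI[of _ \<eta>])
qed

lemma vanishing_dvd:
  fixes F :: "'k::field poly"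
  assumes "finite Z" "\<And>\<zeta>. \<zeta> \<in> Z \<Longrightarrow> poly F \<zeta> = 0"
  shows "(\<Prod>\<zeta>\<in>Z. [:- \<zeta>, 1:]) dvd F"
  using assms
proof (induction Z arbitrary: F)
  case (insert \<zeta> Z)
  then have "poly F \<zeta> = 0" by blast
  then obtain G where G: "F = [:- \<zeta>, 1:] * G" by (meson poly_eq_0_iff_dvd dvdE)
  have "poly G \<eta> = 0" if "\<eta> \<in> Z" for \<eta>
  proof -
    have "\<eta> \<noteq> \<zeta>" using that insert.hyps by blast
    moreover have "poly F \<eta> = 0" using insert.prems that by blast
    ultimately show ?thesis by (auto simp: G)
  qed
  then have "(\<Prod>\<zeta>\<in>Z. [:- \<zeta>, 1:]) dvd G" by (rule insert.IH)
  then show ?case unfolding G prod.insert[OF insert.hyps] by (intro mult_dvd_mono dvd_refl)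
qed simp

lemma dvd_power_of_roots:
  fixes P :: "'k::alg_closed_field poly"
  assumes "P \<noteq> 0" "finite Z" "{x. poly P x = 0} \<subseteq> Z"
  shows "P dvd (\<Prod>\<zeta>\<in>Z. [:- \<zeta>, 1:]) ^ degree P"
  using assms(1,3)
proof (induction "degree P" arbitrary: P)
  case 0
  then have "P dvd 1" by (metis is_unit_iff_degree)
  then show ?case using dvd_trans one_dvd by blast
next
  case (Suc n)
  then have "degree P > 0" by simp
  then obtain r where "poly P r = 0" using alg_closed_imp_poly_has_root by blast
  then obtain Q where Q: "P = [:- r, 1:] * Q" by (meson poly_eq_0_iff_dvd dvdE)
  have r: "r \<in> Z" using Suc.prems Q by auto
  have Q0: "Q \<noteq> 0" using Suc.prems Q by auto
  then have "degree P = Suc (degree Q)" unfolding Q by (subst degree_mult_eq) auto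
  moreover have "{x. poly Q x = 0} \<subseteq> Z" using Suc.prems Q by auto
  ultimately have "Q dvd (\<Prod>\<zeta>\<in>Z. [:- \<zeta>, 1:]) ^ n" using Suc.hyps Q0 by auto
  moreover have "[:- r, 1:] dvd (\<Prod>\<zeta>\<in>Z. [:- \<zeta>, 1:])" using r assms(2) by (rule dvd_prodI[rotated])
  ultimately have "P dvd (\<Prod>\<zeta>\<in>Z. [:- \<zeta>, 1:]) * (\<Prod>\<zeta>\<in>Z. [:- \<zeta>, 1:]) ^ n"
    unfolding Q by (intro mult_dvd_mono)
  then show ?case using \<open>degree P = Suc (degree Q)\<close> Suc.hyps(2) by simp
qed

context involution_lie_algebra
begin

abbreviation "\<MM> \<equiv> map_algebra scale \<sigma>"
abbreviation "fbr \<equiv> fun_bracket bracket"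
abbreviation "fsc \<equiv> fun_scale scale"

sublocale F: lie_algebra fsc fbr
  by (rule lie_algebra_fun) (rule lie_algebra_axioms)

lemma subalgebra: "F.lie_subalgebra \<MM>"
  by (rule map_algebra_subalgebra[OF lie_algebra_axioms automorphism])

lemma subspace_\<MM>: "F.subspace \<MM>" and bracket_\<MM>: "\<alpha> \<in> \<MM> \<Longrightarrow> \<beta> \<in> \<MM> \<Longrightarrow> fbr \<alpha> \<beta> \<in> \<MM>"
  using subalgebra by (auto simp: F.lie_subalgebra_def)

text \<open>\<open>even_map u F = u \<otimes> F(z)\<close> and \<open>odd_map u F = u \<otimes> w F(z)\<close> with \<open>z = x + 1 / x\<close> and
  \<open>w = x - 1 / x\<close>; the value \<open>0\<close> at \<open>x = 0\<close> is the convention for regular maps.\<close>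

definition even_map :: "'g \<Rightarrow> 'k poly \<Rightarrow> 'k \<Rightarrow> 'g" where
  "even_map u F = (\<lambda>x. if x = 0 then 0 else poly F (x + inverse x) *s u)"

definition odd_map :: "'g \<Rightarrow> 'k poly \<Rightarrow> 'k \<Rightarrow> 'g" where
  "odd_map u F = (\<lambda>x. if x = 0 then 0 else ((x - inverse x) * poly F (x + inverse x)) *s u)"

lemma laurent_z: "laurent (\<lambda>x::'k. x + inverse x)" and laurent_w: "laurent (\<lambda>x::'k. x - inverse x)"
  using laurent_add[OF laurent_id laurent_inverse]
    laurent_add[OF laurent_id laurent_mult[OF laurent_const[of "- 1"] laurent_inverse]] by simp_all

lemma even_map_in: "u \<in> \<gg>0 \<Longrightarrow> even_map u F \<in> \<MM>"
  using laurent_regular[OF vector_space_axioms laurent_poly[OF laurent_z]]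
  by (auto simp: map_algebra_def even_map_def act_X_def act_g_def X_rat_def \<gg>0_def \<sigma>.scale add.commute)

lemma odd_map_in:
  assumes "u \<in> \<gg>1"
  shows "odd_map u F \<in> \<MM>"
proof -
  have "(inverse x - x) * c = - ((x - inverse x) * c)" for x c :: 'k by (simp add: algebra_simps)
  then show ?thesis
    using laurent_regular[OF vector_space_axioms laurent_mult[OF laurent_w laurent_poly[OF laurent_z]]] assms
    by (auto simp: map_algebra_def odd_map_def act_X_def act_g_def X_rat_def \<gg>1_def \<sigma>.scale add.commute)
qed

text \<open>\<open>w\<^sup>2 = z\<^sup>2 - 4\<close>.\<close>

definition D0 :: "'k poly" where "D0 = [:- 4, 0, 1:]"

lemma poly_D0: "x \<noteq> 0 \<Longrightarrow> poly D0 (x + inverse x) = (x - inverse x) * (x - inverse x)"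
  by (simp add: D0_def field_simps)

lemma bracket_even_even: "fbr (even_map u F) (even_map v G) = even_map (bracket u v) (F * G)"
  and bracket_even_odd: "fbr (even_map u F) (odd_map v G) = odd_map (bracket u v) (F * G)"
  and bracket_odd_even: "fbr (odd_map u F) (even_map v G) = odd_map (bracket u v) (F * G)"
  and bracket_odd_odd: "fbr (odd_map u F) (odd_map v G) = even_map (bracket u v) (D0 * F * G)"
  by (auto simp: fun_eq_iff fun_bracket_def even_map_def odd_map_def bracket_scale_left bracket_scale_right
      poly_D0 ac_simps)

lemma even_map_add: "even_map (u + v) F = even_map u F + even_map v F"
  and odd_map_add: "odd_map (u + v) F = odd_map u F + odd_map v F"
  and even_map_scale: "even_map (c *s u) F = fsc c (even_map u F)"
  and odd_map_scale: "odd_map (c *s u) F = fsc c (odd_map u F)"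
  by (auto simp: fun_eq_iff fun_scale_def even_map_def odd_map_def scale_right_distrib mult.commute)

lemma even_map_0 [simp]: "even_map 0 F = 0" and odd_map_0 [simp]: "odd_map 0 F = 0"
  by (auto simp: fun_eq_iff even_map_def odd_map_def)

lemma map_inverse: "\<alpha> \<in> \<MM> \<Longrightarrow> x \<noteq> 0 \<Longrightarrow> \<alpha> (inverse x) = \<sigma> (\<alpha> x)"
proof -
  assume "\<alpha> \<in> \<MM>" "x \<noteq> 0"
  then have "\<alpha> (act_X 1 x) = act_g \<sigma> 1 (\<alpha> x)" by (simp add: map_algebra_def X_rat_def)
  then show ?thesis by (simp add: act_X_def act_g_def)
qed

lemma map_at_0: "\<alpha> \<in> \<MM> \<Longrightarrow> \<alpha> 0 = 0"
  by (simp add: map_algebra_def regular_maps_def)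

text \<open>\<open>\<MM> = \<gg>0 \<otimes> k[z] + \<gg>1 \<otimes> w k[z]\<close> with \<open>z = x + 1 / x\<close> and \<open>w = x - 1 / x\<close>: symmetrise a Laurent
  polynomial term by term.\<close>

lemma map_algebra_decomposition:
  assumes \<alpha>: "\<alpha> \<in> \<MM>"
  obtains I :: "int set" and u F v G where "finite I" "\<And>i. u i \<in> \<gg>0" "\<And>i. v i \<in> \<gg>1"
    "\<alpha> = (\<Sum>i\<in>I. even_map (u i) (F i) + odd_map (v i) (G i))"
proof -
  obtain N c where N: "finite N" and c: "\<And>x. x \<noteq> 0 \<Longrightarrow> \<alpha> x = (\<Sum>n\<in>N. (x powi n) *s c n)"
    using \<alpha> unfolding map_algebra_def regular_maps_def X_rat_def by auto
  obtain T where T: "\<And>n x. x \<noteq> 0 \<Longrightarrow> x powi n + inverse x powi n = poly (T n) (x + inverse (x::'k))"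
    using powi_sum_poly by metis
  obtain U where U: "\<And>n x. x \<noteq> 0 \<Longrightarrow> x powi n - inverse x powi n = (x - inverse x) * poly (U n) (x + inverse (x::'k))"
    using powi_diff_poly by metis
  let ?s = "\<lambda>n. even_map (p0 (c n)) (smult (1 / 2) (T n)) + odd_map (p1 (c n)) (smult (1 / 2) (U n))"
  have "\<alpha> x = (\<Sum>n\<in>N. ?s n x)" for x
  proof (cases "x = 0")
    case True
    then show ?thesis using map_at_0[OF \<alpha>] by (simp add: even_map_def odd_map_def)
  next
    case False
    have termwise: "(1 / 2) *s ((x powi n) *s u + (inverse x powi n) *s \<sigma> u) =
        (1 / 2 * (x powi n + inverse x powi n)) *s p0 u + (1 / 2 * (x powi n - inverse x powi n)) *s p1 u" for n u
    proof -
      let ?a = "x powi n" and ?b = "inverse x powi n"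
      have \<sigma>u: "\<sigma> u = p0 u + - p1 u"
      proof -
        have "\<sigma> u = \<sigma> (p0 u + p1 u)" by (simp only: p0_add_p1)
        also have "\<dots> = p0 u + - p1 u" using p0_in[of u] p1_in[of u] by (simp add: \<sigma>.add \<gg>0_def \<gg>1_def)
        finally show ?thesis .
      qed
      have "?a *s u + ?b *s \<sigma> u = ?a *s (p0 u + p1 u) + ?b *s (p0 u + - p1 u)"
        unfolding \<sigma>u[symmetric] p0_add_p1 ..
      also have "\<dots> = (?a + ?b) *s p0 u + (?a - ?b) *s p1 u"
        by (simp add: scale_right_distrib scale_left_distrib scale_left_diff_distrib algebra_simps)
      finally show ?thesis by (simp add: scale_right_distrib)
    qed
    have "\<alpha> x = (1 / 2) *s (\<alpha> x + \<sigma> (\<alpha> (inverse x)))"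
      using map_inverse[OF \<alpha> False] by (simp add: half_double)
    also have "\<dots> = (\<Sum>n\<in>N. (1 / 2) *s ((x powi n) *s c n + (inverse x powi n) *s \<sigma> (c n)))"
      using False by (simp add: c \<sigma>.sum \<sigma>.scale sum.distrib[symmetric] scale_sum_right)
    also have "\<dots> = (\<Sum>n\<in>N. ?s n x)"
      using False by (intro sum.cong refl) (simp only: termwise T[OF False] U[OF False], simp add: even_map_def odd_map_def mult.left_commute)
    finally show ?thesis .
  qed
  then have "\<alpha> = (\<Sum>n\<in>N. ?s n)" by (simp add: fun_eq_iff sum_fun_apply)
  then show ?thesis by (rule that[OF N p0_in p1_in])
qed

lemma fixed_algebra_eq: "fixed_algebra \<sigma> x = (if inverse x = x then \<gg>0 else UNIV)"
  by (auto simp: fixed_algebra_def stabilizer_def act_X_def act_g_def \<gg>0_def)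

text \<open>Lagrange interpolation in \<open>z\<close>.  Off the fixed points \<open>w\<close> does not vanish, so the component of \<open>u\<close> in
  \<open>\<gg>1\<close> can be reached as well; at a fixed point \<open>u\<close> lies in \<open>\<gg>0\<close>.\<close>

lemma evaluation_surjective:
  assumes X: "finite X" "X \<subseteq> X_rat" "inj_on (\<lambda>x. x + inverse x) X" and x: "x \<in> X" and u: "u \<in> fixed_algebra \<sigma> x"
  shows "\<exists>\<alpha>\<in>\<MM>. \<alpha> x = u \<and> (\<forall>y\<in>X - {x}. \<alpha> y = 0)"
proof -
  let ?Z = "(\<lambda>x. x + inverse x) ` X"
  let ?L = "lagrange ?Z (x + inverse x)"
  have L: "poly ?L (y + inverse y) = (if y = x then 1 else 0)" if "y \<in> X" for y
    using poly_lagrange[of ?Z "y + inverse y" "x + inverse x"] X(1) that inj_onD[OF X(3) _ that x] by auto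
  have x0: "x \<noteq> 0" and X0: "\<And>y. y \<in> X \<Longrightarrow> y \<noteq> 0" using X(2) x by (auto simp: X_rat_def)
  show ?thesis
  proof (cases "inverse x = x")
    case True
    then have "u \<in> \<gg>0" using u by (simp add: fixed_algebra_eq)
    then show ?thesis
      using L x x0 by (intro bexI[of _ "even_map u ?L"] even_map_in) (auto simp: even_map_def)
  next
    case False
    define c where "c = 1 / (x - inverse x)"
    have c: "(x - inverse x) * c = 1" using False by (auto simp: c_def)
    let ?\<alpha> = "even_map (p0 u) ?L + odd_map (p1 u) (smult c ?L)"
    have "?\<alpha> \<in> \<MM>" by (intro F.subspace_add[OF subspace_\<MM>] even_map_in odd_map_in p0_in p1_in)
    moreover have "?\<alpha> x = u" using L[OF x] x0 c p0_add_p1[of u] by (simp add: even_map_def odd_map_def)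
    moreover have "?\<alpha> y = 0" if "y \<in> X - {x}" for y
      using L[of y] X0[of y] that by (simp add: even_map_def odd_map_def)
    ultimately show ?thesis by blast
  qed
qed

text \<open>The homogeneous elements of the subspace \<open>\<gg>0 \<otimes> A k[z] + \<gg>1 \<otimes> w A' k[z]\<close> of \<open>\<MM>\<close>.\<close>

definition J :: "'k poly \<Rightarrow> 'k poly \<Rightarrow> ('k \<Rightarrow> 'g) set" where
  "J A A' = {even_map u F | u F. u \<in> \<gg>0 \<and> A dvd F} \<union> {odd_map u F | u F. u \<in> \<gg>1 \<and> A' dvd F}"

lemma J_subset: "\<alpha> \<in> J A A' \<Longrightarrow> \<alpha> \<in> \<MM>"
  unfolding J_def using even_map_in odd_map_in by blast

lemma J_cases:
  assumes "\<alpha> \<in> J A A'"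
  obtains u F where "\<alpha> = even_map u F" "u \<in> \<gg>0" "A dvd F" | u F where "\<alpha> = odd_map u F" "u \<in> \<gg>1" "A' dvd F"
  using assms unfolding J_def by blast

lemma even_map_J: "u \<in> \<gg>0 \<Longrightarrow> A dvd F \<Longrightarrow> even_map u F \<in> J A A'"
  and odd_map_J: "u \<in> \<gg>1 \<Longrightarrow> A' dvd F \<Longrightarrow> odd_map u F \<in> J A A'"
  unfolding J_def by blast+

lemma J_bracket:
  assumes \<alpha>: "\<alpha> \<in> J A A'" and \<beta>: "\<beta> \<in> J B B'"
    and C: "C dvd A * B" "C dvd D0 * A' * B'" "C' dvd A * B'" "C' dvd A' * B"
  shows "fbr \<alpha> \<beta> \<in> J C C'"
  using \<alpha>
proof (cases rule: J_cases)
  case 1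
  note a = this
  show ?thesis using \<beta>
  proof (cases rule: J_cases)
    case 1
    then show ?thesis
      using a C(1) by (auto simp: bracket_even_even intro!: even_map_J bracket_00 intro: dvd_trans[OF _ mult_dvd_mono])
  next
    case 2
    then show ?thesis
      using a C(3) by (auto simp: bracket_even_odd intro!: odd_map_J bracket_01 intro: dvd_trans[OF _ mult_dvd_mono])
  qed
next
  case 2
  note a = this
  show ?thesis using \<beta>
  proof (cases rule: J_cases)
    case 1
    then show ?thesis
      using a C(4) by (auto simp: bracket_odd_even intro!: odd_map_J bracket_10 intro: dvd_trans[OF _ mult_dvd_mono])
  next
    case 2
    then show ?thesis
      using a C(2) by (auto simp: bracket_odd_odd mult.assoc intro!: even_map_J bracket_11
          intro: dvd_trans[OF _ mult_dvd_mono[OF dvd_refl mult_dvd_mono]])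
  qed
qed

end

section \<open>The annihilator of an irreducible representation\<close>

lemma vector_space_fun_scale:
  assumes "vector_space s"
  shows "vector_space (fun_scale s)"
proof -
  interpret vector_space s by fact
  show ?thesis
    by unfold_locales (auto simp: fun_scale_def fun_eq_iff scale_right_distrib scale_left_distrib)
qed

text \<open>An operator on a finite-dimensional space is determined by its restriction to a finite spanning set
  \<open>B\<close>; these restrictions lie in a finite-dimensional space.\<close>

lemma fun_space_spanned:
  fixes sV :: "'k::field \<Rightarrow> 'v::ab_group_add \<Rightarrow> 'v" and B :: "'b set"
  assumes sV: "vector_space sV" and B: "finite B" and V: "finite_dimensional sV V"
  shows "\<exists>S. finite S \<and>
    (\<forall>h. (\<forall>b. h b \<in> V) \<and> (\<forall>b. b \<notin> B \<longrightarrow> h b = 0) \<longrightarrow> h \<in> module.span (fun_scale sV) S)"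
proof -
  interpret V: vector_space sV by (rule sV)
  interpret F: vector_space "fun_scale sV" by (rule vector_space_fun_scale[OF sV])
  obtain C where C: "finite C" "V.span C = V" using V by (auto simp: finite_dimensional_def)
  define \<delta> where "\<delta> b c = (\<lambda>b'. if b' = b then c else 0)" for b :: 'b and c :: 'v
  have lin: "linear_on sV (fun_scale sV) UNIV (\<delta> b)" for b
    by (auto simp: linear_on_def \<delta>_def fun_scale_def fun_eq_iff)
  let ?S = "\<Union>b\<in>B. \<delta> b ` C"
  have "h \<in> F.span ?S" if h: "\<And>b. h b \<in> V" "\<And>b. b \<notin> B \<Longrightarrow> h b = 0" for h
  proof -
    have "h = (\<Sum>b\<in>B. \<delta> b (h b))"
    proof
      fix b
      show "h b = (\<Sum>b\<in>B. \<delta> b (h b)) b"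
        using B h(2)[of b] by (cases "b \<in> B") (simp_all add: sum_fun_apply \<delta>_def)
    qed
    moreover have "\<delta> b (h b) \<in> F.span ?S" if "b \<in> B" for b
    proof -
      have "\<delta> b (h b) \<in> \<delta> b ` V.span C" using h(1) C by simp
      also have "\<dots> = F.span (\<delta> b ` C)"
        by (rule linear_image_span[OF sV V.subspace_UNIV F.vector_space_axioms lin subset_UNIV])
      also have "\<dots> \<subseteq> F.span ?S" using that by (intro F.span_mono) auto
      finally show ?thesis .
    qed
    ultimately show ?thesis by (metis (no_types, lifting) F.span_sum)
  qed
  then show ?thesis using B C by (intro exI[of _ ?S]) auto
qed

locale irreducible_map_rep = involution_lie_algebra scale bracket \<sigma> + V: ac_vector_space sV
  for scale :: "'k::{alg_closed_field, field_char_0} \<Rightarrow> 'g::ab_group_add \<Rightarrow> 'g" (infixr \<open>*s\<close> 75)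
    and bracket :: "'g \<Rightarrow> 'g \<Rightarrow> 'g" and \<sigma> :: "'g \<Rightarrow> 'g" and sV :: "'k \<Rightarrow> 'v::ab_group_add \<Rightarrow> 'v" +
  fixes V :: "'v set" and \<rho> :: "('k \<Rightarrow> 'g) \<Rightarrow> 'v \<Rightarrow> 'v"
  assumes rep: "lie_representation fsc fbr \<MM> sV V \<rho>"
    and fd: "finite_dimensional sV V" and irr: "irreducible_rep \<MM> sV V \<rho>"
begin

lemma subspace_V: "V.subspace V"
  by (rule lie_representationD(2)[OF rep])

lemma rep_operator: "\<alpha> \<in> \<MM> \<Longrightarrow> V.operator_on V (\<rho> \<alpha>)"
  using V.lie_representation_operator[OF rep] by blast

lemmas rep_closed = lie_representationD(3)[OF rep]
  and rep_add = lie_representationD(5)[OF rep]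
  and rep_scale = lie_representationD(6)[OF rep]
  and rep_bracket = lie_representationD(7)[OF rep]

lemma rep_vec_0: "\<alpha> \<in> \<MM> \<Longrightarrow> \<rho> \<alpha> 0 = 0"
  by (rule V.operator_on_0[OF subspace_V rep_operator])

lemma rep_0: "v \<in> V \<Longrightarrow> \<rho> 0 v = 0"
  using rep_scale[of 0 v 0] F.subspace_0[OF subspace_\<MM>] by simp

lemma rep_sum:
  assumes "\<And>i. i \<in> I \<Longrightarrow> \<alpha> i \<in> \<MM>" "v \<in> V"
  shows "\<rho> (\<Sum>i\<in>I. \<alpha> i) v = (\<Sum>i\<in>I. \<rho> (\<alpha> i) v)"
  using assms(1)
proof (induction I rule: infinite_finite_induct)
  case (insert i I)
  have "sum \<alpha> I \<in> \<MM>" using insert.prems by (intro F.subspace_sum[OF subspace_\<MM>]) auto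
  then have "\<rho> (\<alpha> i + sum \<alpha> I) v = \<rho> (\<alpha> i) v + \<rho> (sum \<alpha> I) v"
    using insert.prems assms(2) by (intro rep_add) auto
  moreover have "\<rho> (sum \<alpha> I) v = (\<Sum>i\<in>I. \<rho> (\<alpha> i) v)"
    by (rule insert.IH) (use insert.prems in auto)
  ultimately show ?case by (simp only: sum.insert[OF insert.hyps])
qed (simp_all only: sum.infinite sum.empty rep_0[OF assms(2)] not_False_eq_True)

definition kills :: "('k \<Rightarrow> 'g) \<Rightarrow> bool" where
  "kills \<alpha> \<longleftrightarrow> (\<forall>v\<in>V. \<rho> \<alpha> v = 0)"

lemma kills_0: "kills 0"
  by (simp add: kills_def rep_0 del: zero_fun_apply)

lemma kills_add: "\<alpha> \<in> \<MM> \<Longrightarrow> \<beta> \<in> \<MM> \<Longrightarrow> kills \<alpha> \<Longrightarrow> kills \<beta> \<Longrightarrow> kills (\<alpha> + \<beta>)"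
  by (simp add: kills_def rep_add)

lemma kills_scale: "\<alpha> \<in> \<MM> \<Longrightarrow> kills \<alpha> \<Longrightarrow> kills (fsc c \<alpha>)"
  by (simp add: kills_def rep_scale)

lemma kills_sum: "(\<And>i. i \<in> I \<Longrightarrow> \<alpha> i \<in> \<MM>) \<Longrightarrow> (\<And>i. i \<in> I \<Longrightarrow> kills (\<alpha> i)) \<Longrightarrow> kills (\<Sum>i\<in>I. \<alpha> i)"
  unfolding kills_def by (simp add: rep_sum)

lemma kills_bracket:
  assumes "\<alpha> \<in> \<MM>" "\<beta> \<in> \<MM>" "kills \<alpha>"
  shows "kills (fbr \<alpha> \<beta>)" "kills (fbr \<beta> \<alpha>)"
  using assms by (simp_all add: kills_def rep_bracket rep_closed rep_vec_0)

lemma irreducible_generators: "V.irreducible (\<rho> ` J 1 1) V"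
  unfolding V.irreducible_def
proof (intro conjI allI impI)
  show "V \<noteq> {0}" using irr by (simp add: irreducible_rep_def)
  fix U assume U: "V.invariant (\<rho> ` J 1 1) U \<and> U \<subseteq> V"
  have "\<rho> \<alpha> u \<in> U" if \<alpha>: "\<alpha> \<in> \<MM>" and u: "u \<in> U" for \<alpha> u
  proof -
    obtain I :: "int set" and a F b G where I: "finite I" "\<And>i. a i \<in> \<gg>0" "\<And>i. b i \<in> \<gg>1"
      "\<alpha> = (\<Sum>i\<in>I. even_map (a i) (F i) + odd_map (b i) (G i))"
      by (rule map_algebra_decomposition[OF \<alpha>]) (rule that; assumption)
    have g: "even_map (a i) (F i) \<in> J 1 1" "odd_map (b i) (G i) \<in> J 1 1" for i
      using I by (auto intro: even_map_J odd_map_J)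
    note gM = g[THEN J_subset]
    have "u \<in> V" using u U by auto
    then have "\<rho> \<alpha> u = (\<Sum>i\<in>I. \<rho> (even_map (a i) (F i)) u + \<rho> (odd_map (b i) (G i)) u)"
      unfolding I(4)
      by (simp only: rep_sum[OF F.subspace_add[OF subspace_\<MM> gM]] rep_add[OF gM])
    also have "\<dots> \<in> U"
    proof (rule V.subspace_sum)
      show "V.subspace U" using U by (simp add: V.invariant_def)
      then show "\<rho> (even_map (a i) (F i)) u + \<rho> (odd_map (b i) (G i)) u \<in> U" for i
        using U u g by (intro V.subspace_add) (auto simp: V.invariant_def)
    qed
    finally show ?thesis .
  qed
  then have "V.subspace U \<and> U \<subseteq> V \<and> (\<forall>\<alpha>\<in>\<MM>. \<forall>u\<in>U. \<rho> \<alpha> u \<in> U)"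
    using U by (simp add: V.invariant_def)
  then show "U = {0} \<or> U = V"
    by (rule conjunct2[OF irr[unfolded irreducible_rep_def], rule_format])
qed

text \<open>The operators of \<open>u \<otimes> z\<^sup>n\<close>, \<open>n \<ge> 0\<close>, are linearly dependent.\<close>

lemma exists_killed_poly:
  assumes u: "u \<in> \<gg>0"
  shows "\<exists>P. P \<noteq> 0 \<and> kills (even_map u P)"
proof -
  interpret FV: ac_vector_space "fun_scale sV :: 'k \<Rightarrow> ('v \<Rightarrow> 'v) \<Rightarrow> 'v \<Rightarrow> 'v"
    by (intro ac_vector_space.intro vector_space_fun_scale V.vector_space_axioms)
  obtain B where B: "finite B" "V.span B = V" using fd by (auto simp: finite_dimensional_def)
  have BV: "B \<subseteq> V" using V.span_superset B(2) by blast
  define g where "g n = (\<lambda>b. if b \<in> B then \<rho> (even_map u (monom 1 n)) b else 0)" for n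
  obtain S where S: "finite S" "\<And>h. (\<And>b. h b \<in> V) \<Longrightarrow> (\<And>b. b \<notin> B \<Longrightarrow> h b = 0) \<Longrightarrow> h \<in> FV.span S"
    using fun_space_spanned[OF V.vector_space_axioms B(1) fd] by auto
  have gS: "g n \<in> FV.span S" for n
    by (rule S(2)) (use BV rep_closed even_map_in[OF u] V.subspace_0[OF subspace_V] in \<open>auto simp: g_def\<close>)
  have fdS: "finite_dimensional (fun_scale sV) (FV.span S)"
    using S(1) unfolding finite_dimensional_def by blast
  obtain N c where c: "(\<Sum>i\<le>N. fun_scale sV (c i) (g i)) = 0" "\<exists>i\<le>N. c i \<noteq> 0"
    by (rule FV.family_dependent[OF fdS gS])
  define P where "P = (\<Sum>i\<le>N. monom (c i) i)"
  have "coeff P i = (if i \<le> N then c i else 0)" for i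
    unfolding P_def by (simp add: coeff_sum)
  then have "P \<noteq> 0" using c(2) by (metis coeff_0)
  have "even_map u P = (\<Sum>i\<le>N. fsc (c i) (even_map u (monom 1 i)))"
    by (auto simp: fun_eq_iff sum_fun_apply even_map_def fun_scale_def P_def poly_sum poly_monom scale_sum_left)
  then have \<rho>P: "\<rho> (even_map u P) v = (\<Sum>i\<le>N. sV (c i) (\<rho> (even_map u (monom 1 i)) v))" if "v \<in> V" for v
    using that even_map_in[OF u] F.subspace_scale[OF subspace_\<MM>] by (simp add: rep_sum rep_scale)
  have *: "\<rho> (even_map u P) b = (\<lambda>_. 0) b" if b: "b \<in> B" for b
  proof -
    have "(\<Sum>i\<le>N. sV (c i) (\<rho> (even_map u (monom 1 i)) b)) = (\<Sum>i\<le>N. fun_scale sV (c i) (g i)) b"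
      unfolding sum_fun_apply using b by (simp add: fun_scale_def g_def)
    then show ?thesis using \<rho>P[of b] b BV c(1) by auto
  qed
  have "\<rho> (even_map u P) v = (\<lambda>_. 0) v" if "v \<in> V" for v
  proof (rule linear_on_span_eq[where f = "\<rho> (even_map u P)" and g = "\<lambda>_. 0",
        OF V.vector_space_axioms subspace_V V.vector_space_axioms _ _ BV])
    show "linear_on sV sV V (\<rho> (even_map u P))"
      by (rule V.operator_on_linear[OF rep_operator[OF even_map_in[OF u]]])
    show "linear_on sV sV V (\<lambda>_. 0)" by (simp add: linear_on_def)
    show "v \<in> V.span B" using that B(2) by simp
  qed (rule *)
  then have "kills (even_map u P)" by (simp add: kills_def)
  then show ?thesis using \<open>P \<noteq> 0\<close> by blast
qed

text \<open>\<open>P\<close> is a conductor of \<open>u\<close>: the ideal \<open>P k[z]\<close>, tensored with \<open>u\<close>, acts as zero.\<close>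

definition killed0 :: "'k poly \<Rightarrow> 'g \<Rightarrow> bool" where
  "killed0 P u \<longleftrightarrow> u \<in> \<gg>0 \<and> (\<forall>F. P dvd F \<longrightarrow> kills (even_map u F))"

definition killed1 :: "'k poly \<Rightarrow> 'g \<Rightarrow> bool" where
  "killed1 P u \<longleftrightarrow> u \<in> \<gg>1 \<and> (\<forall>F. P dvd F \<longrightarrow> kills (odd_map u F))"

lemma killed_mono: "killed0 P u \<Longrightarrow> P dvd Q \<Longrightarrow> killed0 Q u" "killed1 P u \<Longrightarrow> P dvd Q \<Longrightarrow> killed1 Q u"
  unfolding killed0_def killed1_def using dvd_trans by blast+

lemma killed_0: "killed0 P 0" "killed1 P 0"
  unfolding killed0_def killed1_def
  using kills_0 V.subspace_0 subspace_0[OF subspace_\<gg>0] subspace_0[OF subspace_\<gg>1] by simp_all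

lemma killed_add: "killed0 P u \<Longrightarrow> killed0 P v \<Longrightarrow> killed0 P (u + v)"
  "killed1 P u' \<Longrightarrow> killed1 P v' \<Longrightarrow> killed1 P (u' + v')"
  unfolding killed0_def killed1_def
  using subspace_add[OF subspace_\<gg>0] subspace_add[OF subspace_\<gg>1]
  by (auto simp only: even_map_add odd_map_add intro!: kills_add even_map_in odd_map_in)

lemma killed_scale: "killed0 P u \<Longrightarrow> killed0 P (c *s u)" "killed1 P v \<Longrightarrow> killed1 P (c *s v)"
  unfolding killed0_def killed1_def
  using subspace_scale[OF subspace_\<gg>0] subspace_scale[OF subspace_\<gg>1]
  by (auto simp only: even_map_scale odd_map_scale intro!: kills_scale even_map_in odd_map_in)

lemma killed_bracket:
  shows "a \<in> \<gg>0 \<Longrightarrow> killed0 P u \<Longrightarrow> killed0 P (bracket a u)"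
    and "a \<in> \<gg>1 \<Longrightarrow> killed0 P u \<Longrightarrow> killed1 P (bracket a u)"
    and "a \<in> \<gg>0 \<Longrightarrow> killed1 P v \<Longrightarrow> killed1 P (bracket a v)"
    and "a \<in> \<gg>1 \<Longrightarrow> killed1 P v \<Longrightarrow> killed0 (D0 * P) (bracket a v)"
proof -
  show "killed0 P (bracket a u)" if "a \<in> \<gg>0" "killed0 P u" for a u
    using that kills_bracket(2)[of "even_map u F" "even_map a 1" for F]
    unfolding killed0_def by (auto simp: bracket_even_even intro: even_map_in bracket_00)
  show "killed1 P (bracket a u)" if "a \<in> \<gg>1" "killed0 P u" for a u
    using that kills_bracket(2)[of "even_map u F" "odd_map a 1" for F]
    unfolding killed0_def killed1_def by (auto simp: bracket_odd_even intro: even_map_in odd_map_in bracket_10)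
  show "killed1 P (bracket a u)" if "a \<in> \<gg>0" "killed1 P u" for a u
    using that kills_bracket(2)[of "odd_map u F" "even_map a 1" for F]
    unfolding killed1_def by (auto simp: bracket_even_odd intro: even_map_in odd_map_in bracket_01)
  show "killed0 (D0 * P) (bracket a v)" if a: "a \<in> \<gg>1" and v: "killed1 P v" for a v
    unfolding killed0_def
  proof (intro conjI allI impI)
    show "bracket a v \<in> \<gg>0" using a v by (simp add: killed1_def bracket_11)
    fix F assume "D0 * P dvd F"
    then obtain G where G: "F = D0 * P * G" by (rule dvdE)
    have "kills (fbr (odd_map a 1) (odd_map v (P * G)))"
      using a v by (intro kills_bracket odd_map_in) (auto simp: killed1_def)
    then show "kills (even_map (bracket a v) F)" by (simp add: bracket_odd_odd G mult.assoc)
  qed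
qed

text \<open>The elements of \<open>\<gg>\<close> that have a nonzero conductor form an ideal.  It is not zero: if \<open>u \<otimes> P\<close> acts as
  zero, then so does \<open>[u, a] \<otimes> P G\<close> for every polynomial \<open>G\<close>, as the bracket of \<open>u \<otimes> P\<close> and \<open>a \<otimes> G\<close>.
  Hence it is \<open>\<gg>\<close>, and the product of the conductors of finitely many spanning elements serves all of
  \<open>\<gg>\<close>.\<close>

lemma conductor_exists:
  "\<exists>P. P \<noteq> 0 \<and> (\<forall>u\<in>\<gg>0. killed0 P u) \<and> (\<forall>u\<in>\<gg>1. killed1 P u)"
proof -
  let ?I = "{u. \<exists>P. P \<noteq> 0 \<and> killed0 P (p0 u) \<and> killed1 P (p1 u)}"
  have D0: "D0 \<noteq> 0" by (simp add: D0_def)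
  have sub: "subspace ?I"
    unfolding subspace_def
  proof (intro conjI ballI allI)
    show "0 \<in> ?I" using killed_0 by (auto intro!: exI[of _ 1])
    show "x + y \<in> ?I" if "x \<in> ?I" "y \<in> ?I" for x y
    proof -
      obtain P where P: "P \<noteq> 0" "killed0 P (p0 x)" "killed1 P (p1 x)"
        using \<open>x \<in> ?I\<close> by auto
      obtain Q where Q: "Q \<noteq> 0" "killed0 Q (p0 y)" "killed1 Q (p1 y)"
        using \<open>y \<in> ?I\<close> by auto
      have "P * Q \<noteq> 0" "killed0 (P * Q) (p0 (x + y))" "killed1 (P * Q) (p1 (x + y))"
        unfolding p0_add p1_add using P(1) Q(1)
        by (simp, intro killed_add killed_mono(1)[OF P(2) dvd_triv_left] killed_mono(1)[OF Q(2) dvd_triv_right],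
            intro killed_add killed_mono(2)[OF P(3) dvd_triv_left] killed_mono(2)[OF Q(3) dvd_triv_right])
      then show ?thesis by blast
    qed
    show "c *s x \<in> ?I" if "x \<in> ?I" for c x
      using that killed_scale by (auto simp only: p0_scale p1_scale mem_Collect_eq)
  qed
  have ideal: "bracket x y \<in> ?I" if y: "y \<in> ?I" for x y
  proof -
    obtain P where P: "P \<noteq> 0" "killed0 P (p0 y)" "killed1 P (p1 y)" using y by auto
    (* The factor D0 comes from the bracket of two odd maps, since w^2 = D0(z). *)
    have "killed0 (D0 * P) (p0 (bracket x y))"
      unfolding p0_bracket
      by (intro killed_add killed_bracket(4)[OF p1_in P(3)] killed_mono(1)[OF killed_bracket(1)[OF p0_in P(2)]]) simp
    moreover have "killed1 (D0 * P) (p1 (bracket x y))"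
      unfolding p1_bracket
      by (intro killed_add killed_mono(2)[OF killed_bracket(2)[OF p1_in P(2)]]
          killed_mono(2)[OF killed_bracket(3)[OF p0_in P(3)]]) simp_all
    ultimately show ?thesis using P(1) D0 by (intro CollectI exI[of _ "D0 * P"]) auto
  qed
  have "\<exists>u\<in>\<gg>0. u \<noteq> 0"
  proof (rule ccontr)
    assume "\<not> ?thesis"
    then have 0: "u = 0" if "u \<in> \<gg>0" for u using that by auto
    have "x = p1 x" for x using p0_add_p1[of x] 0[OF p0_in[of x]] by simp
    then have "bracket x y = 0" for x y using 0[OF bracket_11[OF p1_in p1_in]] by metis
    then show False using nonabelian by blast
  qed
  then obtain u where u: "u \<in> \<gg>0" "u \<noteq> 0" by auto
  obtain P where P: "P \<noteq> 0" "kills (even_map u P)" using exists_killed_poly[OF u(1)] by auto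
  obtain v where v: "bracket u v \<noteq> 0" by (rule bracket_nonzero[OF u(2)])
  have 0: "killed0 P (bracket u a)" if a: "a \<in> \<gg>0" for a
    unfolding killed0_def
  proof (intro conjI allI impI)
    fix F assume "P dvd F"
    then obtain G where G: "F = P * G" by (rule dvdE)
    show "kills (even_map (bracket u a) F)"
      unfolding G bracket_even_even[symmetric] by (intro kills_bracket even_map_in u a P)
  qed (intro bracket_00 u a)
  have 1: "killed1 P (bracket u a)" if a: "a \<in> \<gg>1" for a
    unfolding killed1_def
  proof (intro conjI allI impI)
    fix F assume "P dvd F"
    then obtain G where G: "F = P * G" by (rule dvdE)
    show "kills (odd_map (bracket u a) F)"
      unfolding G bracket_even_odd[symmetric] by (intro kills_bracket even_map_in odd_map_in u a P)
  qed (intro bracket_01 u a)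
  have "bracket u v \<in> ?I"
    using P(1) 0[OF p0_in[of v]] 1[OF p1_in[of v]] u(1)
    by (auto simp: p0_bracket p1_bracket p0_fixed p1_of_\<gg>0)
  then have I: "w \<in> ?I" for w using ideal_UNIV[OF sub ideal _ v] by blast
  obtain B where B: "finite B" "span B = UNIV" using finite_dim by blast
  have "\<forall>b. \<exists>P. P \<noteq> 0 \<and> killed0 P (p0 b) \<and> killed1 P (p1 b)" using I by blast
  then obtain Q where Q: "\<And>b. Q b \<noteq> 0" "\<And>b. killed0 (Q b) (p0 b)" "\<And>b. killed1 (Q b) (p1 b)" by metis
  let ?P = "\<Prod>b\<in>B. Q b"
  have "subspace {w. killed0 ?P (p0 w) \<and> killed1 ?P (p1 w)}"
    unfolding subspace_def using killed_0 killed_add killed_scale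
    by (simp add: p0_add p1_add p0_scale p1_scale)
  moreover have "B \<subseteq> {w. killed0 ?P (p0 w) \<and> killed1 ?P (p1 w)}"
  proof
    fix b assume "b \<in> B"
    then have "Q b dvd ?P" using B(1) by (rule dvd_prodI[rotated])
    then show "b \<in> {w. killed0 ?P (p0 w) \<and> killed1 ?P (p1 w)}" using Q killed_mono by blast
  qed
  ultimately have all: "killed0 ?P (p0 w) \<and> killed1 ?P (p1 w)" for w
    using span_minimal[of B "{w. killed0 ?P (p0 w) \<and> killed1 ?P (p1 w)}"] B(2) by blast
  show ?thesis
  proof (intro exI[of _ ?P] conjI ballI)
    show "?P \<noteq> 0" using Q(1) by (simp add: prod_zero_iff[OF B(1)])
    show "killed0 ?P u" if "u \<in> \<gg>0" for u using all[of u] that by (simp add: p0_fixed)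
    show "killed1 ?P u" if "u \<in> \<gg>1" for u using all[of u] that by (simp add: p1_fixed)
  qed
qed

lemma kills_commutator_scalar:
  assumes \<alpha>: "\<alpha> \<in> \<MM>" and \<beta>: "\<beta> \<in> \<MM>" and c: "\<forall>v\<in>V. \<rho> \<beta> v = sV c v"
  shows "kills (fbr \<alpha> \<beta>)"
  using \<alpha> \<beta> c rep_closed[OF \<alpha>] V.operator_on_scale[OF rep_operator[OF \<alpha>]]
  by (simp add: kills_def rep_bracket)

text \<open>The divisibility conditions say that \<open>J A A'\<close> spans an ideal of \<open>\<MM>\<close>.\<close>

lemma commuting_J_scalar:
  assumes comm: "\<And>\<alpha> \<beta>. \<alpha> \<in> J A A' \<Longrightarrow> \<beta> \<in> J A A' \<Longrightarrow> kills (fbr \<alpha> \<beta>)"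
    and A: "A dvd D0 * A'" "A' dvd A" and \<alpha>: "\<alpha> \<in> J A A'"
  shows "\<exists>c. \<forall>v\<in>V. \<rho> \<alpha> v = sV c v"
proof (rule V.commuting_ideal_scalar[OF fd, of "\<rho> ` J 1 1" "\<rho> ` J A A'"])
  show "V.irreducible (\<rho> ` J 1 1) V" by (rule irreducible_generators)
  show "V.operator_on V a" if "a \<in> \<rho> ` J 1 1" for a using that J_subset rep_operator by blast
  show "V.operator_on V a" if "a \<in> \<rho> ` J A A'" for a using that J_subset rep_operator by blast
  show "\<rho> \<alpha> \<in> \<rho> ` J A A'" using \<alpha> by simp
  show "i (j v) = j (i v)" if i: "i \<in> \<rho> ` J A A'" and j: "j \<in> \<rho> ` J A A'" and v: "v \<in> V" for i j v
  proof -
    obtain \<alpha> \<beta> where ab: "\<alpha> \<in> J A A'" "\<beta> \<in> J A A'" "i = \<rho> \<alpha>" "j = \<rho> \<beta>" using i j by auto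
    have "\<rho> (fbr \<alpha> \<beta>) v = 0" using comm[OF ab(1,2)] v by (simp add: kills_def)
    then show ?thesis using rep_bracket[OF J_subset[OF ab(1)] J_subset[OF ab(2)] v] ab by simp
  qed
  show "\<exists>b\<in>\<rho> ` J A A'. \<forall>v\<in>V. b v = j (a v) - a (j v)" if j: "j \<in> \<rho> ` J A A'" and a: "a \<in> \<rho> ` J 1 1" for j a
  proof -
    obtain \<alpha> \<beta> where ab: "\<alpha> \<in> J A A'" "\<beta> \<in> J 1 1" "j = \<rho> \<alpha>" "a = \<rho> \<beta>" using j a by auto
    have "fbr \<alpha> \<beta> \<in> J A A'" by (rule J_bracket[OF ab(1,2)]) (use A in simp_all)
    then show ?thesis
      using rep_bracket[OF J_subset[OF ab(1)] J_subset[OF ab(2)]] ab by (intro bexI[of _ "\<rho> (fbr \<alpha> \<beta>)"]) auto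
  qed
qed

text \<open>The ideal \<open>I\<close> spanned by \<open>J (R\<^sup>n\<^sup>+\<^sup>1) (R\<^sup>n R')\<close> is equal to its bracket with \<open>\<MM>\<close>; so it acts as zero
  once it acts by scalars.  Its derived algebra lies in the span of \<open>J K K\<close> with \<open>K = R\<^sup>2\<^sup>n\<^sup>+\<^sup>1 R'\<close>, and the
  derived algebra of the latter lies in the next ideal of the chain, which acts as zero.  Hence \<open>J K K\<close>
  acts by scalars.  These scalars are zero on the brackets of elements of \<open>I\<close>, where they are
  commutators of operators that commute with them.  So \<open>I\<close> acts by commuting operators, and therefore by
  scalars.\<close>

lemma J_descent:
  assumes R: "R = D0 * R'"
    and next_killed: "\<And>\<alpha>. \<alpha> \<in> J (R ^ Suc (Suc n)) (R ^ Suc n * R') \<Longrightarrow> kills \<alpha>"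
    and \<alpha>: "\<alpha> \<in> J (R ^ Suc n) (R ^ n * R')"
  shows "kills \<alpha>"
proof -
  let ?I = "J (R ^ Suc n) (R ^ n * R')"
  (* The common divisor of the coefficients of brackets of elements of I: R^(n+1) R^n R' in the odd part,
     and, because D0 R'^2 = R R', D0 (R^n R')^2 in the even part. *)
  define K where "K = R ^ (2 * n + 1) * R'"
  have K: "K = R ^ n * (R ^ n * (R * R'))"
  proof -
    have "R ^ (2 * n + 1) = R ^ (n + n) * R" by (simp add: mult_2)
    then show ?thesis unfolding K_def power_add by (simp only: ac_simps)
  qed
  have KK: "R ^ Suc (Suc n) dvd K * K" "R ^ Suc n * R' dvd K * K"
  proof -
    have e: "K * K = R ^ Suc (Suc n) * (R ^ n * R ^ n * R ^ n * (R' * R'))"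
      by (simp add: K ac_simps)
    show "R ^ Suc (Suc n) dvd K * K" unfolding e by (rule dvd_triv_left)
    have e': "K * K = (R ^ Suc n * R') * (R ^ n * K)"
      by (simp add: K ac_simps)
    show "R ^ Suc n * R' dvd K * K" unfolding e' by (rule dvd_triv_left)
  qed
  have "kills (fbr \<alpha> \<beta>)" if "\<alpha> \<in> J K K" "\<beta> \<in> J K K" for \<alpha> \<beta>
    by (rule next_killed, rule J_bracket[OF that])
      (use KK in \<open>auto simp: mult.assoc intro: dvd_mult\<close>)
  then have K_scalar: "\<exists>c. \<forall>v\<in>V. \<rho> \<alpha> v = sV c v" if "\<alpha> \<in> J K K" for \<alpha>
    using that by (intro commuting_J_scalar[of K K]) simp_all
  have I_bracket: "fbr \<alpha> \<beta> \<in> J K K" if "\<alpha> \<in> ?I" "\<beta> \<in> ?I" for \<alpha> \<beta>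
  proof (rule J_bracket[OF that])
    have "R ^ Suc n * R ^ Suc n = K * D0" by (simp add: K R ac_simps)
    then show "K dvd R ^ Suc n * R ^ Suc n" by simp
    have "D0 * (R ^ n * R') * (R ^ n * R') = K" by (simp add: K R ac_simps)
    then show "K dvd D0 * (R ^ n * R') * (R ^ n * R')" by simp
    have "R ^ Suc n * (R ^ n * R') = K" "R ^ n * R' * R ^ Suc n = K" by (simp_all add: K ac_simps)
    then show "K dvd R ^ Suc n * (R ^ n * R')" "K dvd R ^ n * R' * R ^ Suc n" by simp_all
  qed
  have "kills (fbr \<alpha> \<beta>)" if a: "\<alpha> \<in> ?I" and b: "\<beta> \<in> ?I" for \<alpha> \<beta>
  proof -
    note \<alpha> = J_subset[OF a] and \<beta> = J_subset[OF b]
    note \<gamma> = bracket_\<MM>[OF \<alpha> \<beta>]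
    obtain c where c: "\<And>v. v \<in> V \<Longrightarrow> \<rho> (fbr \<alpha> \<beta>) v = sV c v"
      using K_scalar[OF I_bracket[OF a b]] by auto
    obtain \<mu> v where v: "v \<in> V" "v \<noteq> 0" "\<rho> \<alpha> v = sV \<mu> v"
      by (rule V.eigenvector_exists[OF fd rep_operator[OF \<alpha>]]) (use irr in \<open>auto simp: irreducible_rep_def\<close>)
    have "c = 0"
    proof (rule V.commutator_eigenvalue_0[OF fd rep_operator[OF \<alpha>] rep_operator[OF \<beta>] rep_operator[OF \<gamma>] _ _ v(1-3)])
      show "\<rho> (fbr \<alpha> \<beta>) v = \<rho> \<alpha> (\<rho> \<beta> v) - \<rho> \<beta> (\<rho> \<alpha> v)" if "v \<in> V" for v
        by (rule rep_bracket[OF \<alpha> \<beta> that])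
      show "\<rho> \<alpha> (\<rho> (fbr \<alpha> \<beta>) v) = \<rho> (fbr \<alpha> \<beta>) (\<rho> \<alpha> v)" if "v \<in> V" for v
        using that c rep_closed[OF \<alpha>] V.operator_on_scale[OF rep_operator[OF \<alpha>]] by simp
    qed (rule c[OF v(1)])
    then show ?thesis using c by (simp add: kills_def)
  qed
  then have scalar: "\<exists>c. \<forall>v\<in>V. \<rho> \<alpha> v = sV c v" if "\<alpha> \<in> ?I" for \<alpha>
    using that by (intro commuting_J_scalar[of "R ^ Suc n" "R ^ n * R'"])
      (auto simp: R mult.left_commute)
  (* A commutator with a scalar operator is zero; it remains to write the elements of I as sums of brackets. *)
  have I_killed: "kills (fbr \<alpha> \<beta>)" if "\<alpha> \<in> \<MM>" "\<beta> \<in> ?I" for \<alpha> \<beta>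
    using kills_commutator_scalar[OF that(1) J_subset[OF that(2)]] scalar[OF that(2)] by blast
  show ?thesis
    using \<alpha>
  proof (cases rule: J_cases)
    case (1 u F)
    then obtain G where G: "F = R ^ Suc n * G" by (auto elim: dvdE)
    let ?S = "{u \<in> \<gg>0. kills (even_map u F)}"
    have "u \<in> ?S"
    proof (rule \<gg>0_generated[OF _ _ \<open>u \<in> \<gg>0\<close>])
      show "subspace ?S"
        unfolding subspace_def
        using subspace_\<gg>0 kills_0 by (auto simp: subspace_def even_map_add even_map_scale
            intro!: kills_add kills_scale even_map_in)
      show "bracket a b \<in> ?S" if ab: "a \<in> \<gg>1" "b \<in> \<gg>1" for a b
      proof -
        (* F = D0 R^n R' G, and D0 = w^2 is supplied by the bracket of two odd maps. *)
        have "kills (fbr (odd_map a 1) (odd_map b (R ^ n * R' * G)))"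
          by (rule I_killed) (use ab in \<open>auto intro: odd_map_in odd_map_J\<close>)
        moreover have "D0 * 1 * (R ^ n * R' * G) = F" by (simp add: G R ac_simps)
        ultimately show ?thesis using bracket_11[OF ab] by (simp add: bracket_odd_odd)
      qed
    qed
    then show ?thesis using 1 by simp
  next
    case (2 u F)
    let ?S = "{u \<in> \<gg>1. kills (odd_map u F)}"
    have "u \<in> ?S"
    proof (rule \<gg>1_generated[OF _ _ \<open>u \<in> \<gg>1\<close>])
      show "subspace ?S"
        unfolding subspace_def
        using subspace_\<gg>1 kills_0 by (auto simp: subspace_def odd_map_add odd_map_scale
            intro!: kills_add kills_scale odd_map_in)
      show "bracket a b \<in> ?S" if ab: "a \<in> \<gg>0" "b \<in> \<gg>1" for a b
      proof -
        have "kills (fbr (even_map a 1) (odd_map b F))"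
          by (rule I_killed) (use ab 2 in \<open>auto intro: even_map_in odd_map_J\<close>)
        then show ?thesis using bracket_01[OF ab] by (simp add: bracket_even_odd)
      qed
    qed
    then show ?thesis using 2 by simp
  qed
qed

text \<open>A conductor \<open>P\<close> of \<open>\<gg>\<close> divides a power of the product \<open>R\<close> over its roots.  So the ideals of the chain
  act as zero from some index on, and then all of them do.  The points \<open>2, -2\<close> are added to the roots,
  because \<open>D0\<close> has to divide \<open>R\<close>.\<close>

lemma annihilator_radical:
  "\<exists>Z. finite Z \<and> 2 \<in> Z \<and> - 2 \<in> Z \<and>
    (\<forall>\<alpha>\<in>J (\<Prod>\<zeta>\<in>Z. [:- \<zeta>, 1:]) (\<Prod>\<zeta>\<in>Z - {2, - 2}. [:- \<zeta>, 1:]). kills \<alpha>)"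
proof -
  obtain P where P: "P \<noteq> 0" "\<And>u. u \<in> \<gg>0 \<Longrightarrow> killed0 P u" "\<And>u. u \<in> \<gg>1 \<Longrightarrow> killed1 P u"
    using conductor_exists by auto
  define Z where "Z = {x. poly P x = 0} \<union> {2, - 2}"
  have Z: "finite Z" unfolding Z_def by (simp, rule poly_roots_finite[OF P(1)])
  let ?R = "\<Prod>\<zeta>\<in>Z. [:- \<zeta>, 1:]" and ?R' = "\<Prod>\<zeta>\<in>Z - {2, - 2}. [:- \<zeta>, 1:]"
  have "(2 :: 'k) \<noteq> - 2"
  proof
    assume "(2 :: 'k) = - 2"
    then have "(2 :: 'k) + 2 = 0" by (simp only: eq_neg_iff_add_eq_0)
    then show False by simp
  qed
  then have "(\<Prod>\<zeta>\<in>{2, - 2}. [:- \<zeta>, 1:]) = (D0 :: 'k poly)" by (simp add: D0_def)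
  moreover have "?R = ?R' * (\<Prod>\<zeta>\<in>{2, - 2}. [:- \<zeta>, 1:])"
    by (rule prod.subset_diff[OF _ Z]) (auto simp: Z_def)
  ultimately have R: "?R = D0 * ?R'" by (simp only: mult.commute)
  have P_dvd: "P dvd ?R ^ degree P" by (rule dvd_power_of_roots[OF P(1) Z]) (auto simp: Z_def)
  have top: "kills \<alpha>" if "\<alpha> \<in> J (?R ^ Suc (degree P)) (?R ^ degree P * ?R')" for \<alpha>
    using that
  proof (cases rule: J_cases)
    case (1 u F)
    have "P dvd ?R ^ Suc (degree P)" using P_dvd by (simp add: dvd_mult)
    then show ?thesis using P(2) 1 dvd_trans unfolding killed0_def by blast
  next
    case (2 u F)
    have "P dvd ?R ^ degree P * ?R'" using P_dvd by (rule dvd_mult2)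
    then show ?thesis using P(3) 2 dvd_trans unfolding killed1_def by blast
  qed
  (* Descend from the exponent degree P to 0. *)
  have "\<forall>\<alpha>\<in>J (?R ^ Suc (degree P - m)) (?R ^ (degree P - m) * ?R'). kills \<alpha>" if "m \<le> degree P" for m
    using that
  proof (induction m)
    case 0
    then show ?case using top by simp
  next
    case (Suc m)
    then have "degree P - m = Suc (degree P - Suc m)" by simp
    then show ?case using J_descent[OF R, of "degree P - Suc m"] Suc by auto
  qed
  from this[of "degree P"] have "kills \<alpha>" if "\<alpha> \<in> J ?R ?R'" for \<alpha> using that by simp
  then show ?thesis using Z by (intro exI[of _ Z] conjI ballI) (simp_all add: Z_def)
qed

text \<open>A map that vanishes at the points over \<open>Z\<close> is a sum of multiples of \<open>R\<close> and \<open>R'\<close>: subtract from the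
  coefficients of its even and odd parts their interpolation polynomials on \<open>Z\<close> and \<open>Z - {2, -2}\<close>; the
  interpolation polynomials add up to zero.\<close>

lemma vanishing_killed:
  assumes Z: "finite Z" "2 \<in> Z" "- 2 \<in> Z"
    and J: "\<And>\<alpha>. \<alpha> \<in> J (\<Prod>\<zeta>\<in>Z. [:- \<zeta>, 1:]) (\<Prod>\<zeta>\<in>Z - {2, - 2}. [:- \<zeta>, 1:]) \<Longrightarrow> kills \<alpha>"
    and pt: "\<And>\<zeta>. \<zeta> \<in> Z \<Longrightarrow> pt \<zeta> \<noteq> 0 \<and> pt \<zeta> + inverse (pt \<zeta>) = \<zeta>"
    and \<alpha>: "\<alpha> \<in> \<MM>" "\<And>\<zeta>. \<zeta> \<in> Z \<Longrightarrow> \<alpha> (pt \<zeta>) = 0"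
  shows "kills \<alpha>"
proof -
  obtain I :: "int set" and u F v G where I: "finite I" "\<And>i. u i \<in> \<gg>0" "\<And>i. v i \<in> \<gg>1"
    and dec: "\<alpha> = (\<Sum>i\<in>I. even_map (u i) (F i) + odd_map (v i) (G i))"
    by (rule map_algebra_decomposition[OF \<alpha>(1)]) (rule that; assumption)
  let ?Z' = "Z - {2, - 2}"
  have Z': "finite ?Z'" using Z by simp
  have p0\<alpha>: "p0 (\<alpha> x) = (\<Sum>i\<in>I. poly (F i) (x + inverse x) *s u i)"
    and p1\<alpha>: "p1 (\<alpha> x) = (\<Sum>i\<in>I. ((x - inverse x) * poly (G i) (x + inverse x)) *s v i)" if "x \<noteq> 0" for x
    unfolding dec sum_fun_apply p0_sum p1_sum using I that
    by (auto simp: even_map_def odd_map_def p0_add p1_add p0_scale p1_scale p0_fixed p1_fixed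
        p0_of_\<gg>1 p1_of_\<gg>0 intro!: sum.cong)
  have F0: "(\<Sum>i\<in>I. poly (F i) \<zeta> *s u i) = 0" if "\<zeta> \<in> Z" for \<zeta>
    using p0\<alpha>[of "pt \<zeta>"] pt[OF that] \<alpha>(2)[OF that] by simp
  have G0: "(\<Sum>i\<in>I. poly (G i) \<zeta> *s v i) = 0" if "\<zeta> \<in> ?Z'" for \<zeta>
  proof -
    (* The odd part of a map is a multiple of w, which does not vanish off 2 and -2. *)
    let ?w = "pt \<zeta> - inverse (pt \<zeta>)"
    have x: "pt \<zeta> \<noteq> 0" "pt \<zeta> + inverse (pt \<zeta>) = \<zeta>" using pt that by auto
    have "poly D0 \<zeta> = ?w * ?w" using poly_D0[OF x(1)] x(2) by simp
    moreover have "poly D0 \<zeta> = (\<zeta> - 2) * (\<zeta> + 2)" by (simp add: D0_def algebra_simps)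
    moreover have "\<zeta> + 2 \<noteq> 0" using that by (auto simp: eq_neg_iff_add_eq_0)
    ultimately have w: "?w \<noteq> 0" using that by auto
    have "?w *s (\<Sum>i\<in>I. poly (G i) \<zeta> *s v i) = p1 (\<alpha> (pt \<zeta>))"
      using p1\<alpha>[OF x(1)] x(2) by (simp add: scale_sum_right)
    also have "\<dots> = 0" using \<alpha>(2)[of \<zeta>] that by simp
    finally show ?thesis using w by simp
  qed
  define S where "S i = (\<Sum>\<zeta>\<in>Z. smult (poly (F i) \<zeta>) (lagrange Z \<zeta>))" for i
  define S' where "S' i = (\<Sum>\<zeta>\<in>?Z'. smult (poly (G i) \<zeta>) (lagrange ?Z' \<zeta>))" for i
  have interp: "poly (\<Sum>\<zeta>\<in>Y. smult (f \<zeta>) (lagrange Y \<zeta>)) \<eta> = f \<eta>" if "finite Y" "\<eta> \<in> Y" for Y f \<eta>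
    using that by (simp add: poly_sum poly_lagrange[OF that] if_distrib cong: if_cong)
  have dvd: "(\<Prod>\<zeta>\<in>Z. [:- \<zeta>, 1:]) dvd F i - S i" for i
    by (rule vanishing_dvd[OF Z(1)]) (simp only: poly_diff S_def interp[OF Z(1)] diff_self)
  have dvd': "(\<Prod>\<zeta>\<in>?Z'. [:- \<zeta>, 1:]) dvd G i - S' i" for i
    by (rule vanishing_dvd[OF Z']) (simp only: poly_diff S'_def interp[OF Z'] diff_self)
  have S0: "(\<Sum>i\<in>I. poly (S i) z *s u i) = 0" for z
  proof -
    have "(\<Sum>i\<in>I. poly (S i) z *s u i) =
        (\<Sum>i\<in>I. \<Sum>\<zeta>\<in>Z. poly (lagrange Z \<zeta>) z *s poly (F i) \<zeta> *s u i)"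
      by (simp add: S_def poly_sum scale_sum_left mult.commute)
    also have "\<dots> = (\<Sum>\<zeta>\<in>Z. \<Sum>i\<in>I. poly (lagrange Z \<zeta>) z *s poly (F i) \<zeta> *s u i)" by (rule sum.swap)
    also have "\<dots> = 0"
    proof (rule sum.neutral, rule ballI)
      fix \<zeta> assume "\<zeta> \<in> Z"
      then show "(\<Sum>i\<in>I. poly (lagrange Z \<zeta>) z *s poly (F i) \<zeta> *s u i) = 0"
        unfolding scale_sum_right[symmetric] by (simp only: F0 scale_zero_right)
    qed
    finally show ?thesis .
  qed
  have S'0: "(\<Sum>i\<in>I. poly (S' i) z *s v i) = 0" for z
  proof -
    have "(\<Sum>i\<in>I. poly (S' i) z *s v i) =
        (\<Sum>i\<in>I. \<Sum>\<zeta>\<in>?Z'. poly (lagrange ?Z' \<zeta>) z *s poly (G i) \<zeta> *s v i)"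
      by (simp add: S'_def poly_sum scale_sum_left mult.commute)
    also have "\<dots> = (\<Sum>\<zeta>\<in>?Z'. \<Sum>i\<in>I. poly (lagrange ?Z' \<zeta>) z *s poly (G i) \<zeta> *s v i)" by (rule sum.swap)
    also have "\<dots> = 0"
    proof (rule sum.neutral, rule ballI)
      fix \<zeta> assume "\<zeta> \<in> ?Z'"
      then show "(\<Sum>i\<in>I. poly (lagrange ?Z' \<zeta>) z *s poly (G i) \<zeta> *s v i) = 0"
        unfolding scale_sum_right[symmetric] by (simp only: G0 scale_zero_right)
    qed
    finally show ?thesis .
  qed
  have "\<alpha> = (\<Sum>i\<in>I. even_map (u i) (F i - S i) + odd_map (v i) (G i - S' i))"
  proof
    fix x
    show "\<alpha> x = (\<Sum>i\<in>I. even_map (u i) (F i - S i) + odd_map (v i) (G i - S' i)) x"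
    proof (cases "x = 0")
      case True
      then show ?thesis by (simp add: dec sum_fun_apply even_map_def odd_map_def)
    next
      case False
      let ?z = "x + inverse x" and ?w = "x - inverse x"
      have "(\<Sum>i\<in>I. even_map (u i) (F i - S i) + odd_map (v i) (G i - S' i)) x =
          (\<Sum>i\<in>I. (even_map (u i) (F i) + odd_map (v i) (G i)) x
            - (poly (S i) ?z *s u i + ?w *s poly (S' i) ?z *s v i))"
        using False by (auto simp: sum_fun_apply even_map_def odd_map_def scale_left_diff_distrib
            algebra_simps intro!: sum.cong)
      also have "\<dots> = \<alpha> x - ((\<Sum>i\<in>I. poly (S i) ?z *s u i) + ?w *s (\<Sum>i\<in>I. poly (S' i) ?z *s v i))"
        unfolding dec sum_fun_apply by (simp only: sum_subtractf sum.distrib scale_sum_right)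
      also have "\<dots> = \<alpha> x" by (simp only: S0 S'0) simp
      finally show ?thesis by simp
    qed
  qed
  moreover have "kills (\<Sum>i\<in>I. even_map (u i) (F i - S i) + odd_map (v i) (G i - S' i))"
  proof (intro kills_sum kills_add)
    fix i
    have e: "even_map (u i) (F i - S i) \<in> \<MM>" "odd_map (v i) (G i - S' i) \<in> \<MM>"
      using I even_map_in odd_map_in by blast+
    then show "even_map (u i) (F i - S i) + odd_map (v i) (G i - S' i) \<in> \<MM>"
      by (rule F.subspace_add[OF subspace_\<MM>])
    show "even_map (u i) (F i - S i) \<in> \<MM>" "odd_map (v i) (G i - S' i) \<in> \<MM>" by fact+
    show "kills (even_map (u i) (F i - S i))" by (intro J even_map_J I dvd)
    show "kills (odd_map (v i) (G i - S' i))" by (intro J odd_map_J I dvd')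
  qed
  ultimately show ?thesis by simp
qed

lemma point_over: "\<exists>x::'k. x \<noteq> 0 \<and> x + inverse x = \<zeta>"
proof -
  have "degree [:1, - \<zeta>, 1:] > 0" by simp
  then obtain x where x: "poly [:1, - \<zeta>, 1:] x = 0" using alg_closed_imp_poly_has_root by blast
  then have "x \<noteq> 0" by auto
  moreover have "x * x + 1 = \<zeta> * x" using x by (simp add: algebra_simps)
  then have "x + inverse x = \<zeta>" using \<open>x \<noteq> 0\<close> by (simp add: field_simps)
  ultimately show ?thesis by blast
qed

theorem factors_through_evaluation:
  "\<exists>X. finite X \<and> X \<subseteq> X_rat \<and> inj_on (\<lambda>x. x + inverse x) X \<and>
    (\<forall>\<alpha>\<in>\<MM>. (\<forall>x\<in>X. \<alpha> x = 0) \<longrightarrow> (\<forall>v\<in>V. \<rho> \<alpha> v = 0))"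
proof -
  obtain Z where Z: "finite Z" "2 \<in> Z" "- 2 \<in> Z"
    "\<And>\<alpha>. \<alpha> \<in> J (\<Prod>\<zeta>\<in>Z. [:- \<zeta>, 1:]) (\<Prod>\<zeta>\<in>Z - {2, - 2}. [:- \<zeta>, 1:]) \<Longrightarrow> kills \<alpha>"
    using annihilator_radical by auto
  obtain pt where pt: "\<And>\<zeta>::'k. pt \<zeta> \<noteq> 0 \<and> pt \<zeta> + inverse (pt \<zeta>) = \<zeta>"
    using point_over by metis
  show ?thesis
  proof (intro exI[of _ "pt ` Z"] conjI ballI impI)
    show "inj_on (\<lambda>x. x + inverse x) (pt ` Z)" using pt by (auto simp: inj_on_def)
    show "\<rho> \<alpha> v = 0" if \<alpha>: "\<alpha> \<in> \<MM>" "\<forall>x\<in>pt ` Z. \<alpha> x = 0" and v: "v \<in> V" for \<alpha> v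
    proof -
      have "kills \<alpha>" by (rule vanishing_killed[OF Z(1-4) pt \<alpha>(1)]) (use \<alpha>(2) in auto)
      then show ?thesis using v by (simp add: kills_def)
    qed
  qed (use Z pt in \<open>auto simp: X_rat_def\<close>)
qed

end

section \<open>Irreducible representations are tensor products\<close>

context involution_lie_algebra
begin

lemma fixed_algebra_closed:
  assumes "a \<in> fixed_algebra \<sigma> x" "b \<in> fixed_algebra \<sigma> x"
  shows "a + b \<in> fixed_algebra \<sigma> x" "c *s a \<in> fixed_algebra \<sigma> x" "bracket a b \<in> fixed_algebra \<sigma> x"
  using assms subspace_add[OF subspace_\<gg>0] subspace_scale[OF subspace_\<gg>0] bracket_00
  by (auto simp: fixed_algebra_eq split: if_splits)

definition irrep_family ::
    "'k set \<Rightarrow> ('k \<Rightarrow> (nat \<Rightarrow> 'k) set) \<Rightarrow> ('k \<Rightarrow> 'g \<Rightarrow> (nat \<Rightarrow> 'k) \<Rightarrow> (nat \<Rightarrow> 'k)) \<Rightarrow> bool" where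
  "irrep_family S W \<tau> \<longleftrightarrow> (\<forall>x\<in>S. lie_representation scale bracket (fixed_algebra \<sigma> x) coord_scale (W x) (\<tau> x) \<and>
     finite_dimensional coord_scale (W x) \<and> irreducible_rep (fixed_algebra \<sigma> x) coord_scale (W x) (\<tau> x))"

lemma irrep_familyD:
  assumes "irrep_family S W \<tau>" "x \<in> S"
  shows "lie_representation scale bracket (fixed_algebra \<sigma> x) coord_scale (W x) (\<tau> x)"
    and "finite_dimensional coord_scale (W x)"
    and "irreducible_rep (fixed_algebra \<sigma> x) coord_scale (W x) (\<tau> x)"
    and "coord.subspace (W x)"
  using assms lie_representationD(2) unfolding irrep_family_def by blast+

lemma evaluation_rep_family:
  assumes "irrep_family S W \<tau>" "finite S" "S \<subseteq> X_rat" "M \<subseteq> \<MM>"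
  shows "evaluation_rep S W scale bracket (fixed_algebra \<sigma>) \<tau> M"
proof
  show "\<alpha> x \<in> fixed_algebra \<sigma> x" if "\<alpha> \<in> M" "x \<in> S" for \<alpha> x
    using that assms map_algebra_value_fixed by blast
qed (use assms irrep_familyD in auto)

end

locale supported_map_rep = irreducible_map_rep scale bracket \<sigma> sV V \<rho>
  for scale :: "'k::{alg_closed_field, field_char_0} \<Rightarrow> 'g::ab_group_add \<Rightarrow> 'g" (infixr \<open>*s\<close> 75)
    and bracket :: "'g \<Rightarrow> 'g \<Rightarrow> 'g" and \<sigma> :: "'g \<Rightarrow> 'g" and sV :: "'k \<Rightarrow> 'v::ab_group_add \<Rightarrow> 'v"
    and V :: "'v set" and \<rho> :: "('k \<Rightarrow> 'g) \<Rightarrow> 'v \<Rightarrow> 'v" +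
  fixes X :: "'k set"
  assumes finite_X: "finite X" and X_rat: "X \<subseteq> X_rat" and inj_X: "inj_on (\<lambda>x. x + inverse x) X"
    and vanishing: "\<alpha> \<in> \<MM> \<Longrightarrow> (\<And>x. x \<in> X \<Longrightarrow> \<alpha> x = 0) \<Longrightarrow> v \<in> V \<Longrightarrow> \<rho> \<alpha> v = 0"
begin

lemma rep_eq:
  assumes \<alpha>: "\<alpha> \<in> \<MM>" and \<beta>: "\<beta> \<in> \<MM>" and eq: "\<And>x. x \<in> X \<Longrightarrow> \<alpha> x = \<beta> x" and v: "v \<in> V"
  shows "\<rho> \<alpha> v = \<rho> \<beta> v"
proof -
  have s: "fsc (- 1) \<beta> \<in> \<MM>" by (rule F.subspace_scale[OF subspace_\<MM> \<beta>])
  have "\<rho> (\<alpha> + fsc (- 1) \<beta>) v = 0"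
    by (rule vanishing[OF F.subspace_add[OF subspace_\<MM> \<alpha> s] _ v]) (simp add: eq fun_scale_def)
  then show ?thesis
    unfolding rep_add[OF \<alpha> s v] rep_scale[OF \<beta> v] by simp
qed

definition supported_maps :: "'k set \<Rightarrow> ('k \<Rightarrow> 'g) set" where
  "supported_maps S = {\<alpha> \<in> \<MM>. \<forall>x\<in>X - S. \<alpha> x = 0}"

lemma supported_maps_subset: "supported_maps S \<subseteq> \<MM>"
  by (auto simp: supported_maps_def)

definition lift :: "'k \<Rightarrow> 'g \<Rightarrow> 'k \<Rightarrow> 'g" where
  "lift x u = (SOME \<alpha>. \<alpha> \<in> \<MM> \<and> \<alpha> x = u \<and> (\<forall>y\<in>X - {x}. \<alpha> y = 0))"

lemma lift:
  assumes "x \<in> X" "u \<in> fixed_algebra \<sigma> x"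
  shows "lift x u \<in> \<MM>" "lift x u x = u" "\<And>y. y \<in> X \<Longrightarrow> y \<noteq> x \<Longrightarrow> lift x u y = 0"
    "lift x u \<in> supported_maps {x}"
proof -
  have "\<exists>\<alpha>. \<alpha> \<in> \<MM> \<and> \<alpha> x = u \<and> (\<forall>y\<in>X - {x}. \<alpha> y = 0)"
    using evaluation_surjective[OF finite_X X_rat inj_X assms] by blast
  from someI_ex[OF this] have *: "lift x u \<in> \<MM> \<and> lift x u x = u \<and> (\<forall>y\<in>X - {x}. lift x u y = 0)"
    unfolding lift_def .
  then show "lift x u \<in> \<MM>" "lift x u x = u" "\<And>y. y \<in> X \<Longrightarrow> y \<noteq> x \<Longrightarrow> lift x u y = 0"
    "lift x u \<in> supported_maps {x}" by (auto simp: supported_maps_def)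
qed

definition supported_hom :: "'k set \<Rightarrow> ('k \<Rightarrow> (nat \<Rightarrow> 'k) set) \<Rightarrow> ('k \<Rightarrow> 'g \<Rightarrow> (nat \<Rightarrow> 'k) \<Rightarrow> (nat \<Rightarrow> 'k)) \<Rightarrow>
    ((('k \<Rightarrow> nat) \<Rightarrow> 'k) \<Rightarrow> 'v) \<Rightarrow> bool" where
  "supported_hom S W \<tau> T \<longleftrightarrow> rep_hom (supported_maps S) coord_scale (tensor_space S W) (ev_rep S \<tau>) sV V \<rho> T"

lemma supported_homD:
  assumes "supported_hom S W \<tau> T"
  shows "\<And>w. w \<in> tensor_space S W \<Longrightarrow> T w \<in> V" and "linear_on coord_scale sV (tensor_space S W) T"
    and "\<And>\<alpha> w. \<alpha> \<in> supported_maps S \<Longrightarrow> w \<in> tensor_space S W \<Longrightarrow> T (ev_rep S \<tau> \<alpha> w) = \<rho> \<alpha> (T w)"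
  using assms unfolding supported_hom_def rep_hom_def by simp_all

lemma supported_homI:
  assumes "\<And>w. w \<in> tensor_space S W \<Longrightarrow> T w \<in> V" and "linear_on coord_scale sV (tensor_space S W) T"
    and "\<And>\<alpha> w. \<alpha> \<in> supported_maps S \<Longrightarrow> w \<in> tensor_space S W \<Longrightarrow> T (ev_rep S \<tau> \<alpha> w) = \<rho> \<alpha> (T w)"
  shows "supported_hom S W \<tau> T"
  using assms unfolding supported_hom_def rep_hom_def by simp

lemma tensor_irreducible_supported_maps:
  assumes fam: "irrep_family S W \<tau>" and S: "S \<subseteq> X"
  shows "irreducible_rep (supported_maps S) coord_scale (tensor_space S W) (ev_rep S \<tau>)"
proof -
  have finS: "finite S" using S finite_X finite_subset by blast
  interpret E: evaluation_rep S W scale bracket "fixed_algebra \<sigma>" \<tau> "supported_maps S"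
    by (rule evaluation_rep_family[OF fam finS _ supported_maps_subset]) (use S X_rat in auto)
  show ?thesis
  proof (rule E.ev_rep_irreducible)
    fix x u assume x: "x \<in> S" and u: "u \<in> fixed_algebra \<sigma> x"
    then have xX: "x \<in> X" using S by auto
    show "\<exists>\<alpha>\<in>supported_maps S. \<alpha> x = u \<and> (\<forall>y\<in>S - {x}. \<alpha> y = 0)"
      using lift[OF xX u] S x by (intro bexI[of _ "lift x u"]) (auto simp: supported_maps_def)
  qed (use irrep_familyD[OF fam] in auto)
qed

lemma hom_unique:
  assumes fam: "irrep_family S W \<tau>" and S: "S \<subseteq> X" and T: "supported_hom S W \<tau> T" and T': "supported_hom S W \<tau> T'"
    and w0: "w0 \<in> tensor_space S W" "w0 \<noteq> 0" "T w0 = T' w0" and w: "w \<in> tensor_space S W"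
  shows "T w = T' w"
proof -
  have finS: "finite S" using S finite_X finite_subset by blast
  interpret E: evaluation_rep S W scale bracket "fixed_algebra \<sigma>" \<tau> "supported_maps S"
    by (rule evaluation_rep_family[OF fam finS _ supported_maps_subset]) (use S X_rat in auto)
  note lin = supported_homD(2)[OF T] supported_homD(2)[OF T']
  let ?K = "{w \<in> tensor_space S W. T w = T' w}"
  have "coord.subspace ?K"
    unfolding coord.subspace_def
  proof (intro conjI ballI allI)
    show "0 \<in> ?K"
      using coord.subspace_0[OF E.subspace_TS] linear_on_0[OF vector_space_coord_scale E.subspace_TS lin(1)]
        linear_on_0[OF vector_space_coord_scale E.subspace_TS lin(2)] by (simp only: mem_Collect_eq)
    show "u + v \<in> ?K" if "u \<in> ?K" "v \<in> ?K" for u v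
      using that coord.subspace_add[OF E.subspace_TS, of u v] linear_on_add[OF lin(1), of u v]
        linear_on_add[OF lin(2), of u v] by (simp only: mem_Collect_eq)
    show "coord_scale c u \<in> ?K" if "u \<in> ?K" for c u
      using that coord.subspace_scale[OF E.subspace_TS, of u c] linear_on_scale[OF lin(1), of u c]
        linear_on_scale[OF lin(2), of u c] by (simp only: mem_Collect_eq)
  qed
  moreover have "ev_rep S \<tau> \<alpha> u \<in> ?K" if "\<alpha> \<in> supported_maps S" "u \<in> ?K" for \<alpha> u
    using that lie_representationD(3)[OF E.ev_rep_lie_representation] supported_homD(3)[OF T] supported_homD(3)[OF T'] by auto
  ultimately have "?K = {0} \<or> ?K = tensor_space S W"
    using conjunct2[OF tensor_irreducible_supported_maps[OF fam S, unfolded irreducible_rep_def], rule_format, of ?K]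
    by auto
  moreover have "w0 \<in> ?K" using w0 by simp
  ultimately have "?K = tensor_space S W" using w0(2) by auto
  then show ?thesis using w by auto
qed

lemma hom_add:
  assumes T: "supported_hom S W \<tau> T" and T': "supported_hom S W \<tau> T'"
  shows "supported_hom S W \<tau> (\<lambda>w. T w + T' w)"
  using supported_homD[OF T] supported_homD[OF T'] supported_maps_subset V.subspace_add[OF subspace_V]
    V.operator_on_add[OF rep_operator]
  by (intro supported_homI) (auto simp: linear_on_def V.scale_right_distrib ac_simps subset_iff)

lemma hom_scale:
  assumes T: "supported_hom S W \<tau> T"
  shows "supported_hom S W \<tau> (\<lambda>w. sV c (T w))"
  using supported_homD[OF T] supported_maps_subset V.subspace_scale[OF subspace_V] V.operator_on_scale[OF rep_operator]
  by (intro supported_homI) (auto simp: linear_on_def V.scale_right_distrib mult.commute subset_iff)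

lemma hom_compose:
  assumes T: "supported_hom S W \<tau> T" and \<alpha>: "\<alpha> \<in> \<MM>" "\<And>y. y \<in> S \<Longrightarrow> \<alpha> y = 0"
  shows "supported_hom S W \<tau> (\<lambda>w. \<rho> \<alpha> (T w))"
proof (rule supported_homI)
  show "\<rho> \<alpha> (T w) \<in> V" if "w \<in> tensor_space S W" for w
    using supported_homD(1)[OF T that] rep_closed \<alpha> by blast
  show "linear_on coord_scale sV (tensor_space S W) (\<lambda>w. \<rho> \<alpha> (T w))"
    using supported_homD(1,2)[OF T] V.operator_on_add[OF rep_operator[OF \<alpha>(1)]] V.operator_on_scale[OF rep_operator[OF \<alpha>(1)]]
    by (simp add: linear_on_def)
  fix \<beta> w assume \<beta>: "\<beta> \<in> supported_maps S" and w: "w \<in> tensor_space S W"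
  have \<beta>M: "\<beta> \<in> \<MM>" using \<beta> supported_maps_subset by auto
  have "\<rho> (fbr \<alpha> \<beta>) (T w) = 0"
  proof (rule vanishing[OF bracket_\<MM>[OF \<alpha>(1) \<beta>M] _ supported_homD(1)[OF T w]])
    fix x assume "x \<in> X"
    then show "fbr \<alpha> \<beta> x = 0"
      using \<alpha>(2)[of x] \<beta> by (cases "x \<in> S") (auto simp: fun_bracket_def supported_maps_def)
  qed
  then have "\<rho> \<alpha> (\<rho> \<beta> (T w)) = \<rho> \<beta> (\<rho> \<alpha> (T w))"
    using rep_bracket[OF \<alpha>(1) \<beta>M supported_homD(1)[OF T w]] by simp
  then show "\<rho> \<alpha> (T (ev_rep S \<tau> \<beta> w)) = \<rho> \<beta> (\<rho> \<alpha> (T w))"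
    by (simp only: supported_homD(3)[OF T \<beta> w])
qed

text \<open>Modulo the maps that vanish on \<open>X\<close>, the maps supported at \<open>x\<close> form a copy of \<open>\<gg>\<^sup>x\<close>; so subspaces
  stable under them are representations of \<open>\<gg>\<^sup>x\<close>.\<close>

lemma local_representation:
  assumes x: "x \<in> X" and U: "V.subspace U" "U \<subseteq> V" "\<And>\<alpha> u. \<alpha> \<in> supported_maps {x} \<Longrightarrow> u \<in> U \<Longrightarrow> \<rho> \<alpha> u \<in> U"
  shows "lie_representation scale bracket (fixed_algebra \<sigma> x) sV U (\<lambda>u. \<rho> (lift x u))"
proof -
  note L = lift[OF x]
  note fixed = fixed_algebra_closed[where x = x]
  show ?thesis
  proof (rule lie_representationI[OF V.vector_space_axioms U(1)])
    show "\<rho> (lift x a) v \<in> U" if "a \<in> fixed_algebra \<sigma> x" "v \<in> U" for a v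
      using that U(3) L(4) by blast
    show "linear_on sV sV U (\<rho> (lift x a))" if "a \<in> fixed_algebra \<sigma> x" for a
      using linear_on_subset[OF V.operator_on_linear[OF rep_operator[OF L(1)[OF that]]] U(2)] .
    fix a b v assume a: "a \<in> fixed_algebra \<sigma> x" and v: "v \<in> U"
    have vV: "v \<in> V" using v U(2) by auto
    show "\<rho> (lift x (c *s a)) v = sV c (\<rho> (lift x a) v)" for c
      unfolding rep_scale[OF L(1)[OF a] vV, symmetric]
    proof (rule rep_eq[OF L(1)[OF fixed(2)[OF a a]] F.subspace_scale[OF subspace_\<MM> L(1)[OF a]] _ vV])
      fix y assume "y \<in> X"
      then show "lift x (c *s a) y = fsc c (lift x a) y"
        using L[OF a] L[OF fixed(2)[OF a a]] by (cases "y = x") (simp_all add: fun_scale_def)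
    qed
    assume b: "b \<in> fixed_algebra \<sigma> x"
    show "\<rho> (lift x (a + b)) v = \<rho> (lift x a) v + \<rho> (lift x b) v"
      unfolding rep_add[OF L(1)[OF a] L(1)[OF b] vV, symmetric]
    proof (rule rep_eq[OF L(1)[OF fixed(1)[OF a b]] F.subspace_add[OF subspace_\<MM> L(1)[OF a] L(1)[OF b]] _ vV])
      fix y assume "y \<in> X"
      then show "lift x (a + b) y = (lift x a + lift x b) y"
        using L[OF a] L[OF b] L[OF fixed(1)[OF a b]] by (cases "y = x") simp_all
    qed
    show "\<rho> (lift x (bracket a b)) v = \<rho> (lift x a) (\<rho> (lift x b) v) - \<rho> (lift x b) (\<rho> (lift x a) v)"
      unfolding rep_bracket[OF L(1)[OF a] L(1)[OF b] vV, symmetric]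
    proof (rule rep_eq[OF L(1)[OF fixed(3)[OF a b]] bracket_\<MM>[OF L(1)[OF a] L(1)[OF b]] _ vV])
      fix y assume "y \<in> X"
      then show "lift x (bracket a b) y = fbr (lift x a) (lift x b) y"
        using L[OF a] L[OF b] L[OF fixed(3)[OF a b]] by (cases "y = x") (simp_all add: fun_bracket_def)
    qed
  qed
qed

text \<open>Given a nonzero homomorphism on the tensor product over \<open>S\<close>, the values at a fixed tensor \<open>w0\<close> of all
  such homomorphisms form a representation of \<open>\<gg>\<^sup>x\<close>, since the maps supported at \<open>x\<close> commute with those
  supported in \<open>S\<close>.  An irreducible subrepresentation \<open>U\<close> is the tensor factor at \<open>x\<close>: the
  homomorphism with value \<open>u \<in> U\<close> at \<open>w0\<close> is unique, hence depends linearly and equivariantly on \<open>u\<close>.\<close>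

lemma tensor_hom_extend:
  assumes S: "S \<subseteq> X" and x: "x \<in> X" "x \<notin> S" and fam: "irrep_family S W \<tau>"
    and T0: "supported_hom S W \<tau> T0" and w0: "w0 \<in> tensor_space S W" "T0 w0 \<noteq> 0"
  shows "\<exists>W' \<tau>' T'. irrep_family (insert x S) W' \<tau>' \<and> supported_hom (insert x S) W' \<tau>' T' \<and>
    (\<exists>w\<in>tensor_space (insert x S) W'. T' w \<noteq> 0)"
proof -
  have finS: "finite S" using S finite_X finite_subset by blast
  interpret E: evaluation_rep S W scale bracket "fixed_algebra \<sigma>" \<tau> \<MM>
    by (rule evaluation_rep_family[OF fam finS _ order_refl]) (use S X_rat in auto)
  have w0_nz: "w0 \<noteq> 0"
    using w0(2) linear_on_0[OF vector_space_coord_scale E.subspace_TS supported_homD(2)[OF T0]] by auto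
  (* Evaluation at w0 is injective on these homomorphisms, because the source is irreducible.  So H is a
     copy of their space, on which the algebra at x acts by composition. *)
  let ?H = "{u \<in> V. \<exists>T. supported_hom S W \<tau> T \<and> T w0 = u}"
  have "V.subspace ?H"
    unfolding V.subspace_def
  proof (intro conjI ballI allI)
    have "supported_hom S W \<tau> (\<lambda>w. sV 0 (T0 w))" by (rule hom_scale[OF T0])
    then show "0 \<in> ?H" using V.subspace_0[OF subspace_V] by auto
  next
    fix u v assume "u \<in> ?H" "v \<in> ?H"
    then obtain T T' where TT: "supported_hom S W \<tau> T" "T w0 = u" "supported_hom S W \<tau> T'" "T' w0 = v" "u \<in> V" "v \<in> V" by auto
    then show "u + v \<in> ?H" using hom_add[OF TT(1,3)] V.subspace_add[OF subspace_V] by auto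
  next
    fix c u assume "u \<in> ?H"
    then obtain T where TT: "supported_hom S W \<tau> T" "T w0 = u" "u \<in> V" by auto
    then show "sV c u \<in> ?H" using hom_scale[OF TT(1), of c] V.subspace_scale[OF subspace_V] by auto
  qed
  moreover have "\<rho> \<alpha> u \<in> ?H" if \<alpha>: "\<alpha> \<in> supported_maps {x}" and u: "u \<in> ?H" for \<alpha> u
  proof -
    obtain T where TT: "supported_hom S W \<tau> T" "T w0 = u" "u \<in> V" using u by auto
    have \<alpha>M: "\<alpha> \<in> \<MM>" using \<alpha> supported_maps_subset by auto
    have "\<alpha> y = 0" if "y \<in> S" for y using \<alpha> that S x by (auto simp: supported_maps_def)
    from hom_compose[OF TT(1) \<alpha>M this] show ?thesis using TT rep_closed[OF \<alpha>M] by auto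
  qed
  ultimately have H_inv: "V.invariant (\<rho> ` supported_maps {x}) ?H" by (auto simp: V.invariant_def)
  have fdH: "finite_dimensional sV ?H"
    by (rule V.finite_dimensional_subset[OF fd]) (use H_inv in \<open>auto simp: V.invariant_def\<close>)
  have "?H \<noteq> {0}" using T0 w0 supported_homD(1)[OF T0 w0(1)] by blast
  then obtain U where U: "U \<subseteq> ?H" "V.invariant (\<rho> ` supported_maps {x}) U" "V.irreducible (\<rho> ` supported_maps {x}) U"
    by (rule V.exists_irreducible_subspace[OF fdH H_inv])
  have subU: "V.subspace U" and UV: "U \<subseteq> V" and stable: "\<And>\<alpha> u. \<alpha> \<in> supported_maps {x} \<Longrightarrow> u \<in> U \<Longrightarrow> \<rho> \<alpha> u \<in> U"
    using U by (auto simp: V.invariant_def)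
  let ?L = "fixed_algebra \<sigma> x" and ?\<pi> = "\<lambda>u. \<rho> (lift x u)"
  have repU: "lie_representation scale bracket ?L sV U ?\<pi>"
    by (rule local_representation[OF x(1) subU UV stable])
  have fdU: "finite_dimensional sV U" by (rule V.finite_dimensional_subset[OF fd subU UV])
  have irrU: "irreducible_rep ?L sV U ?\<pi>"
    unfolding irreducible_rep_def
  proof (intro conjI allI impI)
    show "U \<noteq> {0}" using U(3) by (simp add: V.irreducible_def)
    fix U' assume U': "V.subspace U' \<and> U' \<subseteq> U \<and> (\<forall>a\<in>?L. \<forall>u\<in>U'. ?\<pi> a u \<in> U')"
    have "\<rho> \<alpha> u \<in> U'" if \<alpha>: "\<alpha> \<in> supported_maps {x}" and u: "u \<in> U'" for \<alpha> u
    proof -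
      have \<alpha>M: "\<alpha> \<in> \<MM>" using \<alpha> supported_maps_subset by auto
      have \<alpha>x: "\<alpha> x \<in> ?L" using map_algebra_value_fixed[OF \<alpha>M] x X_rat by auto
      have "\<rho> \<alpha> u = ?\<pi> (\<alpha> x) u"
      proof (rule rep_eq[OF \<alpha>M lift(1)[OF x(1) \<alpha>x]])
        show "\<alpha> y = lift x (\<alpha> x) y" if "y \<in> X" for y
          using lift[OF x(1) \<alpha>x] \<alpha> that by (cases "y = x") (auto simp: supported_maps_def)
      qed (use u U' UV in auto)
      then show ?thesis using U' u \<alpha>x by simp
    qed
    then have "V.invariant (\<rho> ` supported_maps {x}) U'" using U' by (auto simp: V.invariant_def)
    then show "U' = {0} \<or> U' = U" using U(3) U' by (auto simp: V.irreducible_def)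
  qed
  obtain Wx :: "(nat \<Rightarrow> 'k) set" and \<tau>x where Wx: "lie_representation scale bracket ?L coord_scale Wx \<tau>x"
    "finite_dimensional coord_scale Wx" "rep_iso ?L sV U ?\<pi> coord_scale Wx \<tau>x"
    by (rule rep_model_exists[OF repU fdU])
  have irrWx: "irreducible_rep ?L coord_scale Wx \<tau>x" by (rule rep_iso_irreducible[OF repU Wx(1) irrU Wx(3)])
  obtain \<theta> where \<theta>: "rep_hom ?L coord_scale Wx \<tau>x sV U ?\<pi> \<theta>" "bij_betw \<theta> Wx U"
    using rep_iso_sym[OF repU Wx(3)] unfolding rep_iso_iff_hom by auto
  have \<theta>_lin: "linear_on coord_scale sV Wx \<theta>" and \<theta>_U: "\<And>w. w \<in> Wx \<Longrightarrow> \<theta> w \<in> U"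
    and \<theta>_eq: "\<And>a w. a \<in> ?L \<Longrightarrow> w \<in> Wx \<Longrightarrow> \<theta> (\<tau>x a w) = ?\<pi> a (\<theta> w)"
    using \<theta>(1) by (auto simp: rep_hom_def)
  have subWx: "coord.subspace Wx" by (rule lie_representationD(2)[OF Wx(1)])
  have "\<forall>u\<in>U. \<exists>T. supported_hom S W \<tau> T \<and> T w0 = u" using U(1) by auto
  from bchoice[OF this] obtain Tu where Tu: "\<And>u. u \<in> U \<Longrightarrow> supported_hom S W \<tau> (Tu u)" "\<And>u. u \<in> U \<Longrightarrow> Tu u w0 = u" by auto
  note uniq = hom_unique[OF fam S _ _ w0(1) w0_nz]
  have Tu_add: "Tu (u + v) w = Tu u w + Tu v w" if "u \<in> U" "v \<in> U" "w \<in> tensor_space S W" for u v w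
    by (rule uniq[OF Tu(1)[OF V.subspace_add[OF subU]] hom_add[OF Tu(1) Tu(1)]])
      (use that Tu(2) V.subspace_add[OF subU] in simp_all)
  have Tu_scale: "Tu (sV c u) w = sV c (Tu u w)" if "u \<in> U" "w \<in> tensor_space S W" for c u w
    by (rule uniq[OF Tu(1)[OF V.subspace_scale[OF subU]] hom_scale[OF Tu(1)]])
      (use that Tu(2) V.subspace_scale[OF subU] in simp_all)
  have Tu_\<pi>: "Tu (?\<pi> a u) w = \<rho> (lift x a) (Tu u w)"
    if u: "u \<in> U" and a: "a \<in> ?L" and w: "w \<in> tensor_space S W" for a u w
  proof -
    have \<pi>u: "?\<pi> a u \<in> U" by (rule lie_representationD(3)[OF repU a u])
    have "lift x a y = 0" if "y \<in> S" for y using lift(3)[OF x(1) a, of y] that S x by auto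
    note h = hom_compose[OF Tu(1)[OF u] lift(1)[OF x(1) a] this]
    show ?thesis by (rule uniq[OF Tu(1)[OF \<pi>u] h]) (simp_all add: Tu(2) u \<pi>u w)
  qed
  define W' where "W' = W(x := Wx)"
  define \<tau>' where "\<tau>' = \<tau>(x := \<tau>x)"
  let ?S = "insert x S"
  have W'S: "W' y = W y" "\<tau>' y = \<tau> y" if "y \<in> S" for y using that x by (auto simp: W'_def \<tau>'_def)
  have W'x: "W' x = Wx" "\<tau>' x = \<tau>x" by (simp_all add: W'_def \<tau>'_def)
  have fam': "irrep_family ?S W' \<tau>'"
    unfolding irrep_family_def
  proof
    fix y assume "y \<in> ?S"
    then show "lie_representation scale bracket (fixed_algebra \<sigma> y) coord_scale (W' y) (\<tau>' y) \<and>
        finite_dimensional coord_scale (W' y) \<and> irreducible_rep (fixed_algebra \<sigma> y) coord_scale (W' y) (\<tau>' y)"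
      using Wx(1,2) irrWx irrep_familyD[OF fam, of y] W'S[of y] W'x by (cases "y = x") auto
  qed
  interpret E': evaluation_rep ?S W' scale bracket "fixed_algebra \<sigma>" \<tau>' "supported_maps ?S"
    by (rule evaluation_rep_family[OF fam' _ _ supported_maps_subset]) (use finS S x X_rat in auto)
  (* The extension sends the tensor of u and p to Tu u p. *)
  define m where "m v = Tu (\<theta> (v x)) (pure_tensor S v)" for v
  have pure_S: "pure_tensor S v \<in> tensor_space S W" if "\<And>y. y \<in> ?S \<Longrightarrow> v y \<in> W' y" for v
    by (rule E.pure_tensor_in_TS) (use that W'S in auto)
  have pure_cong: "pure_tensor S v = pure_tensor S v'" if "\<And>y. y \<in> S \<Longrightarrow> v y = v' y" for v v' :: "'k \<Rightarrow> nat \<Rightarrow> 'k"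
    by (rule multilinear_on_cong[OF multilinear_pure_tensor[OF finS]]) (rule that)
  have m_mult: "multilinear_on ?S W' sV m"
    unfolding multilinear_on_def
  proof (intro conjI allI impI)
    fix v y assume vy: "(\<forall>y\<in>?S. v y \<in> W' y) \<and> y \<in> ?S"
    then have v: "\<And>y. y \<in> ?S \<Longrightarrow> v y \<in> W' y" by auto
    have \<theta>v: "\<theta> (v x) \<in> U" using v[of x] W'x \<theta>_U by simp
    show "linear_on coord_scale sV (W' y) (\<lambda>u. m (v(y := u)))"
    proof (cases "y = x")
      case True
      have "pure_tensor S (v(x := u)) = pure_tensor S v" for u by (rule pure_cong) (use x in auto)
      then have "(\<lambda>u. m (v(y := u))) = (\<lambda>u. Tu (\<theta> u) (pure_tensor S v))" by (simp add: m_def True)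
      moreover have "linear_on coord_scale sV Wx (\<lambda>u. Tu (\<theta> u) (pure_tensor S v))"
        using \<theta>_U pure_S[OF v] unfolding linear_on_def
        by (simp add: linear_on_add[OF \<theta>_lin] linear_on_scale[OF \<theta>_lin] Tu_add Tu_scale)
      ultimately show ?thesis using True W'x by simp
    next
      case False
      then have y: "y \<in> S" using vy by auto
      have "linear_on coord_scale coord_scale (W y) (\<lambda>u. pure_tensor S (v(y := u)))"
        by (rule multilinear_on_linear[OF multilinear_pure_tensor[OF finS] _ y, of v W]) (use v W'S in auto)
      moreover have "pure_tensor S (v(y := u)) \<in> tensor_space S W" if "u \<in> W y" for u
        by (rule E.pure_tensor_in_TS) (use v W'S that in auto)
      moreover note lin = supported_homD(2)[OF Tu(1)[OF \<theta>v]]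
      ultimately have "linear_on coord_scale sV (W y) (\<lambda>u. Tu (\<theta> (v x)) (pure_tensor S (v(y := u))))"
        unfolding linear_on_def[of _ _ "W y"] by (simp add: linear_on_add[OF lin] linear_on_scale[OF lin])
      then show ?thesis using False W'S[OF y] by (simp add: m_def)
    qed
  next
    fix v v' :: "'k \<Rightarrow> nat \<Rightarrow> 'k" assume eq: "\<forall>y\<in>?S. v y = v' y"
    then have "pure_tensor S v = pure_tensor S v'" by (intro pure_cong) auto
    then show "m v = m v'" using eq by (simp add: m_def)
  qed
  have m_V: "m v \<in> V" if "\<And>y. y \<in> ?S \<Longrightarrow> v y \<in> W' y" for v
    unfolding m_def by (rule supported_homD(1)[OF Tu(1) pure_S[OF that]]) (use that[of x] W'x \<theta>_U in simp)
  have m_eq: "(\<Sum>y\<in>?S. m (v(y := \<tau>' y (\<alpha> y) (v y)))) = \<rho> \<alpha> (m v)"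
    if \<alpha>: "\<alpha> \<in> supported_maps ?S" and v: "\<And>y. y \<in> ?S \<Longrightarrow> v y \<in> W' y" for \<alpha> v
  proof -
    have \<alpha>M: "\<alpha> \<in> \<MM>" using \<alpha> supported_maps_subset by auto
    have \<alpha>y: "\<alpha> y \<in> fixed_algebra \<sigma> y" if "y \<in> ?S" for y
      using map_algebra_value_fixed[OF \<alpha>M, of y] that S x X_rat by auto
    have vx: "v x \<in> Wx" using v[of x] W'x by simp
    define u where "u = \<theta> (v x)"
    have u: "u \<in> U" unfolding u_def by (rule \<theta>_U[OF vx])
    let ?p = "pure_tensor S v"
    have p: "?p \<in> tensor_space S W" by (rule pure_S[OF v])
    have upd: "(v(y := \<tau>' y (\<alpha> y) (v y))) z \<in> W' z" if "y \<in> ?S" "z \<in> ?S" for y z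
      using v that lie_representationD(3)[OF irrep_familyD(1)[OF fam' that(1)] \<alpha>y[OF that(1)]] by auto
    have "(\<Sum>y\<in>?S. m (v(y := \<tau>' y (\<alpha> y) (v y)))) =
        m (v(x := \<tau>x (\<alpha> x) (v x))) + (\<Sum>y\<in>S. m (v(y := \<tau> y (\<alpha> y) (v y))))"
    proof -
      have "(\<Sum>y\<in>S. m (v(y := \<tau>' y (\<alpha> y) (v y)))) = (\<Sum>y\<in>S. m (v(y := \<tau> y (\<alpha> y) (v y))))"
        by (intro sum.cong refl) (simp only: W'S)
      then show ?thesis by (simp only: sum.insert[OF finS x(2)] W'x)
    qed
    also have "m (v(x := \<tau>x (\<alpha> x) (v x))) = \<rho> (lift x (\<alpha> x)) (Tu u ?p)"
    proof -
      have "pure_tensor S (v(x := \<tau>x (\<alpha> x) (v x))) = ?p" by (rule pure_cong) (use x in auto)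
      then show ?thesis
        using Tu_\<pi>[OF u \<alpha>y p] \<theta>_eq[OF \<alpha>y vx] by (simp add: m_def u_def)
    qed
    also have "(\<Sum>y\<in>S. m (v(y := \<tau> y (\<alpha> y) (v y)))) = (\<Sum>y\<in>S. Tu u (pure_tensor S (v(y := \<tau> y (\<alpha> y) (v y)))))"
      using x by (intro sum.cong refl) (auto simp: m_def u_def)
    also have "\<dots> = Tu u (ev_rep S \<tau> \<alpha> ?p)"
    proof -
      have evS: "ev_rep S \<tau> \<alpha> ?p = (\<Sum>y\<in>S. pure_tensor S (v(y := \<tau> y (\<alpha> y) (v y))))"
        by (rule E.ev_rep_pure_tensor[OF \<alpha>M]) (use v W'S in auto)
      have "pure_tensor S (v(y := \<tau> y (\<alpha> y) (v y))) \<in> tensor_space S W" if "y \<in> S" for y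
        using upd[of y] that W'S by (intro pure_S) auto
      then show ?thesis
        unfolding evS
        by (intro linear_on_sum[OF vector_space_coord_scale E.subspace_TS supported_homD(2)[OF Tu(1)[OF u]], symmetric])
    qed
    (* Modulo the maps that vanish on X, alpha is the sum of a map supported at x and one supported in S.
       On S the second summand has the values of alpha, and Tu u is equivariant for it. *)
    also have "\<dots> = \<rho> (\<alpha> + fsc (- 1) (lift x (\<alpha> x))) (Tu u ?p)"
    proof -
      let ?\<beta> = "\<alpha> + fsc (- 1) (lift x (\<alpha> x))"
      note l = lift[OF x(1) \<alpha>y[OF insertI1]]
      have "?\<beta> \<in> \<MM>" by (intro F.subspace_add[OF subspace_\<MM>] F.subspace_scale[OF subspace_\<MM>] \<alpha>M l(1))
      moreover have "?\<beta> y = 0" if "y \<in> X - S" for y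
        using that \<alpha> l by (cases "y = x") (auto simp: fun_scale_def supported_maps_def)
      ultimately have "?\<beta> \<in> supported_maps S" by (simp only: supported_maps_def) blast
      moreover have "ev_rep S \<tau> \<alpha> ?p = ev_rep S \<tau> ?\<beta> ?p"
        unfolding ev_rep_slot
      proof (intro sum.cong refl)
        fix y assume y: "y \<in> S"
        then have "?\<beta> y = \<alpha> y" using l(3)[of y] S x by (auto simp: fun_scale_def)
        then show "slot S y (\<tau> y (\<alpha> y)) ?p = slot S y (\<tau> y (?\<beta> y)) ?p" by (simp only:)
      qed
      ultimately show ?thesis using supported_homD(3)[OF Tu(1)[OF u] _ p] by (simp only:)
    qed
    also have "\<rho> (lift x (\<alpha> x)) (Tu u ?p) + \<rho> (\<alpha> + fsc (- 1) (lift x (\<alpha> x))) (Tu u ?p) = \<rho> \<alpha> (Tu u ?p)"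
    proof -
      note l = lift(1)[OF x(1) \<alpha>y[OF insertI1]]
      have Tp: "Tu u ?p \<in> V" by (rule supported_homD(1)[OF Tu(1)[OF u] p])
      show ?thesis
        unfolding rep_add[OF \<alpha>M F.subspace_scale[OF subspace_\<MM> l] Tp] rep_scale[OF l Tp] by simp
    qed
    also have "Tu u ?p = m v" by (simp add: m_def u_def)
    finally show ?thesis .
  qed
  obtain T' where hom': "supported_hom ?S W' \<tau>' T'"
    and T'_pure: "\<And>v. (\<And>y. y \<in> ?S \<Longrightarrow> v y \<in> W' y) \<Longrightarrow> T' (pure_tensor ?S v) = m v"
    using E'.multilinear_hom[OF irrep_familyD(2)[OF fam'] lie_representation_subset[OF rep supported_maps_subset]
        m_mult m_V m_eq] unfolding supported_hom_def by auto
  obtain u where u: "u \<in> U" "u \<noteq> 0" using U(3) V.subspace_0[OF subU] by (auto simp: V.irreducible_def)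
  obtain a where a: "a \<in> Wx" "\<theta> a = u" using \<theta>(2) u(1) by (auto simp: bij_betw_def)
  (* Otherwise Tu u would vanish on the span of the pure tensors, which contains w0; but its value there is u. *)
  have "\<exists>v. (\<forall>y\<in>S. v y \<in> W y) \<and> Tu u (pure_tensor S v) \<noteq> 0"
  proof (rule ccontr)
    assume neg: "\<not> ?thesis"
    have "Tu u w0 = (\<lambda>_. 0) w0"
    proof (rule E.TS_eqI[where g = "\<lambda>_. 0", OF V.vector_space_axioms supported_homD(2)[OF Tu(1)[OF u(1)]] _ _ w0(1)])
      show "linear_on coord_scale sV E.TS (\<lambda>_. 0)" by (simp add: linear_on_def)
    qed (use neg in auto)
    then show False using Tu(2)[OF u(1)] u(2) by simp
  qed
  then obtain v where v: "\<And>y. y \<in> S \<Longrightarrow> v y \<in> W y" "Tu u (pure_tensor S v) \<noteq> 0" by auto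
  let ?v = "v(x := a)"
  have v': "?v y \<in> W' y" if "y \<in> ?S" for y using that v(1) a W'S W'x x by auto
  have "pure_tensor S ?v = pure_tensor S v" by (rule pure_cong) (use x in auto)
  moreover have "T' (pure_tensor ?S ?v) = m ?v" by (rule T'_pure[OF v'])
  moreover have "m ?v = Tu u (pure_tensor S ?v)" unfolding m_def using a by simp
  ultimately have "T' (pure_tensor ?S ?v) \<noteq> 0" using v(2) by (simp only:) simp
  moreover have "pure_tensor ?S ?v \<in> E'.TS" by (rule E'.pure_tensor_in_TS[OF v'])
  ultimately show ?thesis using fam' hom' by blast
qed

text \<open>Extend a nonzero homomorphism one tensor factor at a time until it is defined over all of \<open>X\<close>; it is
  then an isomorphism by Schur's lemma.\<close>

theorem iso_tensor_product:
  "\<exists>W \<tau>. irrep_family X W \<tau> \<and> rep_iso \<MM> sV V \<rho> coord_scale (tensor_space X W) (ev_rep X \<tau>)"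
proof -
  have "\<exists>W \<tau> T. irrep_family S W \<tau> \<and> supported_hom S W \<tau> T \<and> (\<exists>w\<in>tensor_space S W. T w \<noteq> 0)"
    if "finite S" "S \<subseteq> X" for S
    using that
  proof (induction S)
    case empty
    (* The tensor product over the empty set is the space of functions on the single multi-index
       that is constantly undefined. *)
    obtain v0 where v0: "v0 \<in> V" "v0 \<noteq> 0"
      using irreducible_rep_nonzero[OF rep irr] by auto
    define T :: "(('k \<Rightarrow> nat) \<Rightarrow> 'k) \<Rightarrow> 'v" where "T w = sV (w (\<lambda>_. undefined)) v0" for w
    define W :: "'k \<Rightarrow> (nat \<Rightarrow> 'k) set" where "W = (\<lambda>_. UNIV)"
    define \<tau> :: "'k \<Rightarrow> 'g \<Rightarrow> (nat \<Rightarrow> 'k) \<Rightarrow> (nat \<Rightarrow> 'k)" where "\<tau> = (\<lambda>_ _ v. v)"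
    have "irrep_family {} W \<tau>" by (simp add: irrep_family_def)
    moreover have "supported_hom {} W \<tau> T"
    proof (rule supported_homI)
      show "T w \<in> V" for w using v0 by (simp add: T_def V.subspace_scale[OF subspace_V])
      show "linear_on coord_scale sV (tensor_space {} W) T"
        by (simp add: linear_on_def T_def V.scale_left_distrib fun_scale_def)
      show "T (ev_rep {} \<tau> \<alpha> w) = \<rho> \<alpha> (T w)" if \<alpha>: "\<alpha> \<in> supported_maps {}" for \<alpha> w
        using vanishing[of \<alpha> "T w"] \<alpha> v0
        by (simp add: ev_rep_slot T_def supported_maps_def V.subspace_scale[OF subspace_V])
    qed
    moreover have "pure_tensor {} v \<in> tensor_space {} W" for v
      unfolding tensor_space_def by (rule coord.span_base) auto
    moreover have "T (pure_tensor {} v) \<noteq> 0" for v using v0 by (simp add: T_def pure_tensor_def)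
    ultimately show ?case by blast
  next
    case (insert x S)
    then have S: "S \<subseteq> X" and x: "x \<in> X" by auto
    obtain W \<tau> T w where "irrep_family S W \<tau>" "supported_hom S W \<tau> T" "w \<in> tensor_space S W" "T w \<noteq> 0"
      using insert.IH[OF S] by auto
    then show ?case by (rule tensor_hom_extend[OF S x insert.hyps(2)])
  qed
  from this[OF finite_X order_refl] obtain W \<tau> T w where W: "irrep_family X W \<tau>" "supported_hom X W \<tau> T"
    and w: "w \<in> tensor_space X W" "T w \<noteq> 0" by auto
  interpret E: evaluation_rep X W scale bracket "fixed_algebra \<sigma>" \<tau> \<MM>
    by (rule evaluation_rep_family[OF W(1) finite_X X_rat order_refl])
  have MX: "supported_maps X = \<MM>" by (auto simp: supported_maps_def)
  have "rep_iso \<MM> coord_scale (tensor_space X W) (ev_rep X \<tau>) sV V \<rho>"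
    by (rule irreducible_rep_hom_iso[where T = T, OF E.ev_rep_lie_representation rep
          tensor_irreducible_supported_maps[OF W(1) order_refl, unfolded MX] irr _ w])
      (use W(2) in \<open>simp add: supported_hom_def MX\<close>)
  then have "rep_iso \<MM> sV V \<rho> coord_scale (tensor_space X W) (ev_rep X \<tau>)"
    by (rule rep_iso_sym[OF E.ev_rep_lie_representation])
  then show ?thesis using W(1) by blast
qed

end

section \<open>Isomorphism classes of representations\<close>

lemma rep_class_self:
  "lie_representation sL bL L coord_scale V \<rho> \<Longrightarrow> (V, \<rho>) \<in> rep_class sL bL L coord_scale V \<rho>"
  unfolding rep_class_def using rep_iso_refl by blast

lemma rep_class_eqI:
  assumes V: "lie_representation sL bL L sV V \<rho>" and iso: "rep_iso L sV V \<rho> sW W \<tau>"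
  shows "rep_class sL bL L sV V \<rho> = rep_class sL bL L sW W \<tau>"
  unfolding rep_class_def
  using rep_iso_trans[OF rep_iso_sym[OF V iso]] rep_iso_trans[OF iso] by blast

lemma rep_class_member:
  assumes "(W, \<tau>) \<in> rep_class sL bL L sV V \<rho>"
  shows "lie_representation sL bL L coord_scale W \<tau>" "rep_iso L sV V \<rho> coord_scale W \<tau>"
  using assms by (auto simp: rep_class_def)

lemma irreps_member:
  fixes sL :: "'k::field \<Rightarrow> 'l::ab_group_add \<Rightarrow> 'l"
  assumes C: "C \<in> irreps sL bL L" and W: "(W, \<tau>) \<in> C"
  shows "lie_representation sL bL L coord_scale W \<tau>" "finite_dimensional coord_scale W"
    "irreducible_rep L coord_scale W \<tau>" "C = rep_class sL bL L coord_scale W \<tau>"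
proof -
  have "\<exists>(V :: (nat \<Rightarrow> 'k) set) \<rho>. C = rep_class sL bL L coord_scale V \<rho> \<and> lie_representation sL bL L coord_scale V \<rho> \<and>
      finite_dimensional coord_scale V \<and> irreducible_rep L coord_scale V \<rho>"
    using C unfolding irreps_def by simp
  then obtain V :: "(nat \<Rightarrow> 'k) set" and \<rho> where V: "C = rep_class sL bL L coord_scale V \<rho>"
    "lie_representation sL bL L coord_scale V \<rho>" "finite_dimensional coord_scale V"
    "irreducible_rep L coord_scale V \<rho>"
    by blast
  note W' = rep_class_member[OF W[unfolded V(1)]]
  show "lie_representation sL bL L coord_scale W \<tau>" by (rule W'(1))
  show "finite_dimensional coord_scale W" by (rule rep_iso_finite_dimensional[OF V(2) W'(1) V(3) W'(2)])
  show "irreducible_rep L coord_scale W \<tau>" by (rule rep_iso_irreducible[OF V(2) W'(1) V(4) W'(2)])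
  show "C = rep_class sL bL L coord_scale W \<tau>" unfolding V(1) by (rule rep_class_eqI[OF V(2) W'(2)])
qed

lemma irreps_nonempty:
  assumes "C \<in> irreps sL bL L"
  shows "\<exists>p. p \<in> C"
  using assms rep_class_self unfolding irreps_def by blast

lemma rep_class_in_irreps:
  fixes sV :: "'k::field \<Rightarrow> 'v::ab_group_add \<Rightarrow> 'v"
  assumes V: "lie_representation sL bL L sV V \<rho>" "finite_dimensional sV V" "irreducible_rep L sV V \<rho>"
  shows "rep_class sL bL L sV V \<rho> \<in> irreps sL bL L"
proof -
  obtain W :: "(nat \<Rightarrow> 'k) set" and \<tau> where W: "lie_representation sL bL L coord_scale W \<tau>"
    "finite_dimensional coord_scale W" "rep_iso L sV V \<rho> coord_scale W \<tau>"
    by (rule rep_model_exists[OF V(1,2)])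
  have "irreducible_rep L coord_scale W \<tau>" by (rule rep_iso_irreducible[OF V(1) W(1) V(3) W(3)])
  then show ?thesis
    unfolding irreps_def rep_class_eqI[OF V(1) W(3)] using W by blast
qed

lemma irreps_eqI:
  assumes "C \<in> irreps sL bL L" "C' \<in> irreps sL bL L" "(V, \<rho>) \<in> C" "(W, \<tau>) \<in> C'"
    and iso: "rep_iso L coord_scale V \<rho> coord_scale W \<tau>"
  shows "C = C'"
  using irreps_member[OF assms(1,3)] irreps_member[OF assms(2,4)] rep_class_eqI[OF _ iso] by metis

lemma irreps_same_class_iso:
  assumes C: "C \<in> irreps sL bL L" and "(V, \<rho>) \<in> C" "(W, \<tau>) \<in> C"
  shows "rep_iso L coord_scale V \<rho> coord_scale W \<tau>"
proof -
  have "(W, \<tau>) \<in> rep_class sL bL L coord_scale V \<rho>"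
    using assms(3) irreps_member(4)[OF assms(1,2)] by simp
  then show ?thesis by (rule rep_class_member)
qed

lemma vector_space_self: "vector_space ((*) :: 'k::field \<Rightarrow> 'k \<Rightarrow> 'k)"
  by unfold_locales (auto simp: algebra_simps)

lemma trivial_representation:
  "lie_representation sL bL L ((*) :: 'k::field \<Rightarrow> 'k \<Rightarrow> 'k) UNIV (\<lambda>_ _. 0)"
proof -
  interpret K: vector_space "(*) :: 'k \<Rightarrow> 'k \<Rightarrow> 'k" by (rule vector_space_self)
  show ?thesis
    by (rule lie_representationI[OF vector_space_self]) (auto simp: linear_on_def K.subspace_UNIV)
qed

lemma trivial_class_in_irreps: "trivial_class sL bL L \<in> (irreps sL bL L :: ('k::field, 'l::ab_group_add) rep set set)"
  unfolding trivial_class_def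
proof (rule rep_class_in_irreps[OF trivial_representation])
  interpret K: vector_space "(*) :: 'k \<Rightarrow> 'k \<Rightarrow> 'k" by (rule vector_space_self)
  have "K.span {1} = UNIV"
  proof -
    have "c * 1 \<in> K.span {1}" for c by (intro K.span_scale K.span_base) simp
    then show ?thesis by auto
  qed
  then show "finite_dimensional ((*) :: 'k \<Rightarrow> 'k \<Rightarrow> 'k) UNIV"
    unfolding finite_dimensional_def by (intro exI[of _ "{1}"]) simp
  have "U = {0} \<or> U = UNIV" if U: "K.subspace U" for U
  proof (cases "U \<subseteq> {0}")
    case True
    then show ?thesis using K.subspace_0[OF U] by auto
  next
    case False
    then obtain u where u: "u \<in> U" "u \<noteq> 0" by auto
    have "c \<in> U" for c using K.subspace_scale[OF U u(1), of "c / u"] u(2) by simp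
    then show ?thesis by auto
  qed
  moreover have "(UNIV :: 'k set) \<noteq> {0}" by (metis UNIV_I one_neq_zero singletonD)
  ultimately show "irreducible_rep L ((*) :: 'k \<Rightarrow> 'k \<Rightarrow> 'k) UNIV (\<lambda>_ _. 0)"
    unfolding irreducible_rep_def by blast
qed

lemma trivial_class_iff:
  assumes C: "C \<in> irreps sL bL L" and V: "(V, \<rho>) \<in> C"
  shows "C = trivial_class sL bL L \<longleftrightarrow> rep_iso L (*) UNIV (\<lambda>_ _. 0) coord_scale V \<rho>"
proof
  assume "C = trivial_class sL bL L"
  then show "rep_iso L (*) UNIV (\<lambda>_ _. 0) coord_scale V \<rho>"
    using V rep_class_member(2) unfolding trivial_class_def by blast
next
  assume iso: "rep_iso L (*) UNIV (\<lambda>_ _. 0) coord_scale V \<rho>"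
  show "C = trivial_class sL bL L"
    unfolding trivial_class_def rep_class_eqI[OF trivial_representation iso] by (rule irreps_member(4)[OF C V])
qed

section \<open>Equivariant functions and evaluation classes\<close>

context involution_lie_algebra
begin

lemma fixed_algebra_inverse: "fixed_algebra \<sigma> (inverse x) = fixed_algebra \<sigma> x"
  by (auto simp: fixed_algebra_eq)

lemma \<sigma>_fixed_algebra: "a \<in> fixed_algebra \<sigma> x \<Longrightarrow> \<sigma> a \<in> fixed_algebra \<sigma> x"
  by (auto simp: fixed_algebra_eq \<gg>0_def split: if_splits)

lemma rep_compose_\<sigma>:
  assumes "lie_representation scale bracket (fixed_algebra \<sigma> x) sV V \<rho>"
  shows "lie_representation scale bracket (fixed_algebra \<sigma> x) sV V (\<rho> \<circ> \<sigma>)"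
  unfolding comp_def
proof (rule lie_representationI[OF lie_representationD(1,2)[OF assms]])
  note s = \<sigma>_fixed_algebra[of _ x]
  show "\<rho> (\<sigma> a) v \<in> V" if "a \<in> fixed_algebra \<sigma> x" "v \<in> V" for a v
    by (rule lie_representationD(3)[OF assms s[OF that(1)] that(2)])
  show "linear_on sV sV V (\<rho> (\<sigma> a))" if "a \<in> fixed_algebra \<sigma> x" for a
    by (rule lie_representationD(4)[OF assms s[OF that]])
  fix a b v assume ab: "a \<in> fixed_algebra \<sigma> x" "b \<in> fixed_algebra \<sigma> x" and v: "v \<in> V"
  show "\<rho> (\<sigma> (a + b)) v = \<rho> (\<sigma> a) v + \<rho> (\<sigma> b) v"
    unfolding \<sigma>.add by (rule lie_representationD(5)[OF assms s[OF ab(1)] s[OF ab(2)] v])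
  show "\<rho> (\<sigma> (bracket a b)) v = \<rho> (\<sigma> a) (\<rho> (\<sigma> b) v) - \<rho> (\<sigma> b) (\<rho> (\<sigma> a) v)"
    unfolding \<sigma>_bracket by (rule lie_representationD(7)[OF assms s[OF ab(1)] s[OF ab(2)] v])
next
  show "\<rho> (\<sigma> (c *s a)) v = sV c (\<rho> (\<sigma> a) v)" if "a \<in> fixed_algebra \<sigma> x" "v \<in> V" for a v c
    unfolding \<sigma>.scale by (rule lie_representationD(6)[OF assms \<sigma>_fixed_algebra[OF that(1)] that(2)])
qed

lemma rep_iso_compose_\<sigma>:
  assumes "rep_iso (fixed_algebra \<sigma> x) sV V \<rho> sW W \<tau>"
  shows "rep_iso (fixed_algebra \<sigma> x) sV V (\<rho> \<circ> \<sigma>) sW W (\<tau> \<circ> \<sigma>)"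
proof -
  obtain T where T: "rep_hom (fixed_algebra \<sigma> x) sV V \<rho> sW W \<tau> T" "bij_betw T V W"
    using assms unfolding rep_iso_iff_hom by auto
  have "rep_hom (fixed_algebra \<sigma> x) sV V (\<rho> \<circ> \<sigma>) sW W (\<tau> \<circ> \<sigma>) T"
    using T(1) \<sigma>_fixed_algebra[of _ x] unfolding rep_hom_def comp_def by blast
  then show ?thesis unfolding rep_iso_iff_hom using T(2) by blast
qed

lemma compose_\<sigma>_\<sigma>: "(\<rho> \<circ> \<sigma>) \<circ> \<sigma> = \<rho>"
  by (simp add: fun_eq_iff)

lemma act_class_0:
  fixes C :: "('k, 'g) rep set"
  shows "act_class \<sigma> 0 C = C"
proof -
  have "\<rho> \<circ> act_g \<sigma> (- 0) = \<rho>" for \<rho> :: "'g \<Rightarrow> (nat \<Rightarrow> 'k) \<Rightarrow> nat \<Rightarrow> 'k"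
    by (simp add: act_g_def fun_eq_iff)
  then show ?thesis by (simp add: act_class_def case_prod_unfold)
qed

lemma act_class_1: "act_class \<sigma> 1 C = (\<lambda>(V, \<rho>). (V, \<rho> \<circ> \<sigma>)) ` C"
proof -
  have "act_g \<sigma> (- 1) = \<sigma>" by (simp add: act_g_def fun_eq_iff)
  then show ?thesis by (simp add: act_class_def)
qed

lemma act_class_1_1: "act_class \<sigma> 1 (act_class \<sigma> 1 C) = C"
  by (simp add: act_class_1 image_image case_prod_unfold compose_\<sigma>_\<sigma>)

lemma act_class_rep_class:
  "act_class \<sigma> 1 (rep_class scale bracket (fixed_algebra \<sigma> x) sV V \<rho>) =
    rep_class scale bracket (fixed_algebra \<sigma> x) sV V (\<rho> \<circ> \<sigma>)"
proof
  show "act_class \<sigma> 1 (rep_class scale bracket (fixed_algebra \<sigma> x) sV V \<rho>) \<subseteq>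
      rep_class scale bracket (fixed_algebra \<sigma> x) sV V (\<rho> \<circ> \<sigma>)"
    unfolding act_class_1 rep_class_def using rep_compose_\<sigma> rep_iso_compose_\<sigma> by auto
  show "rep_class scale bracket (fixed_algebra \<sigma> x) sV V (\<rho> \<circ> \<sigma>) \<subseteq>
      act_class \<sigma> 1 (rep_class scale bracket (fixed_algebra \<sigma> x) sV V \<rho>)"
  proof
    fix p assume "p \<in> rep_class scale bracket (fixed_algebra \<sigma> x) sV V (\<rho> \<circ> \<sigma>)"
    then obtain W \<tau> where W: "p = (W, \<tau>)" "lie_representation scale bracket (fixed_algebra \<sigma> x) coord_scale W \<tau>"
      "rep_iso (fixed_algebra \<sigma> x) sV V (\<rho> \<circ> \<sigma>) coord_scale W \<tau>"
      by (auto simp: rep_class_def)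
    have "(W, \<tau> \<circ> \<sigma>) \<in> rep_class scale bracket (fixed_algebra \<sigma> x) sV V \<rho>"
      using rep_compose_\<sigma>[OF W(2)] rep_iso_compose_\<sigma>[OF W(3)] by (simp add: rep_class_def compose_\<sigma>_\<sigma>)
    then show "p \<in> act_class \<sigma> 1 (rep_class scale bracket (fixed_algebra \<sigma> x) sV V \<rho>)"
      unfolding act_class_1 W(1) by (rule rev_image_eqI) (simp add: compose_\<sigma>_\<sigma>)
  qed
qed

lemma irreducible_rep_compose_\<sigma>:
  assumes "irreducible_rep (fixed_algebra \<sigma> x) sV V \<rho>"
  shows "irreducible_rep (fixed_algebra \<sigma> x) sV V (\<rho> \<circ> \<sigma>)"
proof -
  have "(\<forall>a\<in>fixed_algebra \<sigma> x. \<forall>u\<in>U. (\<rho> \<circ> \<sigma>) a u \<in> U) \<longleftrightarrow> (\<forall>a\<in>fixed_algebra \<sigma> x. \<forall>u\<in>U. \<rho> a u \<in> U)" for U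
    using \<sigma>_fixed_algebra[of _ x] \<sigma>_\<sigma> by (metis comp_apply)
  then show ?thesis using assms unfolding irreducible_rep_def by simp
qed

lemma act_class_irreps:
  assumes "C \<in> irreps scale bracket (fixed_algebra \<sigma> x)"
  shows "act_class \<sigma> 1 C \<in> irreps scale bracket (fixed_algebra \<sigma> x)"
proof -
  obtain V \<rho> where V: "(V, \<rho>) \<in> C" using irreps_nonempty[OF assms] by (metis surj_pair)
  note C = irreps_member[OF assms V]
  show ?thesis
    unfolding C(4) act_class_rep_class
    by (intro rep_class_in_irreps rep_compose_\<sigma> irreducible_rep_compose_\<sigma> C)
qed

lemma act_class_trivial:
  "act_class \<sigma> 1 (trivial_class scale bracket (fixed_algebra \<sigma> x)) = trivial_class scale bracket (fixed_algebra \<sigma> x)"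
  unfolding trivial_class_def act_class_rep_class by (simp add: comp_def)

text \<open>\<open>\<sigma>\<close> is the identity on \<open>\<gg>\<^sup>x\<close> at a fixed point \<open>x\<close> of the inversion.\<close>

lemma act_class_fixed_point:
  assumes x: "inverse x = x" and C: "C \<in> irreps scale bracket (fixed_algebra \<sigma> x)"
  shows "act_class \<sigma> 1 C = C"
proof -
  obtain V \<rho> where V: "(V, \<rho>) \<in> C" using irreps_nonempty[OF C] by (metis surj_pair)
  note C = irreps_member[OF C V]
  have "rep_iso (fixed_algebra \<sigma> x) coord_scale V \<rho> coord_scale V (\<rho> \<circ> \<sigma>)"
    unfolding rep_iso_def using x
    by (intro exI[of _ "\<lambda>v. v"]) (auto simp: bij_betw_def fixed_algebra_eq \<gg>0_def)
  from rep_class_eqI[OF C(1) this] show ?thesis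
    unfolding C(4) act_class_rep_class by simp
qed

lemma inverse_eq_or_iff:
  assumes "x \<in> X_rat" "y \<in> X_rat"
  shows "x + inverse x = y + inverse y \<longleftrightarrow> (\<exists>\<gamma>. y = act_X \<gamma> x)"
proof -
  have "(\<exists>\<gamma>. y = act_X \<gamma> x) \<longleftrightarrow> y = x \<or> y = inverse x"
    unfolding act_X_def by (metis bit_not_one_iff)
  moreover have "x \<noteq> 0" "y \<noteq> 0" using assms by (auto simp: X_rat_def)
  then have "x + inverse x = y + inverse y \<longleftrightarrow> x = y \<or> x = inverse y" by (rule add_inverse_eq_iff)
  ultimately show ?thesis by (metis inverse_inverse_eq)
qed

text \<open>A linear bijection at every point of \<open>Y\<close>, and an invariant vector at the other points of \<open>S'\<close>, define
  a nonzero homomorphism between tensor products over \<open>S\<close> and \<open>S'\<close>.\<close>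

lemma tensor_product_iso:
  assumes S: "finite S" "S \<subseteq> X_rat" "inj_on (\<lambda>x. x + inverse x) S"
    and S': "finite S'" "S' \<subseteq> X_rat" "inj_on (\<lambda>x. x + inverse x) S'"
    and fam: "irrep_family S V \<rho>" and fam': "irrep_family S' V' \<rho>'"
    and Y: "Y \<subseteq> S'" and \<phi>: "bij_betw \<phi> Y S"
    and \<theta>_lin: "\<And>y. y \<in> Y \<Longrightarrow> linear_on coord_scale coord_scale (V (\<phi> y)) (\<theta> y)"
    and \<theta>_bij: "\<And>y. y \<in> Y \<Longrightarrow> bij_betw (\<theta> y) (V (\<phi> y)) (V' y)"
    and \<theta>_eq: "\<And>y \<alpha> v. y \<in> Y \<Longrightarrow> \<alpha> \<in> \<MM> \<Longrightarrow> v \<in> V (\<phi> y) \<Longrightarrow>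
      \<theta> y (\<rho> (\<phi> y) (\<alpha> (\<phi> y)) v) = \<rho>' y (\<alpha> y) (\<theta> y v)"
    and e: "\<And>y. y \<in> S' - Y \<Longrightarrow> e y \<in> V' y" "\<And>y. y \<in> S' - Y \<Longrightarrow> e y \<noteq> 0"
      "\<And>y \<alpha>. y \<in> S' - Y \<Longrightarrow> \<alpha> \<in> \<MM> \<Longrightarrow> \<rho>' y (\<alpha> y) (e y) = 0"
  shows "rep_iso \<MM> coord_scale (tensor_space S V) (ev_rep S \<rho>) coord_scale (tensor_space S' V') (ev_rep S' \<rho>')"
proof -
  interpret E: evaluation_rep S V scale bracket "fixed_algebra \<sigma>" \<rho> \<MM>
    by (rule evaluation_rep_family[OF fam S(1,2) order_refl])
  interpret E': evaluation_rep S' V' scale bracket "fixed_algebra \<sigma>" \<rho>' \<MM>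
    by (rule evaluation_rep_family[OF fam' S'(1,2) order_refl])
  have irr: "irreducible_rep \<MM> coord_scale E.TS (ev_rep S \<rho>)"
    by (rule E.ev_rep_irreducible) (use irrep_familyD[OF fam] evaluation_surjective[OF S] in auto)
  have irr': "irreducible_rep \<MM> coord_scale E'.TS (ev_rep S' \<rho>')"
    by (rule E'.ev_rep_irreducible) (use irrep_familyD[OF fam'] evaluation_surjective[OF S'] in auto)
  have finY: "finite Y" using Y S'(1) by (rule finite_subset)
  have \<phi>S: "\<phi> y \<in> S" if "y \<in> Y" for y using \<phi> that by (auto simp: bij_betw_def)
  define t where "t v y = (if y \<in> Y then \<theta> y (v (\<phi> y)) else e y)" for v y
  have t_in: "t v y \<in> V' y" if "\<And>x. x \<in> S \<Longrightarrow> v x \<in> V x" "y \<in> S'" for v y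
    using that \<phi>S bij_betwE[OF \<theta>_bij, of y] e(1) by (auto simp: t_def)
  have t_upd: "t (v(\<phi> y := u)) z = ((t v)(y := \<theta> y u)) z" if "y \<in> Y" for v y u z
    using \<phi> that by (auto simp: t_def bij_betw_def inj_on_def)
  define m where "m v = pure_tensor S' (t v)" for v
  have m_upd: "m (v(\<phi> y := u)) = pure_tensor S' ((t v)(y := \<theta> y u))" if "y \<in> Y" for v y u
    unfolding m_def using t_upd[OF that] by (auto simp: pure_tensor_def)
  have m_mult: "multilinear_on S V coord_scale m"
    unfolding multilinear_on_def
  proof (intro conjI allI impI)
    fix v x assume vx: "(\<forall>y\<in>S. v y \<in> V y) \<and> x \<in> S"
    then obtain y where y: "y \<in> Y" "x = \<phi> y" using \<phi> by (auto simp: bij_betw_def)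
    have "linear_on coord_scale coord_scale (V' y) (\<lambda>u. pure_tensor S' ((t v)(y := u)))"
      by (rule multilinear_on_linear[OF multilinear_pure_tensor[OF S'(1)], of "t v" V'])
        (use vx t_in y Y in auto)
    then show "linear_on coord_scale coord_scale (V x) (\<lambda>u. m (v(x := u)))"
      unfolding y(2) m_upd[OF y(1)]
      using linear_on_add[OF \<theta>_lin[OF y(1)]] linear_on_scale[OF \<theta>_lin[OF y(1)]] bij_betwE[OF \<theta>_bij[OF y(1)]]
      unfolding linear_on_def by simp
  next
    fix v v' :: "'k \<Rightarrow> nat \<Rightarrow> 'k" assume "\<forall>x\<in>S. v x = v' x"
    then have "t v = t v'" using \<phi>S by (auto simp: t_def)
    then show "m v = m v'" by (simp add: m_def)
  qed
  have m_in: "m v \<in> E'.TS" if "\<And>x. x \<in> S \<Longrightarrow> v x \<in> V x" for v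
    unfolding m_def by (rule E'.pure_tensor_in_TS) (use that t_in in auto)
  have m_eq: "(\<Sum>x\<in>S. m (v(x := \<rho> x (\<alpha> x) (v x)))) = ev_rep S' \<rho>' \<alpha> (m v)"
    if \<alpha>: "\<alpha> \<in> \<MM>" and v: "\<And>x. x \<in> S \<Longrightarrow> v x \<in> V x" for \<alpha> v
  proof -
    have "(\<Sum>x\<in>S. m (v(x := \<rho> x (\<alpha> x) (v x)))) = (\<Sum>y\<in>Y. m (v(\<phi> y := \<rho> (\<phi> y) (\<alpha> (\<phi> y)) (v (\<phi> y)))))"
      by (rule sum.reindex_bij_betw[OF \<phi>, symmetric])
    also have "\<dots> = (\<Sum>y\<in>Y. pure_tensor S' ((t v)(y := \<rho>' y (\<alpha> y) (t v y))))"
      using \<theta>_eq[OF _ \<alpha>] v \<phi>S by (intro sum.cong refl) (simp only: m_upd, simp add: t_def)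
    also have "\<dots> = (\<Sum>y\<in>S'. pure_tensor S' ((t v)(y := \<rho>' y (\<alpha> y) (t v y))))"
    proof (rule sum.mono_neutral_left[OF S'(1) Y], rule ballI)
      fix y assume y: "y \<in> S' - Y"
      then have "\<rho>' y (\<alpha> y) (t v y) = 0" using e(3)[OF y \<alpha>] by (simp add: t_def)
      then show "pure_tensor S' ((t v)(y := \<rho>' y (\<alpha> y) (t v y))) = 0"
        using y by (auto simp: fun_eq_iff pure_tensor_fun_upd[OF S'(1)])
    qed
    also have "\<dots> = ev_rep S' \<rho>' \<alpha> (m v)"
      unfolding m_def by (rule E'.ev_rep_pure_tensor[OF \<alpha>, symmetric]) (use v t_in in auto)
    finally show ?thesis .
  qed
  obtain T where T: "rep_hom \<MM> coord_scale E.TS (ev_rep S \<rho>) coord_scale E'.TS (ev_rep S' \<rho>') T"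
    and T_pure: "\<And>v. (\<And>x. x \<in> S \<Longrightarrow> v x \<in> V x) \<Longrightarrow> T (pure_tensor S v) = m v"
    using E.multilinear_hom[OF irrep_familyD(2)[OF fam] E'.ev_rep_lie_representation m_mult m_in m_eq] by auto
  have "\<exists>v. v \<in> V x \<and> v \<noteq> 0" if "x \<in> S" for x
    using irreducible_rep_nonzero[OF irrep_familyD(1,3)[OF fam that]] by blast
  then obtain v where v: "\<And>x. x \<in> S \<Longrightarrow> v x \<in> V x" "\<And>x. x \<in> S \<Longrightarrow> v x \<noteq> 0" by metis
  have "t v y \<noteq> 0" if y: "y \<in> S'" for y
  proof (cases "y \<in> Y")
    case True
    have sub: "coord.subspace (V (\<phi> y))" by (rule irrep_familyD(4)[OF fam \<phi>S[OF True]])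
    have "\<theta> y 0 = 0" by (rule linear_on_0[OF vector_space_coord_scale sub \<theta>_lin[OF True]])
    moreover have "inj_on (\<theta> y) (V (\<phi> y))" using \<theta>_bij[OF True] by (simp add: bij_betw_def)
    ultimately have "\<theta> y (v (\<phi> y)) \<noteq> 0"
      using inj_onD[of "\<theta> y" "V (\<phi> y)" "v (\<phi> y)" 0] v[OF \<phi>S[OF True]] coord.subspace_0[OF sub] by metis
    then show ?thesis using True by (simp add: t_def)
  next
    case False
    then show ?thesis using e(2) y by (simp add: t_def)
  qed
  then have "m v \<noteq> 0" unfolding m_def by (rule E'.pure_tensor_nonzero)
  then have nz: "T (pure_tensor S v) \<noteq> 0" using T_pure[OF v(1)] by simp
  from irreducible_rep_hom_iso[where T = T, OF E.ev_rep_lie_representation E'.ev_rep_lie_representation irr irr' T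
      E.pure_tensor_in_TS[OF v(1)] nz]
  show ?thesis .
qed

lemma transversal_exists:
  fixes A :: "'k set"
  shows "\<exists>S\<subseteq>A. inj_on (\<lambda>x. x + inverse x) S \<and> (\<forall>x\<in>A. \<exists>y\<in>S. x + inverse x = y + inverse y)"
proof -
  let ?z = "\<lambda>x::'k. x + inverse x"
  have "\<forall>\<zeta>\<in>?z ` A. \<exists>x. x \<in> A \<and> ?z x = \<zeta>" by auto
  from bchoice[OF this] obtain pick where pick: "\<forall>\<zeta>\<in>?z ` A. pick \<zeta> \<in> A \<and> ?z (pick \<zeta>) = \<zeta>" ..
  show ?thesis
  proof (intro exI[of _ "pick ` ?z ` A"] conjI ballI)
    show "pick ` ?z ` A \<subseteq> A" using pick by auto
    show "inj_on ?z (pick ` ?z ` A)"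
    proof (rule inj_onI)
      fix x y assume "x \<in> pick ` ?z ` A" "y \<in> pick ` ?z ` A" and eq: "?z x = ?z y"
      then obtain \<zeta> \<eta> where "\<zeta> \<in> ?z ` A" "x = pick \<zeta>" "\<eta> \<in> ?z ` A" "y = pick \<eta>" by blast
      then show "x = y" using pick eq by metis
    qed
    show "\<exists>y\<in>pick ` ?z ` A. ?z x = ?z y" if "x \<in> A" for x
      using pick that by (intro bexI[of _ "pick (?z x)"]) auto
  qed
qed

abbreviation "\<E> \<equiv> equivariant_class_funs scale bracket \<sigma>"
abbreviation "supp \<equiv> class_supp scale bracket \<sigma>"

lemma \<E>D:
  assumes "\<Psi> \<in> \<E>"
  shows "\<And>x. x \<in> X_rat \<Longrightarrow> \<Psi> x \<in> irreps scale bracket (fixed_algebra \<sigma> x)"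
    and "finite (supp \<Psi>)" and "\<And>x \<gamma>. x \<in> X_rat \<Longrightarrow> \<Psi> (act_X \<gamma> x) = act_class \<sigma> \<gamma> (\<Psi> x)"
    and "\<And>x. x \<notin> X_rat \<Longrightarrow> \<Psi> x = undefined"
  using assms unfolding equivariant_class_funs_def by (auto dest: PiE_mem PiE_arb)

lemma \<E>_inverse: "\<Psi> \<in> \<E> \<Longrightarrow> x \<in> X_rat \<Longrightarrow> \<Psi> (inverse x) = act_class \<sigma> 1 (\<Psi> x)"
  using \<E>D(3)[of \<Psi> x 1] by (simp add: act_X_def)

text \<open>Representatives of \<open>\<Psi>\<close> on a finite set with at most one point in each orbit and at least one in each
  orbit of the support.  Points off the support are admitted, so that two functions can be compared on
  the same set.\<close>

definition evaluation_data :: "('k \<Rightarrow> ('k, 'g) rep set) \<Rightarrow> 'k set \<Rightarrow> ('k \<Rightarrow> (nat \<Rightarrow> 'k) set) \<Rightarrow>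
    ('k \<Rightarrow> 'g \<Rightarrow> (nat \<Rightarrow> 'k) \<Rightarrow> nat \<Rightarrow> 'k) \<Rightarrow> bool" where
  "evaluation_data \<Psi> S V \<rho> \<longleftrightarrow> finite S \<and> S \<subseteq> X_rat \<and> inj_on (\<lambda>x. x + inverse x) S \<and>
     (\<forall>x\<in>supp \<Psi>. \<exists>y\<in>S. x + inverse x = y + inverse y) \<and> (\<forall>x\<in>S. (V x, \<rho> x) \<in> \<Psi> x)"

lemma evaluation_data_irrep_family:
  assumes "\<Psi> \<in> \<E>" "evaluation_data \<Psi> S V \<rho>"
  shows "irrep_family S V \<rho>"
  unfolding irrep_family_def
proof
  fix x assume x: "x \<in> S"
  then have "\<Psi> x \<in> irreps scale bracket (fixed_algebra \<sigma> x)" "(V x, \<rho> x) \<in> \<Psi> x"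
    using assms \<E>D(1) by (auto simp: evaluation_data_def)
  from irreps_member[OF this] show "lie_representation scale bracket (fixed_algebra \<sigma> x) coord_scale (V x) (\<rho> x) \<and>
     finite_dimensional coord_scale (V x) \<and> irreducible_rep (fixed_algebra \<sigma> x) coord_scale (V x) (\<rho> x)"
    by blast
qed

lemma supp_inverse:
  assumes \<Psi>: "\<Psi> \<in> \<E>" and x: "x \<in> X_rat" "y \<in> X_rat" "x + inverse x = y + inverse y"
  shows "x \<in> supp \<Psi> \<longleftrightarrow> y \<in> supp \<Psi>"
proof -
  have *: "inverse x \<in> supp \<Psi>" if "x \<in> supp \<Psi>" for x
  proof -
    have x: "x \<in> X_rat" "inverse x \<in> X_rat" using that by (auto simp: class_supp_def X_rat_def)
    have "\<Psi> (inverse x) \<noteq> trivial_class scale bracket (fixed_algebra \<sigma> x)"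
    proof
      assume "\<Psi> (inverse x) = trivial_class scale bracket (fixed_algebra \<sigma> x)"
      then have "\<Psi> x = trivial_class scale bracket (fixed_algebra \<sigma> x)"
        using \<E>_inverse[OF \<Psi> x(2)] by (simp add: act_class_trivial)
      then show False using that by (simp add: class_supp_def)
    qed
    then show ?thesis using x by (simp add: class_supp_def fixed_algebra_inverse)
  qed
  have "x = y \<or> x = inverse y" using x add_inverse_eq_iff by (auto simp: X_rat_def)
  then show ?thesis using *[of x] *[of y] by auto
qed

lemma transversal_data:
  assumes \<Psi>: "\<Psi> \<in> \<E>" and X: "orbit_transversal (supp \<Psi>) X" and V: "\<forall>x\<in>X. (V x, \<rho> x) \<in> \<Psi> x"
  shows "evaluation_data \<Psi> X V \<rho>"
  unfolding evaluation_data_def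
proof (intro conjI ballI)
  have Xs: "X \<subseteq> supp \<Psi>" and ex: "\<And>y. y \<in> supp \<Psi> \<Longrightarrow> \<exists>!z. z \<in> X \<and> (\<exists>\<gamma>. z = act_X \<gamma> y)"
    using X by (auto simp: orbit_transversal_def)
  have sR: "supp \<Psi> \<subseteq> X_rat" by (auto simp: class_supp_def)
  show "finite X" using Xs \<E>D(2)[OF \<Psi>] by (rule finite_subset)
  show XR: "X \<subseteq> X_rat" using Xs sR by simp
  show "inj_on (\<lambda>x. x + inverse x) X"
  proof (rule inj_onI)
    fix x y assume xy: "x \<in> X" "y \<in> X" "x + inverse x = y + inverse y"
    then have "\<exists>\<gamma>. y = act_X \<gamma> x" "\<exists>\<gamma>. x = act_X \<gamma> x"
      using XR inverse_eq_or_iff[of x y] inverse_eq_or_iff[of x x] by auto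
    then show "x = y" using ex[of x] xy Xs by auto
  qed
  show "\<exists>y\<in>X. x + inverse x = y + inverse y" if "x \<in> supp \<Psi>" for x
    using ex[OF that] inverse_eq_or_iff[of x] XR that sR by blast
  show "(V x, \<rho> x) \<in> \<Psi> x" if "x \<in> X" for x using V that by blast
qed

text \<open>Changing representatives, replacing points by their inverses, and adding points with trivial
  representations do not change the isomorphism class.\<close>

lemma evaluation_data_iso:
  assumes \<Psi>: "\<Psi> \<in> \<E>" and S: "evaluation_data \<Psi> S V \<rho>" "S \<subseteq> supp \<Psi>" and S': "evaluation_data \<Psi> S' V' \<rho>'"
  shows "rep_iso \<MM> coord_scale (tensor_space S V) (ev_rep S \<rho>) coord_scale (tensor_space S' V') (ev_rep S' \<rho>')"
proof -
  let ?z = "\<lambda>x::'k. x + inverse x" and ?Y = "S' \<inter> supp \<Psi>"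
  have s: "finite S" "S \<subseteq> X_rat" "inj_on ?z S" "\<And>x. x \<in> supp \<Psi> \<Longrightarrow> \<exists>y\<in>S. ?z x = ?z y"
    "\<And>x. x \<in> S \<Longrightarrow> (V x, \<rho> x) \<in> \<Psi> x" using S(1) by (auto simp: evaluation_data_def)
  have s': "finite S'" "S' \<subseteq> X_rat" "inj_on ?z S'" "\<And>x. x \<in> supp \<Psi> \<Longrightarrow> \<exists>y\<in>S'. ?z x = ?z y"
    "\<And>x. x \<in> S' \<Longrightarrow> (V' x, \<rho>' x) \<in> \<Psi> x" using S' by (auto simp: evaluation_data_def)
  (* phi sends a point of S' in the support to the point of S in the same orbit. *)
  have "\<forall>y\<in>?Y. \<exists>x. x \<in> S \<and> ?z y = ?z x" using s(4) by blast
  from bchoice[OF this] obtain \<phi> where \<phi>: "\<And>y. y \<in> ?Y \<Longrightarrow> \<phi> y \<in> S" "\<And>y. y \<in> ?Y \<Longrightarrow> ?z y = ?z (\<phi> y)" by auto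
  have "bij_betw \<phi> ?Y S"
    unfolding bij_betw_def
  proof
    show "inj_on \<phi> ?Y"
    proof (rule inj_onI)
      fix y y' assume y: "y \<in> ?Y" "y' \<in> ?Y" "\<phi> y = \<phi> y'"
      then have "?z y = ?z y'" using \<phi>(2)[OF y(1)] \<phi>(2)[OF y(2)] by simp
      then show "y = y'" by (rule inj_onD[OF s'(3)]) (use y in auto)
    qed
    show "\<phi> ` ?Y = S"
    proof
      show "S \<subseteq> \<phi> ` ?Y"
      proof
        fix x assume x: "x \<in> S"
        then obtain y where y: "y \<in> S'" "?z x = ?z y" using s'(4) S(2) by blast
        then have "y \<in> ?Y" using supp_inverse[OF \<Psi>, of x y] x S(2) s(2) s'(2) by auto
        moreover have "\<phi> y = x" using inj_onD[OF s(3), of "\<phi> y" x] \<phi>[OF \<open>y \<in> ?Y\<close>] x y by auto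
        ultimately show "x \<in> \<phi> ` ?Y" by auto
      qed
    qed (use \<phi> in auto)
  qed
  have "\<exists>\<theta>. linear_on coord_scale coord_scale (V (\<phi> y)) \<theta> \<and> bij_betw \<theta> (V (\<phi> y)) (V' y) \<and>
      (\<forall>\<alpha>\<in>\<MM>. \<forall>v\<in>V (\<phi> y). \<theta> (\<rho> (\<phi> y) (\<alpha> (\<phi> y)) v) = \<rho>' y (\<alpha> y) (\<theta> v))" if y: "y \<in> ?Y" for y
  proof -
    have yR: "y \<in> X_rat" "\<phi> y \<in> X_rat" using y \<phi>(1)[OF y] s(2) s'(2) by auto
    have "\<exists>\<pi>. (V (\<phi> y), \<pi>) \<in> \<Psi> y \<and> (\<forall>\<alpha>\<in>\<MM>. \<rho> (\<phi> y) (\<alpha> (\<phi> y)) = \<pi> (\<alpha> y))"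
    proof (cases "\<phi> y = y")
      case True
      then show ?thesis using s(5)[OF \<phi>(1)[OF y]] by (intro exI[of _ "\<rho> (\<phi> y)"]) simp
    next
      case False
      then have inv: "\<phi> y = inverse y"
        using \<phi>(2)[OF y] add_inverse_eq_iff[of "\<phi> y" y] yR by (auto simp: X_rat_def)
      have "(V (\<phi> y), \<rho> (\<phi> y)) \<in> act_class \<sigma> 1 (\<Psi> y)"
        using s(5)[OF \<phi>(1)[OF y]] \<E>_inverse[OF \<Psi> yR(1)] by (simp add: inv)
      then obtain \<pi> where \<pi>: "(V (\<phi> y), \<pi>) \<in> \<Psi> y" "\<rho> (\<phi> y) = \<pi> \<circ> \<sigma>"
        unfolding act_class_1 by auto
      (* The twist of the representation by sigma is undone by the equivariance of alpha. *)
      have "\<pi> (\<sigma> (\<alpha> (inverse y))) = \<pi> (\<alpha> y)" if "\<alpha> \<in> \<MM>" for \<alpha>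
        using map_inverse[OF that, of y] yR by (simp add: X_rat_def)
      then show ?thesis using \<pi> by (intro exI[of _ \<pi>]) (simp add: inv)
    qed
    then obtain \<pi> where \<pi>: "(V (\<phi> y), \<pi>) \<in> \<Psi> y" "\<And>\<alpha>. \<alpha> \<in> \<MM> \<Longrightarrow> \<rho> (\<phi> y) (\<alpha> (\<phi> y)) = \<pi> (\<alpha> y)" by auto
    have "(V' y, \<rho>' y) \<in> \<Psi> y" using s'(5) y by auto
    from irreps_same_class_iso[OF \<E>D(1)[OF \<Psi> yR(1)] \<pi>(1) this]
    obtain \<theta> where \<theta>: "rep_hom (fixed_algebra \<sigma> y) coord_scale (V (\<phi> y)) \<pi> coord_scale (V' y) (\<rho>' y) \<theta>"
      "bij_betw \<theta> (V (\<phi> y)) (V' y)"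
      unfolding rep_iso_iff_hom by auto
    have "\<theta> (\<rho> (\<phi> y) (\<alpha> (\<phi> y)) v) = \<rho>' y (\<alpha> y) (\<theta> v)" if "\<alpha> \<in> \<MM>" "v \<in> V (\<phi> y)" for \<alpha> v
      unfolding \<pi>(2)[OF that(1)]
      using \<theta>(1) map_algebra_value_fixed[OF that(1) yR(1)] that(2) unfolding rep_hom_def by blast
    then show ?thesis using \<theta> unfolding rep_hom_def by blast
  qed
  then obtain \<theta> where \<theta>: "\<And>y. y \<in> ?Y \<Longrightarrow> linear_on coord_scale coord_scale (V (\<phi> y)) (\<theta> y)"
    "\<And>y. y \<in> ?Y \<Longrightarrow> bij_betw (\<theta> y) (V (\<phi> y)) (V' y)"
    "\<And>y \<alpha> v. y \<in> ?Y \<Longrightarrow> \<alpha> \<in> \<MM> \<Longrightarrow> v \<in> V (\<phi> y) \<Longrightarrow> \<theta> y (\<rho> (\<phi> y) (\<alpha> (\<phi> y)) v) = \<rho>' y (\<alpha> y) (\<theta> y v)"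
    by metis
  have "\<exists>e. e \<in> V' y \<and> e \<noteq> 0 \<and> (\<forall>\<alpha>\<in>\<MM>. \<rho>' y (\<alpha> y) e = 0)" if y: "y \<in> S' - ?Y" for y
  proof -
    have yR: "y \<in> X_rat" and "\<Psi> y = trivial_class scale bracket (fixed_algebra \<sigma> y)"
      using y s'(2) by (auto simp: class_supp_def)
    moreover have "(V' y, \<rho>' y) \<in> \<Psi> y" using s'(5) y by auto
    ultimately have "rep_iso (fixed_algebra \<sigma> y) (*) UNIV (\<lambda>_ _. 0) coord_scale (V' y) (\<rho>' y)"
      using trivial_class_iff[OF \<E>D(1)[OF \<Psi> yR]] by blast
    then obtain T where T: "rep_hom (fixed_algebra \<sigma> y) (*) UNIV (\<lambda>_ _. 0) coord_scale (V' y) (\<rho>' y) T"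
      "bij_betw T UNIV (V' y)" unfolding rep_iso_iff_hom by auto
    interpret K: vector_space "(*) :: 'k \<Rightarrow> 'k \<Rightarrow> 'k" by (rule vector_space_self)
    have "linear_on (*) coord_scale UNIV T" using T(1) by (simp add: rep_hom_def)
    then have T0: "T 0 = 0" by (rule linear_on_0[OF vector_space_self K.subspace_UNIV])
    have "\<rho>' y (\<alpha> y) (T 1) = 0" if "\<alpha> \<in> \<MM>" for \<alpha>
      using T(1) map_algebra_value_fixed[OF that yR] T0 unfolding rep_hom_def by (metis UNIV_I)
    moreover have "T 1 \<noteq> 0"
      using T(2) T0 by (metis UNIV_I bij_betw_imp_inj_on inj_onD one_neq_zero)
    moreover have "T 1 \<in> V' y" using T(2) by (auto simp: bij_betw_def)
    ultimately show ?thesis by blast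
  qed
  then obtain e where e: "\<And>y. y \<in> S' - ?Y \<Longrightarrow> e y \<in> V' y" "\<And>y. y \<in> S' - ?Y \<Longrightarrow> e y \<noteq> 0"
    "\<And>y \<alpha>. y \<in> S' - ?Y \<Longrightarrow> \<alpha> \<in> \<MM> \<Longrightarrow> \<rho>' y (\<alpha> y) (e y) = 0" by metis
  show ?thesis
    by (rule tensor_product_iso[where Y = ?Y and \<phi> = \<phi> and \<theta> = \<theta> and e = e, OF s(1-3) s'(1-3)
          evaluation_data_irrep_family[OF \<Psi> S(1)] evaluation_data_irrep_family[OF \<Psi> S'] Int_lower1 \<open>bij_betw \<phi> ?Y S\<close>])
      (fact \<theta> e)+
qed

lemma evaluation_data_exists:
  assumes \<Psi>: "\<Psi> \<in> \<E>" and "finite S" "S \<subseteq> X_rat" "inj_on (\<lambda>x. x + inverse x) S"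
    "\<And>x. x \<in> supp \<Psi> \<Longrightarrow> \<exists>y\<in>S. x + inverse x = y + inverse y"
  shows "\<exists>V \<rho>. evaluation_data \<Psi> S V \<rho>"
proof -
  have "\<forall>x\<in>S. \<exists>p. p \<in> \<Psi> x" using irreps_nonempty[OF \<E>D(1)[OF \<Psi>]] assms(3) by blast
  from bchoice[OF this] obtain p where p: "\<forall>x\<in>S. p x \<in> \<Psi> x" ..
  then have "evaluation_data \<Psi> S (\<lambda>x. fst (p x)) (\<lambda>x. snd (p x))" using assms by (simp add: evaluation_data_def)
  then show ?thesis by blast
qed

lemma ev_class_data:
  assumes \<Psi>: "\<Psi> \<in> \<E>" and S: "evaluation_data \<Psi> S V \<rho>"
  shows "ev_class scale bracket \<sigma> \<Psi> = map_rep_class scale bracket \<sigma> coord_scale (tensor_space S V) (ev_rep S \<rho>)"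
proof -
  have eq: "map_rep_class scale bracket \<sigma> coord_scale (tensor_space X V') (ev_rep X \<rho>') =
      map_rep_class scale bracket \<sigma> coord_scale (tensor_space S V) (ev_rep S \<rho>)"
    if X: "orbit_transversal (supp \<Psi>) X" and V': "\<forall>x\<in>X. (V' x, \<rho>' x) \<in> \<Psi> x" for X V' \<rho>'
  proof -
    have d: "evaluation_data \<Psi> X V' \<rho>'" by (rule transversal_data[OF \<Psi> X V'])
    have Xs: "X \<subseteq> supp \<Psi>" using X by (simp add: orbit_transversal_def)
    interpret E: evaluation_rep X V' scale bracket "fixed_algebra \<sigma>" \<rho>' \<MM>
      by (rule evaluation_rep_family[OF evaluation_data_irrep_family[OF \<Psi> d] _ _ order_refl]) (use d in \<open>auto simp: evaluation_data_def\<close>)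
    show ?thesis
      unfolding map_rep_class_def
      by (rule rep_class_eqI[OF E.ev_rep_lie_representation evaluation_data_iso[OF \<Psi> d Xs S]])
  qed
  have sR: "supp \<Psi> \<subseteq> X_rat" by (auto simp: class_supp_def)
  obtain X where X: "X \<subseteq> supp \<Psi>" "inj_on (\<lambda>x. x + inverse x) X"
    "\<And>x. x \<in> supp \<Psi> \<Longrightarrow> \<exists>y\<in>X. x + inverse x = y + inverse y"
    using transversal_exists[of "supp \<Psi>"] by auto
  have tr: "orbit_transversal (supp \<Psi>) X"
    unfolding orbit_transversal_def
  proof (intro conjI ballI)
    fix y assume y: "y \<in> supp \<Psi>"
    have orb: "(\<exists>\<gamma>. z = act_X \<gamma> y) \<longleftrightarrow> y + inverse y = z + inverse z" if "z \<in> X" for z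
      using inverse_eq_or_iff[of y z] y that X(1) sR by blast
    obtain z where z: "z \<in> X" "y + inverse y = z + inverse z" using X(3)[OF y] by auto
    show "\<exists>!z. z \<in> X \<and> (\<exists>\<gamma>. z = act_X \<gamma> y)"
    proof (rule ex1I[of _ z])
      show "z \<in> X \<and> (\<exists>\<gamma>. z = act_X \<gamma> y)" using z orb by simp
      show "z' = z" if z': "z' \<in> X \<and> (\<exists>\<gamma>. z' = act_X \<gamma> y)" for z'
      proof (rule inj_onD[OF X(2)])
        have "z' \<in> X" using z' by blast
        then have "y + inverse y = z' + inverse z'" using orb z' by blast
        then show "z' + inverse z' = z + inverse z" using z(2) by simp
      qed (use z z' in simp_all)
    qed
  qed (rule X(1))
  obtain V0 \<rho>0 where "evaluation_data \<Psi> X V0 \<rho>0"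
    using evaluation_data_exists[OF \<Psi> finite_subset[OF X(1) \<E>D(2)[OF \<Psi>]] order_trans[OF X(1) sR] X(2,3)] by auto
  then have V0: "\<forall>x\<in>X. (V0 x, \<rho>0 x) \<in> \<Psi> x" by (simp add: evaluation_data_def)
  let ?A = "{map_rep_class scale bracket \<sigma> coord_scale (tensor_space X V) (ev_rep X \<rho>) | X V \<rho>.
      orbit_transversal (supp \<Psi>) X \<and> (\<forall>x\<in>X. (V x, \<rho> x) \<in> \<Psi> x)}"
  have "?A = {map_rep_class scale bracket \<sigma> coord_scale (tensor_space S V) (ev_rep S \<rho>)}" (is "_ = {?C}")
  proof
    show "?A \<subseteq> {?C}" using eq by auto
    have "?C = map_rep_class scale bracket \<sigma> coord_scale (tensor_space X V0) (ev_rep X \<rho>0)"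
      using eq[OF tr V0] by simp
    then show "{?C} \<subseteq> ?A" using tr V0 by blast
  qed
  then show ?thesis unfolding ev_class_def by simp
qed

lemma evaluation_data_tensor:
  assumes \<Psi>: "\<Psi> \<in> \<E>" and S: "evaluation_data \<Psi> S V \<rho>"
  shows "lie_representation fsc fbr \<MM> coord_scale (tensor_space S V) (ev_rep S \<rho>)"
    and "finite_dimensional coord_scale (tensor_space S V)"
    and "irreducible_rep \<MM> coord_scale (tensor_space S V) (ev_rep S \<rho>)"
proof -
  note fam = evaluation_data_irrep_family[OF assms]
  have s: "finite S" "S \<subseteq> X_rat" "inj_on (\<lambda>x. x + inverse x) S" using S by (auto simp: evaluation_data_def)
  interpret E: evaluation_rep S V scale bracket "fixed_algebra \<sigma>" \<rho> \<MM>
    by (rule evaluation_rep_family[OF fam s(1,2) order_refl])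
  show "lie_representation fsc fbr \<MM> coord_scale (tensor_space S V) (ev_rep S \<rho>)"
    by (rule E.ev_rep_lie_representation)
  show "finite_dimensional coord_scale (tensor_space S V)"
    by (rule tensor_space_finite_dimensional[OF s(1) irrep_familyD(2)[OF fam]])
  show "irreducible_rep \<MM> coord_scale (tensor_space S V) (ev_rep S \<rho>)"
    by (rule E.ev_rep_irreducible) (use irrep_familyD[OF fam] evaluation_surjective[OF s] in auto)
qed

lemma ev_class_in_irreps:
  assumes \<Psi>: "\<Psi> \<in> \<E>"
  shows "ev_class scale bracket \<sigma> \<Psi> \<in> map_irreps scale bracket \<sigma>"
proof -
  have sR: "supp \<Psi> \<subseteq> X_rat" by (auto simp: class_supp_def)
  obtain X where X: "X \<subseteq> supp \<Psi>" "inj_on (\<lambda>x. x + inverse x) X"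
    "\<And>x. x \<in> supp \<Psi> \<Longrightarrow> \<exists>y\<in>X. x + inverse x = y + inverse y"
    using transversal_exists[of "supp \<Psi>"] by auto
  obtain V \<rho> where d: "evaluation_data \<Psi> X V \<rho>"
    using evaluation_data_exists[OF \<Psi> finite_subset[OF X(1) \<E>D(2)[OF \<Psi>]] order_trans[OF X(1) sR] X(2,3)] by auto
  show ?thesis
    unfolding ev_class_data[OF \<Psi> d] map_rep_class_def map_irreps_def
    by (rule rep_class_in_irreps[OF evaluation_data_tensor[OF \<Psi> d]])
qed

text \<open>\<open>\<Psi> x\<close> is recovered from the tensor product: freezing all indices but the one at \<open>x\<close> turns an isomorphism
  of tensor products into a nonzero homomorphism between the factors at \<open>x\<close>.\<close>

lemma ev_class_injective:
  assumes \<Psi>: "\<Psi> \<in> \<E>" and \<Psi>': "\<Psi>' \<in> \<E>" and eq: "ev_class scale bracket \<sigma> \<Psi> = ev_class scale bracket \<sigma> \<Psi>'"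
  shows "\<Psi> = \<Psi>'"
proof
  fix x
  show "\<Psi> x = \<Psi>' x"
  proof (cases "x \<in> X_rat")
    case False
    then show ?thesis using \<E>D(4)[OF \<Psi>] \<E>D(4)[OF \<Psi>'] by simp
  next
    case x: True
    let ?z = "\<lambda>x::'k. x + inverse x" and ?A = "supp \<Psi> \<union> supp \<Psi>'"
    have A: "finite ?A" "?A \<subseteq> X_rat" using \<E>D(2)[OF \<Psi>] \<E>D(2)[OF \<Psi>'] by (auto simp: class_supp_def)
    obtain S0 where S0: "S0 \<subseteq> ?A" "inj_on ?z S0" "\<And>x. x \<in> ?A \<Longrightarrow> \<exists>y\<in>S0. ?z x = ?z y"
      using transversal_exists[of ?A] by auto
    (* A transversal for both supports that contains x itself. *)
    define S where "S = insert x {s \<in> S0. ?z s \<noteq> ?z x}"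
    have xS: "x \<in> S" by (simp add: S_def)
    have S: "finite S" "S \<subseteq> X_rat" "inj_on ?z S"
      using finite_subset[OF S0(1) A(1)] S0(1) A(2) x S0(2) by (auto simp: S_def inj_on_def)
    have cov: "\<exists>y\<in>S. ?z u = ?z y" if "u \<in> ?A" for u
      using S0(3)[OF that] by (cases "?z u = ?z x") (auto simp: S_def)
    obtain V \<rho> where d: "evaluation_data \<Psi> S V \<rho>" using evaluation_data_exists[OF \<Psi> S] cov by auto
    obtain V' \<rho>' where d': "evaluation_data \<Psi>' S V' \<rho>'" using evaluation_data_exists[OF \<Psi>' S] cov by auto
    note fam = evaluation_data_irrep_family[OF \<Psi> d] and fam' = evaluation_data_irrep_family[OF \<Psi>' d']
    interpret E: evaluation_rep S V scale bracket "fixed_algebra \<sigma>" \<rho> \<MM>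
      by (rule evaluation_rep_family[OF fam S(1,2) order_refl])
    interpret E': evaluation_rep S V' scale bracket "fixed_algebra \<sigma>" \<rho>' \<MM>
      by (rule evaluation_rep_family[OF fam' S(1,2) order_refl])
    let ?C = "map_rep_class scale bracket \<sigma> coord_scale E.TS (ev_rep S \<rho>)"
    have C: "?C = map_rep_class scale bracket \<sigma> coord_scale E'.TS (ev_rep S \<rho>')"
      using eq ev_class_data[OF \<Psi> d] ev_class_data[OF \<Psi>' d'] by simp
    obtain p where "p \<in> ?C"
      using irreps_nonempty[OF rep_class_in_irreps[OF evaluation_data_tensor[OF \<Psi> d]]] unfolding map_rep_class_def by auto
    then obtain W \<tau> where W: "(W, \<tau>) \<in> ?C" by (cases p) auto
    have "rep_iso \<MM> coord_scale E.TS (ev_rep S \<rho>) coord_scale W \<tau>"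
      using W unfolding map_rep_class_def by (rule rep_class_member)
    moreover have "rep_iso \<MM> coord_scale E'.TS (ev_rep S \<rho>') coord_scale W \<tau>"
      using W unfolding C unfolding map_rep_class_def by (rule rep_class_member)
    ultimately have "rep_iso \<MM> coord_scale E.TS (ev_rep S \<rho>) coord_scale E'.TS (ev_rep S \<rho>')"
      using rep_iso_trans rep_iso_sym[OF E'.ev_rep_lie_representation] by blast
    then obtain T where T: "rep_hom \<MM> coord_scale E.TS (ev_rep S \<rho>) coord_scale E'.TS (ev_rep S \<rho>') T"
      "bij_betw T E.TS E'.TS" unfolding rep_iso_iff_hom by auto
    have T_lin: "linear_on coord_scale coord_scale E.TS T" and T_in: "\<And>w. w \<in> E.TS \<Longrightarrow> T w \<in> E'.TS"
      and T_eq: "\<And>\<alpha> w. \<alpha> \<in> \<MM> \<Longrightarrow> w \<in> E.TS \<Longrightarrow> T (ev_rep S \<rho> \<alpha> w) = ev_rep S \<rho>' \<alpha> (T w)"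
      using T(1) by (auto simp: rep_hom_def)
    have "\<exists>v. v \<in> V y \<and> v \<noteq> 0" if "y \<in> S" for y
      using irreducible_rep_nonzero[OF irrep_familyD(1,3)[OF fam that]] by blast
    then obtain v where v: "\<And>y. y \<in> S \<Longrightarrow> v y \<in> V y" "\<And>y. y \<in> S \<Longrightarrow> v y \<noteq> 0" by metis
    have pv: "pure_tensor S v \<in> E.TS" by (rule E.pure_tensor_in_TS[OF v(1)])
    have T0: "T 0 = 0" by (rule linear_on_0[OF vector_space_coord_scale E.subspace_TS T_lin])
    have "T (pure_tensor S v) \<noteq> 0"
    proof
      assume "T (pure_tensor S v) = 0"
      then have "T (pure_tensor S v) = T 0" by (simp only: T0)
      then have "pure_tensor S v = 0"
        by (rule inj_onD[OF bij_betw_imp_inj_on[OF T(2)] _ pv coord.subspace_0[OF E.subspace_TS]])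
      moreover have "pure_tensor S v \<noteq> 0" by (rule E.pure_tensor_nonzero) (rule v(2))
      ultimately show False by blast
    qed
    then obtain i0 where i0: "T (pure_tensor S v) i0 \<noteq> 0" by (auto simp: fun_eq_iff)
    have i0S: "i0 \<in> extensional S" using E'.TS_support[OF T_in[OF pv]] i0 by blast
    (* Freeze the tensor factors v off x in the source and the indices i0 off x in the target. *)
    define h where "h u = (\<lambda>j. T (pure_tensor S (v(x := u))) (i0(x := j)))" for u
    have pure: "pure_tensor S (v(x := u)) \<in> E.TS" if "u \<in> V x" for u
      by (rule E.pure_tensor_in_TS) (use v(1) that in auto)
    have pure_lin: "linear_on coord_scale coord_scale (V x) (\<lambda>u. pure_tensor S (v(x := u)))"
      by (rule multilinear_on_linear[OF multilinear_pure_tensor[OF S(1)] v(1) xS])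
    have h_in: "h u \<in> V' x" if "u \<in> V x" for u
      unfolding h_def by (rule E'.slice_in[OF T_in[OF pure[OF that]] xS i0S])
    have h_lin: "linear_on coord_scale coord_scale (V x) h"
      unfolding linear_on_def h_def
      by (intro conjI ballI allI)
        (simp_all only: linear_on_add[OF pure_lin] linear_on_scale[OF pure_lin] linear_on_add[OF T_lin]
          linear_on_scale[OF T_lin] pure, auto simp: fun_scale_def)
    have h_eq: "h (\<rho> x a u) = \<rho>' x a (h u)" if a: "a \<in> fixed_algebra \<sigma> x" and u: "u \<in> V x" for a u
    proof -
      obtain \<alpha> where \<alpha>: "\<alpha> \<in> \<MM>" "\<alpha> x = a" "\<And>y. y \<in> S \<Longrightarrow> y \<noteq> x \<Longrightarrow> \<alpha> y = 0"
        using evaluation_surjective[OF S xS a] by auto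
      have "pure_tensor S (v(x := \<rho> x a u)) = slot S x (\<rho> x a) (pure_tensor S (v(x := u)))"
        using E.slot_pure_tensor[OF xS lie_representationD(4)[OF irrep_familyD(1)[OF fam xS] a], of "v(x := u)"] u
        by simp
      also have "\<dots> = ev_rep S \<rho> \<alpha> (pure_tensor S (v(x := u)))"
        using E.ev_rep_supported[OF \<alpha>(1) xS \<alpha>(3) scale_zero_left pure[OF u]] \<alpha>(2) by simp
      finally have "T (pure_tensor S (v(x := \<rho> x a u))) = ev_rep S \<rho>' \<alpha> (T (pure_tensor S (v(x := u))))"
        using T_eq[OF \<alpha>(1) pure[OF u]] by simp
      also have "\<dots> = slot S x (\<rho>' x a) (T (pure_tensor S (v(x := u))))"
        using E'.ev_rep_supported[OF \<alpha>(1) xS \<alpha>(3) scale_zero_left T_in[OF pure[OF u]]] \<alpha>(2) by simp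
      finally show ?thesis
        unfolding h_def using extensional_upd[OF i0S xS] by (simp add: slot_def)
    qed
    have "h (v x) (i0 x) \<noteq> 0" using i0 by (simp add: h_def)
    then have h_nz: "h (v x) \<noteq> 0" by auto
    have "rep_hom (fixed_algebra \<sigma> x) coord_scale (V x) (\<rho> x) coord_scale (V' x) (\<rho>' x) h"
      unfolding rep_hom_def using h_in h_lin h_eq by blast
    from irreducible_rep_hom_iso[where T = h, OF irrep_familyD(1)[OF fam xS] irrep_familyD(1)[OF fam' xS]
        irrep_familyD(3)[OF fam xS] irrep_familyD(3)[OF fam' xS] this v(1)[OF xS] h_nz]
    have iso: "rep_iso (fixed_algebra \<sigma> x) coord_scale (V x) (\<rho> x) coord_scale (V' x) (\<rho>' x)" .
    have "(V x, \<rho> x) \<in> \<Psi> x" "(V' x, \<rho>' x) \<in> \<Psi>' x" using d d' xS by (auto simp: evaluation_data_def)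
    from irreps_eqI[OF \<E>D(1)[OF \<Psi> x] \<E>D(1)[OF \<Psi>' x] this iso] show ?thesis .
  qed
qed

lemma irreducible_is_tensor_product:
  assumes "lie_representation fsc fbr \<MM> sV V \<rho>" "finite_dimensional sV V" "irreducible_rep \<MM> sV V \<rho>"
  shows "\<exists>X W \<tau>. finite X \<and> X \<subseteq> X_rat \<and> inj_on (\<lambda>x. x + inverse x) X \<and> irrep_family X W \<tau> \<and>
    rep_iso \<MM> sV V \<rho> coord_scale (tensor_space X W) (ev_rep X \<tau>)"
proof -
  interpret R: irreducible_map_rep scale bracket \<sigma> sV V \<rho>
    by (intro irreducible_map_rep.intro involution_lie_algebra_axioms ac_vector_space.intro
        lie_representationD(1)[OF assms(1)] irreducible_map_rep_axioms.intro assms)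
  obtain X where X: "finite X" "X \<subseteq> X_rat" "inj_on (\<lambda>x. x + inverse x) X"
    "\<forall>\<alpha>\<in>\<MM>. (\<forall>x\<in>X. \<alpha> x = 0) \<longrightarrow> (\<forall>v\<in>V. \<rho> \<alpha> v = 0)"
    using R.factors_through_evaluation by auto
  interpret S: supported_map_rep scale bracket \<sigma> sV V \<rho> X
    by unfold_locales (use X in auto)
  show ?thesis using S.iso_tensor_product X by blast
qed

lemma evaluation_rep_of_irreducible:
  assumes "lie_representation fsc fbr \<MM> sV V \<rho>" "finite_dimensional sV V" "irreducible_rep \<MM> sV V \<rho>"
  shows "is_evaluation_rep scale bracket \<sigma> sV V \<rho>"
proof -
  obtain X W \<tau> where "finite X" "X \<subseteq> X_rat" "irrep_family X W \<tau>"
    "rep_iso \<MM> sV V \<rho> coord_scale (tensor_space X W) (ev_rep X \<tau>)"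
    using irreducible_is_tensor_product[OF assms] by auto
  then show ?thesis unfolding is_evaluation_rep_def irrep_family_def by blast
qed

text \<open>A tensor product of irreducible representations at the points of \<open>X\<close> comes from the equivariant function
  with these values that is trivial off the orbits of \<open>X\<close>.\<close>

lemma ev_class_surjective:
  assumes C: "C \<in> map_irreps scale bracket \<sigma>"
  shows "\<exists>\<Psi>\<in>\<E>. ev_class scale bracket \<sigma> \<Psi> = C"
proof -
  have "\<exists>(V0 :: (nat \<Rightarrow> 'k) set) \<rho>0. C = rep_class fsc fbr \<MM> coord_scale V0 \<rho>0 \<and>
      lie_representation fsc fbr \<MM> coord_scale V0 \<rho>0 \<and> finite_dimensional coord_scale V0 \<and>
      irreducible_rep \<MM> coord_scale V0 \<rho>0"
    using C unfolding map_irreps_def irreps_def by simp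
  then obtain V0 :: "(nat \<Rightarrow> 'k) set" and \<rho>0 where V0: "C = rep_class fsc fbr \<MM> coord_scale V0 \<rho>0"
    "lie_representation fsc fbr \<MM> coord_scale V0 \<rho>0" "finite_dimensional coord_scale V0"
    "irreducible_rep \<MM> coord_scale V0 \<rho>0"
    by blast
  obtain X W \<tau> where X: "finite X" "X \<subseteq> X_rat" "inj_on (\<lambda>x. x + inverse x) X" and fam: "irrep_family X W \<tau>"
    and iso: "rep_iso \<MM> coord_scale V0 \<rho>0 coord_scale (tensor_space X W) (ev_rep X \<tau>)"
    using irreducible_is_tensor_product[OF V0(2-4)] by auto
  let ?triv = "\<lambda>x. trivial_class scale bracket (fixed_algebra \<sigma> x)"
  define K where "K x = rep_class scale bracket (fixed_algebra \<sigma> x) coord_scale (W x) (\<tau> x)" for x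
  have K: "K x \<in> irreps scale bracket (fixed_algebra \<sigma> x)" if "x \<in> X" for x
    unfolding K_def by (rule rep_class_in_irreps[OF irrep_familyD(1-3)[OF fam that]])
  (* The values on X determine the values on the inverses of the points of X by equivariance; if a point
     and its inverse both lie in X, they are equal, since distinct points of X have distinct orbits. *)
  define \<Psi> where "\<Psi> x = (if x \<notin> X_rat then undefined else if x \<in> X then K x
    else if inverse x \<in> X then act_class \<sigma> 1 (K (inverse x)) else ?triv x)" for x
  have fixed_pt: "inverse x = x" if "x \<in> X" "inverse x \<in> X" for x
    using inj_onD[OF X(3), of "inverse x" x] that by (simp add: add.commute)
  have \<Psi>_irr: "\<Psi> x \<in> irreps scale bracket (fixed_algebra \<sigma> x)" if "x \<in> X_rat" for x
  proof (cases "x \<in> X")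
    case True
    then show ?thesis using that K by (simp add: \<Psi>_def)
  next
    case False
    then show ?thesis
      using that act_class_irreps[OF K[of "inverse x"]] trivial_class_in_irreps
      by (auto simp: \<Psi>_def fixed_algebra_inverse)
  qed
  have supp_sub: "supp \<Psi> \<subseteq> X \<union> inverse ` X"
  proof
    fix x assume x: "x \<in> supp \<Psi>"
    have "x \<in> X \<or> inverse x \<in> X"
    proof (rule ccontr)
      assume "\<not> ?thesis"
      then have "\<Psi> x = ?triv x" using x by (simp add: \<Psi>_def class_supp_def)
      then show False using x by (simp add: class_supp_def)
    qed
    then show "x \<in> X \<union> inverse ` X" by (metis UnI1 UnI2 image_eqI inverse_inverse_eq)
  qed
  have inv: "\<Psi> (inverse x) = act_class \<sigma> 1 (\<Psi> x)" if x: "x \<in> X_rat" for x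
  proof -
    have xR: "inverse x \<in> X_rat" using x by (simp add: X_rat_def)
    consider "x \<in> X" "inverse x \<in> X" | "x \<in> X" "inverse x \<notin> X" | "x \<notin> X" "inverse x \<in> X" | "x \<notin> X" "inverse x \<notin> X"
      by blast
    then show ?thesis
    proof cases
      case 1
      then show ?thesis using fixed_pt[OF 1] act_class_fixed_point[OF fixed_pt[OF 1] \<Psi>_irr[OF x]] by simp
    next
      case 2
      then show ?thesis using x xR by (simp add: \<Psi>_def)
    next
      case 3
      then show ?thesis using x xR by (simp add: \<Psi>_def act_class_1_1)
    next
      case 4
      then show ?thesis using x xR by (simp add: \<Psi>_def act_class_trivial fixed_algebra_inverse)
    qed
  qed
  have "\<Psi> \<in> \<E>"
    unfolding equivariant_class_funs_def
  proof (intro CollectI conjI allI ballI)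
    show "\<Psi> \<in> (\<Pi>\<^sub>E x\<in>X_rat. irreps scale bracket (fixed_algebra \<sigma> x))"
      by (rule PiE_I) (use \<Psi>_irr in \<open>auto simp: \<Psi>_def\<close>)
    show "finite (supp \<Psi>)" by (rule finite_subset[OF supp_sub]) (use X in simp)
    show "\<Psi> (act_X \<gamma> x) = act_class \<sigma> \<gamma> (\<Psi> x)" if "x \<in> X_rat" for \<gamma> x
    proof (cases "\<gamma> = 0")
      case True
      then show ?thesis by (simp add: act_X_def act_class_0)
    next
      case False
      then have "\<gamma> = 1" by simp
      then show ?thesis using inv[OF that] by (simp add: act_X_def)
    qed
  qed
  moreover have "evaluation_data \<Psi> X W \<tau>"
    unfolding evaluation_data_def
  proof (intro conjI ballI)
    show "\<exists>y\<in>X. x + inverse x = y + inverse y" if "x \<in> supp \<Psi>" for x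
    proof -
      have "x \<in> X \<or> x \<in> inverse ` X" using that supp_sub by blast
      then show ?thesis by (auto intro: bexI[rotated] simp: add.commute)
    qed
    show "(W x, \<tau> x) \<in> \<Psi> x" if "x \<in> X" for x
      using that X(2) rep_class_self[OF irrep_familyD(1)[OF fam that]] by (auto simp: \<Psi>_def K_def)
  qed (rule X)+
  ultimately have "ev_class scale bracket \<sigma> \<Psi> = C"
    unfolding V0(1) rep_class_eqI[OF V0(2) iso] by (simp add: ev_class_data map_rep_class_def)
  then show ?thesis using \<open>\<Psi> \<in> \<E>\<close> by blast
qed

theorem ev_class_bij: "bij_betw (ev_class scale bracket \<sigma>) \<E> (map_irreps scale bracket \<sigma>)"
  unfolding bij_betw_def
proof
  show "inj_on (ev_class scale bracket \<sigma>) \<E>" by (rule inj_onI) (rule ev_class_injective)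
  show "ev_class scale bracket \<sigma> ` \<E> = map_irreps scale bracket \<sigma>"
    using ev_class_in_irreps ev_class_surjective by blast
qed

end

section \<open>The Chevalley involution\<close>

text \<open>The automorphism \<open>\<sigma> \<circ> \<sigma>\<close> fixes the generators.  If \<open>\<sigma>\<close> were the identity, then \<open>f i = - e i\<close>; but \<open>h i\<close> acts on
  \<open>e i\<close> and on \<open>f i\<close> by \<open>2\<close> and \<open>-2\<close>.\<close>

lemma chevalley_involution_order_two:
  fixes scale :: "'k::{alg_closed_field, field_char_0} \<Rightarrow> 'g::ab_group_add \<Rightarrow> 'g"
  assumes simple: "simple_lie_algebra scale bracket"
    and gen: "lie_algebra.chevalley_generators scale bracket I e f h"
    and inv: "lie_algebra.chevalley_involution scale bracket I e f h \<sigma>"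
  shows "lie_algebra.lie_automorphism scale bracket \<sigma>" "\<sigma> \<circ> \<sigma> = id" "\<sigma> \<noteq> id"
proof -
  interpret simple_lie_algebra scale bracket by fact
  show aut: "lie_automorphism \<sigma>" using inv by (simp add: chevalley_involution_def)
  have lin: "Vector_Spaces.linear scale scale \<sigma>" and br: "\<And>x y. \<sigma> (bracket x y) = bracket (\<sigma> x) (\<sigma> y)"
    using aut by (auto simp: lie_automorphism_def)
  interpret \<sigma>: Vector_Spaces.linear scale scale \<sigma> by (rule lin)
  have \<sigma>: "\<And>i. i \<in> I \<Longrightarrow> \<sigma> (e i) = - f i" "\<And>i. i \<in> I \<Longrightarrow> \<sigma> (f i) = - e i" "\<And>i. i \<in> I \<Longrightarrow> \<sigma> (h i) = - h i"
    using inv by (auto simp: chevalley_involution_def)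
  have min: "L = UNIV" if "lie_subalgebra L" "e ` I \<union> f ` I \<union> h ` I \<subseteq> L" for L
    using gen that by (auto simp: chevalley_generators_def)
  have "{u. \<sigma> (\<sigma> u) = u} = UNIV"
    by (rule min) (auto simp: lie_subalgebra_def subspace_def \<sigma>.add \<sigma>.scale \<sigma>.zero br \<sigma> \<sigma>.neg)
  then show "\<sigma> \<circ> \<sigma> = id" by (auto simp: fun_eq_iff)
  show "\<sigma> \<noteq> id"
  proof
    assume id: "\<sigma> = id"
    have I: "I \<noteq> {}"
    proof
      assume "I = {}"
      then have "({0} :: 'g set) = UNIV"
        using bracket_self[of 0] by (intro min) (auto simp: lie_subalgebra_def)
      then have "bracket x y = 0" for x y by (metis UNIV_I singletonD)
      then show False using nonabelian by blast
    qed
    then obtain i where i: "i \<in> I" by auto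
    obtain H \<alpha> where H: "simple_roots H I \<alpha>" "\<forall>i\<in>I. e i \<in> root_space H (\<alpha> i) \<and>
        f i \<in> root_space H (\<lambda>x. - \<alpha> i x) \<and> h i \<in> H \<and> bracket (e i) (f i) = h i \<and> \<alpha> i (h i) = 2"
      using gen unfolding chevalley_generators_def by blast
    have ef: "bracket (h i) (e i) = scale 2 (e i)" "bracket (h i) (f i) = scale (- 2) (f i)"
      "bracket (e i) (f i) = h i"
      using H(2) i by (auto simp: root_space_def)
    have f: "f i = - e i" using \<sigma>(1)[OF i] id by (metis id_apply minus_minus)
    have "h i = bracket (e i) (scale (- 1) (e i))" using ef(3) f by simp
    then have h: "h i = 0" by (simp only: bracket_scale_right bracket_self scale_zero_right)
    have "\<alpha> i \<in> dual H" using H(1) i by (auto simp: simple_roots_def roots_def)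
    then have "\<forall>c. \<forall>x\<in>H. \<alpha> i (scale c x) = c * \<alpha> i x" by (simp add: dual_def)
    moreover have "h i \<in> H" using H(2) i by blast
    ultimately have "\<alpha> i (scale 0 (h i)) = 0 * \<alpha> i (h i)" by blast
    then have "\<alpha> i 0 = 0" by simp
    moreover have "\<alpha> i (h i) = 2" using H(2) i by auto
    ultimately show False using h by simp
  qed
qed

section \<open>The classification\<close>

theorem proposition6p2:
  fixes scale :: "'k::{alg_closed_field, field_char_0} \<Rightarrow> 'g::ab_group_add \<Rightarrow> 'g"
    and bracket :: "'g \<Rightarrow> 'g \<Rightarrow> 'g"
  assumes "simple_lie_algebra scale bracket"
  shows
    "(\<forall>\<sigma>. lie_algebra.lie_automorphism scale bracket \<sigma> \<and> \<sigma> \<circ> \<sigma> = id \<and> \<sigma> \<noteq> id \<longrightarrow>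
        bij_betw (ev_class scale bracket \<sigma>)
          (equivariant_class_funs scale bracket \<sigma>) (map_irreps scale bracket \<sigma>) \<and>
        (\<forall>(sV :: 'k \<Rightarrow> 'v::ab_group_add \<Rightarrow> 'v) V \<rho>.
           lie_representation (fun_scale scale) (fun_bracket bracket) (map_algebra scale \<sigma>) sV V \<rho> \<and>
           finite_dimensional sV V \<and> irreducible_rep (map_algebra scale \<sigma>) sV V \<rho> \<longrightarrow>
           is_evaluation_rep scale bracket \<sigma> sV V \<rho>))
   \<and> (\<forall>(I :: 'i set) e f h \<sigma>.
        lie_algebra.chevalley_generators scale bracket I e f h \<and>
        lie_algebra.chevalley_involution scale bracket I e f h \<sigma> \<longrightarrow>
        bij_betw (ev_class scale bracket \<sigma>)
          (equivariant_class_funs scale bracket \<sigma>) (map_irreps scale bracket \<sigma>) \<and>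
        (\<forall>(sV :: 'k \<Rightarrow> 'v \<Rightarrow> 'v) V \<rho>.
           lie_representation (fun_scale scale) (fun_bracket bracket) (map_algebra scale \<sigma>) sV V \<rho> \<and>
           finite_dimensional sV V \<and> irreducible_rep (map_algebra scale \<sigma>) sV V \<rho> \<longrightarrow>
           is_evaluation_rep scale bracket \<sigma> sV V \<rho>))"
proof -
  have main: "bij_betw (ev_class scale bracket \<sigma>)
        (equivariant_class_funs scale bracket \<sigma>) (map_irreps scale bracket \<sigma>) \<and>
      (\<forall>(sV :: 'k \<Rightarrow> 'v \<Rightarrow> 'v) V \<rho>.
         lie_representation (fun_scale scale) (fun_bracket bracket) (map_algebra scale \<sigma>) sV V \<rho> \<and>
         finite_dimensional sV V \<and> irreducible_rep (map_algebra scale \<sigma>) sV V \<rho> \<longrightarrow>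
         is_evaluation_rep scale bracket \<sigma> sV V \<rho>)"
    if "lie_algebra.lie_automorphism scale bracket \<sigma>" "\<sigma> \<circ> \<sigma> = id" "\<sigma> \<noteq> id" for \<sigma>
  proof -
    interpret involution_lie_algebra scale bracket \<sigma>
      by (intro involution_lie_algebra.intro involution_lie_algebra_axioms.intro assms that)
    show ?thesis using ev_class_bij evaluation_rep_of_irreducible by blast
  qed
  show ?thesis
  proof (intro conjI[OF allI[OF impI] allI[OF allI[OF allI[OF allI[OF allI[OF impI]]]]]])
    fix \<sigma> assume "lie_algebra.lie_automorphism scale bracket \<sigma> \<and> \<sigma> \<circ> \<sigma> = id \<and> \<sigma> \<noteq> id"
    then show "bij_betw (ev_class scale bracket \<sigma>)
        (equivariant_class_funs scale bracket \<sigma>) (map_irreps scale bracket \<sigma>) \<and>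
      (\<forall>(sV :: 'k \<Rightarrow> 'v \<Rightarrow> 'v) V \<rho>.
         lie_representation (fun_scale scale) (fun_bracket bracket) (map_algebra scale \<sigma>) sV V \<rho> \<and>
         finite_dimensional sV V \<and> irreducible_rep (map_algebra scale \<sigma>) sV V \<rho> \<longrightarrow>
         is_evaluation_rep scale bracket \<sigma> sV V \<rho>)"
      using main by blast
  next
    fix I :: "'i set" and e f h \<sigma>
    assume "lie_algebra.chevalley_generators scale bracket I e f h \<and>
        lie_algebra.chevalley_involution scale bracket I e f h \<sigma>"
    then show "bij_betw (ev_class scale bracket \<sigma>)
        (equivariant_class_funs scale bracket \<sigma>) (map_irreps scale bracket \<sigma>) \<and>
      (\<forall>(sV :: 'k \<Rightarrow> 'v \<Rightarrow> 'v) V \<rho>.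
         lie_representation (fun_scale scale) (fun_bracket bracket) (map_algebra scale \<sigma>) sV V \<rho> \<and>
         finite_dimensional sV V \<and> irreducible_rep (map_algebra scale \<sigma>) sV V \<rho> \<longrightarrow>
         is_evaluation_rep scale bracket \<sigma> sV V \<rho>)"
      using main chevalley_involution_order_two[OF assms] by blast
  qed
qed

end
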